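(* Let $n\ge 2$. There exists a function $f\in L^1(\mathbb S^n)$ such that $$\limsup_{R\rightarrow\infty}\big|\widetilde S_R^{\frac{n-1}{2}} f(x)\big|=\infty\quad\text{for almost every } x\in\mathbb S^n,$$ where, for $\delta>0$ and $R>0$, $$\widetilde S^\delta_R f = \sum_{0\le k<R} \left(1-\frac{k}{R}\right)^\delta \mathrm{proj}_k f$$ denotes the Riesz $(R,\delta)$ mean of $f$.
   Context: $\mathbb S^n\subset\mathbb R^{n+1}$ is the unit sphere with the uniform measure $dy$ (normalized to total mass $1$). For $f\in L^1(\mathbb S^n)$ and $k=0,1,\dots$, $\mathrm{proj}_k f$ is the spherical harmonic component of degree $k$ of $f$: $$\mathrm{proj}_k f(x)=\int_{\mathbb S^n} Z_k(x,y) f(y)\,dy,\qquad Z_k(x,y)=\frac{k+\lambda}{\lambda}\,C_k^\lambda(\langle x,y\rangle),\quad \lambda=\frac{n-1}{2},$$ with $C_k^\lambda$ the Gegenbauer polynomial of degree $k$ and index $\lambda$; on $L^2(\mathbb S^n)$ it is the orthogonal projection onto the space of spherical harmonics of degree $k$. The sum over $k$ runs over nonnegative integers, and $R$ ranges over positive real numbers. *)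

theory Defs
  imports "HOL-Analysis.Analysis"
begin

section \<open>The uniform probability measure on the unit sphere\<close>

text \<open>
  Radial projection of the uniform distribution on the unit ball
  (\<^term>\<open>sgn x\<close> is \<open>x / norm x\<close>). The origin is a null set, so the total mass is 1;
  the lemmas below record this and the invariance under orthogonal maps.
\<close>

definition sphere_measure :: "'a::euclidean_space measure" where
  "sphere_measure =
     restrict_space (distr (uniform_measure lborel (ball 0 1)) borel sgn) (sphere 0 1)"

lemma space_sphere_measure: "space sphere_measure = sphere 0 1"
  by (simp add: sphere_measure_def space_restrict_space)

lemma sets_sphere_measure: "sets sphere_measure = sets (restrict_space borel (sphere 0 1))"
  by (simp add: sphere_measure_def sets_restrict_space)

lemma emeasure_sphere_measure:
  fixes A :: "'a::euclidean_space set"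
  assumes "A \<in> sets borel" "A \<subseteq> sphere 0 1"
  shows "emeasure sphere_measure A =
           emeasure lborel (ball 0 1 \<inter> sgn -` A) / emeasure lborel (ball (0::'a) 1)"
proof -
  have "sgn -` A \<in> sets (borel :: 'a measure)"
    using measurable_sets_borel[OF borel_measurable_sgn assms(1)] by simp
  then show ?thesis
    using assms
    by (simp add: sphere_measure_def emeasure_restrict_space emeasure_distr)
qed

lemma emeasure_unit_ball: "emeasure lborel (ball (0::'a::euclidean_space) 1) \<noteq> 0"
  "emeasure lborel (ball (0::'a::euclidean_space) 1) \<noteq> \<infinity>"
  subgoal by (metis content_ball_pos emeasure_eq_ennreal_measure measure_def enn2real_0 less_irrefl zero_less_one)
  subgoal using emeasure_lborel_ball_finite[of "0::'a" 1] by auto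
  done

lemma emeasure_sphere_measure_total: "emeasure sphere_measure (sphere (0::'a::euclidean_space) 1) = 1"
proof -
  have "ball (0::'a) 1 \<inter> sgn -` sphere 0 1 = ball 0 1 - {0}"
    by (auto simp: norm_sgn split: if_splits)
  then have "emeasure sphere_measure (sphere (0::'a) 1) = emeasure lborel (ball (0::'a) 1 - {0}) / emeasure lborel (ball (0::'a) 1)"
    by (simp add: emeasure_sphere_measure)
  also have "emeasure lborel (ball (0::'a) 1 - {0}) = emeasure lborel (ball (0::'a) 1)"
    by (intro emeasure_Diff_null_set) (auto simp: null_sets_def)
  finally show ?thesis
    using emeasure_unit_ball[where 'a='a] by (simp add: ennreal_divide_self less_top)
qed

lemma lborel_orthogonal_invariant:
  fixes T :: "'a::euclidean_space \<Rightarrow> 'a"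
  assumes T: "orthogonal_transformation T"
  shows "distr lborel borel T = (lborel :: 'a measure)"
proof -
  define N where "N = distr (lborel :: 'a measure) borel T"
  have lin: "linear T" using T by (simp add: orthogonal_transformation_linear)
  then have Tm[measurable]: "T \<in> borel_measurable borel"
    by (intro borel_measurable_continuous_onI linear_continuous_on linear_conv_bounded_linear[THEN iffD1])
  have setsN[simp, measurable_cong]: "sets N = sets borel" and spN[simp]: "space N = UNIV"
    by (auto simp: N_def)
  have balls: "T -` ball 0 r = ball 0 r" for r
    using T by (auto simp: orthogonal_transformation_norm)
  have ballN: "emeasure N (ball 0 r) = emeasure lborel (ball (0::'a) r)" for r
    unfolding N_def by (subst emeasure_distr) (auto simp: balls)
  have transL: "emeasure lborel {y. y - x \<in> A} = emeasure lborel A" if "A \<in> sets borel" for A and x :: 'a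
    by (subst (2) lborel_distr_plus[of "- x", symmetric]) (use that in \<open>simp add: emeasure_distr vimage_def\<close>)
  have transN: "emeasure N {y. y - x \<in> A} = emeasure N A" if [measurable]: "A \<in> sets borel" for A x
  proof -
    obtain z where z: "x = T z" using T orthogonal_transformation_surj by (metis surjD)
    have "emeasure N {y. y - x \<in> A} = emeasure lborel {y. T y - T z \<in> A}"
      unfolding N_def z by (subst emeasure_distr) (auto simp: vimage_def)
    also have "\<dots> = emeasure lborel {y. y - z \<in> {w. T w \<in> A}}"
      by (simp add: linear_diff[OF lin])
    also have "\<dots> = emeasure lborel {w. T w \<in> A}"
      by (rule transL) measurable
    also have "\<dots> = emeasure N A"
      unfolding N_def by (subst emeasure_distr) (auto simp: vimage_def)
    finally show ?thesis .
  qed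
  have reflL: "emeasure lborel {x. y - x \<in> A} = emeasure lborel A" if [measurable]: "A \<in> sets borel" for A and y :: 'a
  proof -
    have "emeasure lborel {x. y - x \<in> A} = emeasure (distr lborel borel (\<lambda>x. y + (-1) *\<^sub>R x)) A"
      by (simp add: emeasure_distr vimage_def)
    also have "distr lborel borel (\<lambda>x. y + (-1) *\<^sub>R x) = lborel"
      using lborel_affine[of "-1" y] by (simp add: density_1)
    finally show ?thesis .
  qed
  have sfN: "sigma_finite_measure N"
  proof (rule sigma_finite_measure.intro, intro exI conjI)
    show "countable (range (\<lambda>n::nat. ball (0::'a) (real n)))" by simp
    show "range (\<lambda>n::nat. ball (0::'a) (real n)) \<subseteq> sets N" by auto
    show "\<Union> (range (\<lambda>n::nat. ball (0::'a) (real n))) = space N"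
      by (auto intro: reals_Archimedean2)
    show "\<forall>a\<in>range (\<lambda>n::nat. ball (0::'a) (real n)). emeasure N a \<noteq> \<infinity>"
      using emeasure_lborel_ball_finite by (auto simp: ballN less_top)
  qed
  interpret N: sigma_finite_measure N by (rule sfN)
  interpret P: pair_sigma_finite "lborel :: 'a measure" N
    by unfold_locales
  interpret Q: pair_sigma_finite "N" "lborel :: 'a measure"
    by unfold_locales
  have key: "emeasure lborel A * emeasure N B = emeasure lborel B * emeasure N A"
    if [measurable]: "A \<in> sets borel" "B \<in> sets borel" for A B
  proof -
    have "emeasure lborel A * emeasure N B = (\<integral>\<^sup>+x. emeasure N B * indicator A x \<partial>lborel)"
      by (subst nn_integral_cmult_indicator) (auto simp: mult.commute)
    also have "\<dots> = (\<integral>\<^sup>+x. (\<integral>\<^sup>+y. indicator A x * indicator B (y - x) \<partial>N) \<partial>lborel)"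
    proof (rule nn_integral_cong)
      fix x :: 'a
      have "(\<integral>\<^sup>+y. indicator A x * indicator B (y - x) \<partial>N) = indicator A x * (\<integral>\<^sup>+y. indicator {y. y - x \<in> B} y \<partial>N)"
        by (subst nn_integral_cmult[symmetric], measurable, intro nn_integral_cong) (auto simp: indicator_def)
      also have "\<dots> = indicator A x * emeasure N B"
        by (simp add: transN nn_integral_indicator)
      finally show "emeasure N B * indicator A x = (\<integral>\<^sup>+y. indicator A x * indicator B (y - x) \<partial>N)"
        by (simp add: mult.commute)
    qed
    also have "\<dots> = (\<integral>\<^sup>+y. (\<integral>\<^sup>+x. indicator A x * indicator B (y - x) \<partial>lborel) \<partial>N)"
      by (rule Q.Fubini') measurable
    also have "\<dots> = (\<integral>\<^sup>+y. (\<integral>\<^sup>+z. indicator B z * indicator A (y - z) \<partial>lborel) \<partial>N)"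
    proof (rule nn_integral_cong)
      fix y :: 'a
      have "(\<integral>\<^sup>+x. indicator A x * indicator B (y - x) \<partial>lborel) = (\<integral>\<^sup>+x. indicator {x \<in> A. y - x \<in> B} x \<partial>lborel)"
        by (intro nn_integral_cong) (auto simp: indicator_def)
      also have "\<dots> = emeasure lborel {x. x \<in> A \<and> y - x \<in> B}" by simp
      also have "\<dots> = emeasure lborel {x. y - x \<in> {z. z \<in> B \<and> y - z \<in> A}}"
        by (rule arg_cong[where f = "emeasure lborel"]) auto
      also have "\<dots> = emeasure lborel {z. z \<in> B \<and> y - z \<in> A}"
        by (rule reflL) measurable
      also have "\<dots> = (\<integral>\<^sup>+x. indicator {z \<in> B. y - z \<in> A} x \<partial>lborel)" by simp
      also have "\<dots> = (\<integral>\<^sup>+z. indicator B z * indicator A (y - z) \<partial>lborel)"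
        by (intro nn_integral_cong) (auto simp: indicator_def)
      finally show "(\<integral>\<^sup>+x. indicator A x * indicator B (y - x) \<partial>lborel) = (\<integral>\<^sup>+z. indicator B z * indicator A (y - z) \<partial>lborel)" .
    qed
    also have "\<dots> = (\<integral>\<^sup>+z. (\<integral>\<^sup>+y. indicator B z * indicator A (y - z) \<partial>N) \<partial>lborel)"
      by (rule P.Fubini') measurable
    also have "\<dots> = (\<integral>\<^sup>+z. emeasure N A * indicator B z \<partial>lborel)"
    proof (rule nn_integral_cong)
      fix x :: 'a
      have "(\<integral>\<^sup>+y. indicator B x * indicator A (y - x) \<partial>N) = indicator B x * (\<integral>\<^sup>+y. indicator {y. y - x \<in> A} y \<partial>N)"
        by (subst nn_integral_cmult[symmetric], measurable, intro nn_integral_cong) (auto simp: indicator_def)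
      also have "\<dots> = indicator B x * emeasure N A"
        by (simp add: transN nn_integral_indicator)
      finally show "(\<integral>\<^sup>+y. indicator B x * indicator A (y - x) \<partial>N) = emeasure N A * indicator B x"
        by (simp add: mult.commute)
    qed
    also have "\<dots> = emeasure lborel B * emeasure N A"
      by (subst nn_integral_cmult_indicator) (auto simp: mult.commute)
    finally show ?thesis .
  qed
  have "emeasure N B = emeasure lborel B" if "B \<in> sets borel" for B
    using key[of "ball 0 1" B] that emeasure_unit_ball[where 'a='a]
    by (simp add: ballN mult.commute[of _ "emeasure lborel (ball 0 1)"] ennreal_mult_cancel_left)
  then show ?thesis
    unfolding N_def[symmetric] by (intro measure_eqI) auto
qed

lemma sphere_measure_orthogonal_invariant:
  fixes T :: "'a::euclidean_space \<Rightarrow> 'a"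
  assumes T: "orthogonal_transformation T" and A: "A \<in> sets sphere_measure"
  shows "emeasure sphere_measure (T -` A) = emeasure sphere_measure A"
proof -
  have lin: "linear T" using T by (simp add: orthogonal_transformation_linear)
  then have Tm[measurable]: "T \<in> borel_measurable borel"
    by (intro borel_measurable_continuous_onI linear_continuous_on linear_conv_bounded_linear[THEN iffD1])
  have A': "A \<in> sets borel" "A \<subseteq> sphere 0 1"
    using A by (auto simp: sets_sphere_measure sets_restrict_space)
  have TA: "T -` A \<in> sets borel" "T -` A \<subseteq> sphere 0 1"
    using A' T measurable_sets_borel[OF Tm A'(1)] by (auto simp: orthogonal_transformation_norm)
  have sg: "sgn (T x) = T (sgn x)" for x
    using T by (simp add: sgn_div_norm orthogonal_transformation_norm linear_scale[OF lin])
  have S: "ball 0 1 \<inter> sgn -` A \<in> sets borel"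
    using measurable_sets_borel[OF borel_measurable_sgn A'(1)] by simp
  have "emeasure lborel (ball 0 1 \<inter> sgn -` A) = emeasure (distr lborel borel T) (ball 0 1 \<inter> sgn -` A)"
    by (simp add: lborel_orthogonal_invariant[OF T])
  also have "\<dots> = emeasure lborel (T -` (ball 0 1 \<inter> sgn -` A))"
    using S by (simp add: emeasure_distr)
  also have "T -` (ball 0 1 \<inter> sgn -` A) = ball 0 1 \<inter> sgn -` (T -` A)"
    using T by (auto simp: sg orthogonal_transformation_norm)
  finally show ?thesis
    using A' TA by (simp add: emeasure_sphere_measure)
qed


section \<open>Gegenbauer polynomials\<close>

text \<open>
  Generating function \<open>(1 - 2 t X + X\<^sup>2) powr (- l) = (\<Sum>k. gegenbauer k l t * X ^ k)\<close>,
  read as a formal power series in \<open>X\<close>; \<^term>\<open>fps_binomial (- l)\<close> is the binomial series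
  of exponent \<open>- l\<close>.
\<close>

definition gegenbauer :: "nat \<Rightarrow> real \<Rightarrow> real \<Rightarrow> real" where
  "gegenbauer k l t =
     fps_nth (fps_compose (fps_binomial (- l)) (fps_X ^ 2 - fps_const (2 * t) * fps_X)) k"

lemma gegenbauer_0: "gegenbauer 0 l t = 1"
  by (simp add: gegenbauer_def)

lemma gegenbauer_1: "gegenbauer 1 l t = 2 * l * t"
  by (simp add: gegenbauer_def fps_compose_nth)

lemma gegenbauer_rec:
  "real (k + 2) * gegenbauer (k + 2) l t =
     2 * (real k + 1 + l) * t * gegenbauer (k + 1) l t - (real k + 2 * l) * gegenbauer k l t"
proof -
  define g :: "real fps" where "g = fps_X ^ 2 - fps_const (2 * t) * fps_X"
  define F where "F = fps_binomial (- l) oo g"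
  have g0: "fps_nth g 0 = 0" by (simp add: g_def)
  have "(1 + fps_X) * fps_deriv (fps_binomial (- l)) = fps_const (- l) * fps_binomial (- l)"
    unfolding fps_binomial_deriv by (simp add: fps_divide_unit mult.commute[of "1 + fps_X"] inverse_mult_eq_1 mult.assoc del: fps_const_neg)
  then have "((1 + fps_X) * fps_deriv (fps_binomial (- l))) oo g = (fps_const (- l) * fps_binomial (- l)) oo g"
    by simp
  then have "(1 + g) * (fps_deriv (fps_binomial (- l)) oo g) = fps_const (- l) * F"
    by (simp add: fps_compose_mult_distrib[OF g0] fps_compose_add_distrib fps_X_fps_compose_startby0[OF g0] F_def del: fps_const_neg)
  then have "(1 + g) * fps_deriv F = fps_const (- l) * F * fps_deriv g"
    by (simp add: F_def fps_compose_deriv[OF g0] mult.assoc[symmetric])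
  moreover have "(1 + g) * fps_deriv F = fps_deriv F + fps_X * (fps_X * fps_deriv F) - fps_const (2*t) * (fps_X * fps_deriv F)"
    by (simp add: g_def algebra_simps power2_eq_square)
  moreover have "fps_const (- l) * F * fps_deriv g = fps_const (-2*l) * (fps_X * F) + fps_const (2 * l * t) * F"
  proof -
    have d: "fps_deriv g = fps_const 2 * fps_X - fps_const (2 * t)"
      by (simp add: g_def power2_eq_square numeral_fps_const[symmetric])
    have m: "fps_const (-2 * l) = fps_const (- l) * fps_const 2"
      "fps_const (2 * l * t) = - (fps_const (- l) * fps_const (2 * t))" by simp_all
    show ?thesis unfolding d m by (simp only: algebra_simps mult_minus_right right_minus add_0_right add_0_left)
  qed
  ultimately have
    "fps_nth (fps_deriv F + fps_X * (fps_X * fps_deriv F) - fps_const (2*t) * (fps_X * fps_deriv F)) (Suc k) =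
     fps_nth (fps_const (-2*l) * (fps_X * F) + fps_const (2 * l * t) * F) (Suc k)"
    by simp
  moreover have nth: "fps_nth F j = gegenbauer j l t" for j
    by (simp add: gegenbauer_def F_def g_def)
  ultimately show ?thesis
    by (cases k) (simp_all add: nth, simp_all add: algebra_simps)
qed


section \<open>Spherical harmonic projections and Riesz means\<close>

text \<open>
  For the sphere of dimension \<open>n = DIM('a) - 1\<close> the index is
  \<open>(n - 1) / 2 = (DIM('a) - 2) / 2\<close>.
\<close>

definition zonal_kernel :: "nat \<Rightarrow> 'a::euclidean_space \<Rightarrow> 'a \<Rightarrow> real" where
  "zonal_kernel k x y =
     (let l = (real DIM('a) - 2) / 2 in (real k + l) / l * gegenbauer k l (x \<bullet> y))"

definition sphere_proj :: "nat \<Rightarrow> ('a::euclidean_space \<Rightarrow> real) \<Rightarrow> 'a \<Rightarrow> real" where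
  "sphere_proj k f x = (\<integral>y. zonal_kernel k x y * f y \<partial>sphere_measure)"

definition riesz_mean :: "real \<Rightarrow> real \<Rightarrow> ('a::euclidean_space \<Rightarrow> real) \<Rightarrow> 'a \<Rightarrow> real" where
  "riesz_mean \<delta> R f x =
     (\<Sum>k | real k < R. (1 - real k / R) powr \<delta> * sphere_proj k f x)"

end

theory Submission
  imports Defs "HOL-Real_Asymp.Real_Asymp"
begin

text \<open>
  Fix \<open>l = (n - 1) / 2\<close>. At angle \<open>\<theta>\<close> the kernel of the Riesz mean of order \<open>l\<close> oscillates in \<open>R\<close> with
  frequency \<open>\<theta>\<close> and with an amplitude comparable to \<open>\<theta>\<close> to the power \<open>- n\<close>, for small \<open>\<theta>\<close>. On a sphere of
  dimension \<open>n\<close> this amplitude just fails to be integrable, so a measure of total mass one that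
  consists of many well distributed point masses has, seen from every point \<open>x\<close>, a large sum of
  amplitudes. If the angles between \<open>x\<close> and the point masses satisfy no relation over the integers
  modulo \<open>2 * pi\<close>, then some \<open>R\<close> makes all the oscillations add up, and the Riesz means of the measure
  are large at \<open>x\<close>.

  No asymptotic expansion of the kernel is used. Since \<open>R\<close> to the power \<open>l\<close> times the weight
  \<open>(1 - k / R)\<close> to the power \<open>l\<close> is a function of \<open>R - k\<close>, the Laplace transform in \<open>R\<close> of the means
  factors into the transform of a power and the generating function of the zonal polynomials at
  \<open>exp (- s)\<close>, which is the Poisson kernel (lemmas \<open>zonal_series\<close> and \<open>laplace_riesz_sum\<close>). Its growth
  as \<open>s\<close> tends to \<open>\<i> * \<alpha>\<close> measures the component of frequency \<open>\<alpha>\<close> of the kernel: of maximal order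
  if \<open>\<alpha> = \<theta>\<close>, and of smaller order if \<open>\<alpha>\<close> differs from both \<open>\<theta>\<close> and \<open>- \<theta>\<close> modulo \<open>2 * pi\<close> (lemmas
  \<open>at_resonance\<close> and \<open>off_resonance\<close>). Testing the means against a Riesz product, which is
  nonnegative and contains all the frequencies with the right phases, bounds the sum of the
  amplitudes by the supremum of the means. This is theorem \<open>resonance\<close>.

  Points in general position are found one after another by Fubini's theorem, because
  \<open>{y. x \<bullet> y = v}\<close> is a null set for each \<open>x\<close> (lemma \<open>exists_independent_points\<close>). Replacing the point
  masses by small caps gives functions in the unit ball of the space of integrable functions whose
  means, over a bounded range of \<open>R\<close>, exceed a given bound outside a set of small measure (lemma
  \<open>riesz_mean_peaks\<close>).

  Finally a gliding hump sums such functions with small coefficients. The usual difficulty, that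
  the earlier summands may cancel the new peak, disappears with a choice among many coefficients:
  at each point where the new summand has its peak at most one of them is bad, so one of them is
  bad only on a small set (lemma \<open>small_perturbation\<close>). Since the means are bounded on bounded ranges of \<open>R\<close>, it is enough to make
  their supremum over all \<open>R > 0\<close> infinite.
\<close>


section \<open>The generating function of the zonal polynomials\<close>

text \<open>
  The binomial series of \<open>(1 - c * X)\<close> to the power \<open>- l\<close>. Over the complex numbers the Gegenbauer
  generating function at \<open>cos \<theta>\<close> is the product of two of them, which makes its radius of convergence
  and its modulus visible.
\<close>

definition linear_binomial :: "real \<Rightarrow> complex \<Rightarrow> complex fps" where
  "linear_binomial l c = fps_binomial (- of_real l) oo (fps_const (- c) * fps_X)"

lemma linear_binomial_nth: "fps_nth (linear_binomial l c) n = ((- of_real l) gchoose n) * (- c) ^ n"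
  by (simp add: linear_binomial_def fps_compose_linear mult.commute[of "(- c) ^ n"] del: fps_const_neg)

lemma sums_linear_binomial:
  assumes "norm (c * z) < 1"
  shows "(\<lambda>n. fps_nth (linear_binomial l c) n * z ^ n) sums ((1 - c * z) powr (- of_real l))"
  using gen_binomial_complex[of "- (c * z)" "- of_real l"] assms
  by (simp add: linear_binomial_nth power_mult_distrib[symmetric] mult.assoc)

lemma conv_radius_linear_binomial:
  assumes "norm c = 1"
  shows "fps_conv_radius (linear_binomial l c) \<ge> 1"
  unfolding fps_conv_radius_def
proof (rule conv_radius_geI_ex)
  fix r :: real assume "0 < r" "ereal r < 1"
  then show "\<exists>z. norm z = r \<and> summable (\<lambda>n. fps_nth (linear_binomial l c) n * z ^ n)"
    using sums_linear_binomial[of c "of_real r" l] assms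
    by (intro exI[of _ "of_real r"]) (auto simp: norm_mult sums_iff)
qed

lemma eval_linear_binomial:
  assumes "norm c = 1" "norm z < 1"
  shows "eval_fps (linear_binomial l c) z = (1 - c * z) powr (- of_real l)"
  using sums_linear_binomial[of c z l] assms by (simp add: eval_fps_def sums_iff norm_mult)

lemma linear_binomial_deriv:
  "(1 - fps_const c * fps_X) * fps_deriv (linear_binomial l c) = fps_const (of_real l * c) * linear_binomial l c"
proof -
  define g where "g = fps_const (- c) * (fps_X :: complex fps)"
  have g0: "fps_nth g 0 = 0" by (simp add: g_def)
  have "(1 + fps_X) * fps_deriv (fps_binomial (- of_real l :: complex)) = fps_const (- of_real l) * fps_binomial (- of_real l)"
    unfolding fps_binomial_deriv by (simp add: fps_divide_unit mult.commute[of "1 + fps_X"] inverse_mult_eq_1 mult.assoc del: fps_const_neg)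
  then have "((1 + fps_X) * fps_deriv (fps_binomial (- of_real l :: complex))) oo g = (fps_const (- of_real l) * fps_binomial (- of_real l)) oo g"
    by simp
  then have *: "(1 + g) * (fps_deriv (fps_binomial (- of_real l :: complex)) oo g) = fps_const (- of_real l) * linear_binomial l c"
    unfolding linear_binomial_def g_def[symmetric]
    by (simp add: fps_compose_mult_distrib[OF g0] fps_compose_add_distrib fps_X_fps_compose_startby0[OF g0] del: fps_const_neg)
  have "fps_deriv (linear_binomial l c) = (fps_deriv (fps_binomial (- of_real l)) oo g) * fps_const (- c)"
    unfolding linear_binomial_def g_def[symmetric] fps_compose_deriv[OF g0]
    by (simp add: g_def del: fps_const_neg)
  then have "(1 + g) * fps_deriv (linear_binomial l c) = fps_const (- c) * (fps_const (- of_real l) * linear_binomial l c)"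
    unfolding *[symmetric] by (simp only: mult_ac)
  moreover have "1 + g = 1 - fps_const c * fps_X"
    by (simp add: g_def fps_const_neg[symmetric] del: fps_const_neg)
  ultimately show ?thesis
    by (simp add: mult.assoc[symmetric] mult.commute)
qed

definition gegenbauer_fps :: "real \<Rightarrow> real \<Rightarrow> complex fps" where
  "gegenbauer_fps l \<theta> = linear_binomial l (cis \<theta>) * linear_binomial l (cis (- \<theta>))"

lemma quadratic_factor:
  "(1 - fps_const (cis \<theta>) * fps_X) * (1 - fps_const (cis (- \<theta>)) * fps_X)
    = 1 - fps_const (of_real (2 * cos \<theta>)) * fps_X + fps_X ^ 2"
proof -
  have s: "cis \<theta> + cis (- \<theta>) = of_real (2 * cos \<theta>)"
    by (simp add: complex_eq_iff)
  have p: "cis \<theta> * cis (- \<theta>) = 1" by (simp add: cis_mult)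
  have "(1 - fps_const (cis \<theta>) * fps_X) * (1 - fps_const (cis (- \<theta>)) * fps_X)
     = 1 - fps_const (cis \<theta> + cis (- \<theta>)) * fps_X + fps_const (cis \<theta> * cis (- \<theta>)) * fps_X ^ 2"
    unfolding fps_const_add[symmetric] fps_const_mult[symmetric] by (simp only: algebra_simps power2_eq_square mult_1_left mult_1_right)
  then show ?thesis unfolding s p by simp
qed

text \<open>
  Each factor solves a linear differential equation of first order, hence so does the product.
  Comparison of coefficients turns this equation into the three-term recurrence of the Gegenbauer
  polynomials.
\<close>

lemma gegenbauer_fps_deriv:
  "(1 - fps_const (of_real (2 * cos \<theta>)) * fps_X + fps_X ^ 2) * fps_deriv (gegenbauer_fps l \<theta>)
    = fps_const (of_real l) * (fps_const (of_real (2 * cos \<theta>)) - 2 * fps_X) * gegenbauer_fps l \<theta>"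
proof -
  define a b where "a = linear_binomial l (cis \<theta>)" and "b = linear_binomial l (cis (- \<theta>))"
  define u v where "u = 1 - fps_const (cis \<theta>) * (fps_X :: complex fps)"
    and "v = 1 - fps_const (cis (- \<theta>)) * (fps_X :: complex fps)"
  have ua: "u * fps_deriv a = fps_const (of_real l * cis \<theta>) * a"
    and vb: "v * fps_deriv b = fps_const (of_real l * cis (- \<theta>)) * b"
    using linear_binomial_deriv by (simp_all add: a_def b_def u_def v_def)
  have "u * v * fps_deriv (a * b) = (u * fps_deriv a) * v * b + (v * fps_deriv b) * u * a"
    by (simp add: algebra_simps)
  also have "\<dots> = fps_const (of_real l) * (fps_const (cis \<theta>) * v + fps_const (cis (- \<theta>)) * u) * (a * b)"
    unfolding ua vb fps_const_mult[symmetric] by (simp only: algebra_simps)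
  also have "fps_const (cis \<theta>) * v + fps_const (cis (- \<theta>)) * u
     = fps_const (cis \<theta> + cis (- \<theta>)) - 2 * fps_const (cis \<theta> * cis (- \<theta>)) * fps_X"
    unfolding u_def v_def fps_const_add[symmetric] fps_const_mult[symmetric] by algebra
  also have "cis \<theta> + cis (- \<theta>) = of_real (2 * cos \<theta>)" by (simp add: complex_eq_iff)
  also have "cis \<theta> * cis (- \<theta>) = 1" by (simp add: cis_mult)
  finally show ?thesis
    by (simp only: u_def v_def quadratic_factor gegenbauer_fps_def a_def b_def fps_const_1_eq_1 mult_1_right)
qed

lemma gegenbauer_fps_nth: "fps_nth (gegenbauer_fps l \<theta>) k = of_real (gegenbauer k l (cos \<theta>))"
proof (induction k rule: induct_nat_012)
  define F where "F = gegenbauer_fps l \<theta>"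
  define t where "t = cos \<theta>"
  have coeff: "fps_nth (fps_deriv F - fps_const (of_real (2*t)) * (fps_X * fps_deriv F) + fps_X * (fps_X * fps_deriv F)) j
    = fps_nth (fps_const (of_real (l * (2*t))) * F - fps_const (of_real (2*l)) * (fps_X * F)) j" for j
  proof (rule arg_cong[where f = "\<lambda>x. fps_nth x j"])
    have "fps_deriv F - fps_const (of_real (2*t)) * (fps_X * fps_deriv F) + fps_X * (fps_X * fps_deriv F)
      = (1 - fps_const (of_real (2 * t)) * fps_X + fps_X ^ 2) * fps_deriv F"
      by (simp only: algebra_simps power2_eq_square mult_1_left)
    also have "\<dots> = fps_const (of_real l) * (fps_const (of_real (2 * t)) - 2 * fps_X) * F"
      unfolding F_def t_def by (rule gegenbauer_fps_deriv)
    also have "\<dots> = fps_const (of_real (l * (2*t))) * F - fps_const (of_real (2*l)) * (fps_X * F)"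
      unfolding of_real_mult fps_const_mult[symmetric]
      by (simp add: numeral_fps_const algebra_simps)
    finally show "fps_deriv F - fps_const (of_real (2*t)) * (fps_X * fps_deriv F) + fps_X * (fps_X * fps_deriv F)
      = fps_const (of_real (l * (2*t))) * F - fps_const (of_real (2*l)) * (fps_X * F)" .
  qed
  show zero: "fps_nth (gegenbauer_fps l \<theta>) 0 = of_real (gegenbauer 0 l (cos \<theta>))"
    by (simp add: gegenbauer_fps_def linear_binomial_nth gegenbauer_0)
  show "fps_nth (gegenbauer_fps l \<theta>) (Suc 0) = of_real (gegenbauer (Suc 0) l (cos \<theta>))"
    using coeff[of 0] zero gegenbauer_1[of l t] by (simp add: F_def t_def gegenbauer_0 mult_ac)
  fix n
  assume IH0: "fps_nth (gegenbauer_fps l \<theta>) n = of_real (gegenbauer n l (cos \<theta>))"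
    and IH1: "fps_nth (gegenbauer_fps l \<theta>) (Suc n) = of_real (gegenbauer (Suc n) l (cos \<theta>))"
  have "of_nat (n + 2) * fps_nth F (n + 2) = of_real (2 * (real n + 1 + l) * t) * fps_nth F (n + 1) - of_real (real n + 2 * l) * fps_nth F n"
    using coeff[of "Suc n"] by (cases n) (simp_all add: mult.assoc, simp_all add: algebra_simps)
  also have "\<dots> = of_real (2 * (real n + 1 + l) * t * gegenbauer (n + 1) l t - (real n + 2 * l) * gegenbauer n l t)"
    using IH0 IH1 by (simp add: F_def t_def)
  also have "\<dots> = of_real (real (n + 2) * gegenbauer (n + 2) l t)"
    by (simp only: gegenbauer_rec)
  finally have "of_nat (n + 2) * fps_nth F (n + 2) = of_nat (n + 2) * of_real (gegenbauer (n + 2) l t)"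
    by simp
  moreover have "of_nat (n + 2) \<noteq> (0 :: complex)"
    unfolding of_nat_eq_0_iff by simp
  ultimately show "fps_nth (gegenbauer_fps l \<theta>) (Suc (Suc n)) = of_real (gegenbauer (Suc (Suc n)) l (cos \<theta>))"
    unfolding mult_cancel_left by (simp add: F_def t_def)
qed

lemma conv_radius_gegenbauer_fps: "fps_conv_radius (gegenbauer_fps l \<theta>) \<ge> 1"
  using fps_conv_radius_mult[of "linear_binomial l (cis \<theta>)" "linear_binomial l (cis (- \<theta>))"]
    conv_radius_linear_binomial[of "cis \<theta>" l] conv_radius_linear_binomial[of "cis (- \<theta>)" l]
  unfolding gegenbauer_fps_def
  by (auto intro: order.trans[rotated])

definition zonal_poly :: "real \<Rightarrow> nat \<Rightarrow> real \<Rightarrow> real" where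
  "zonal_poly l k t = (real k + l) / l * gegenbauer k l t"

text \<open>
  As functions of \<open>k\<close>, these are the coefficients whose Riesz means form the kernel at angle \<open>\<theta>\<close>.
\<close>

definition zonal_coeff :: "real \<Rightarrow> real \<Rightarrow> nat \<Rightarrow> real" where
  "zonal_coeff l \<theta> k = zonal_poly l k (cos \<theta>)"

text \<open>
  The factor \<open>(k + l) / l\<close> is the action of \<open>1 + X / l * d/dX\<close> on the generating function, and the
  differential equation evaluates it: the result is the Poisson kernel, that is \<open>1 - X\<^sup>2\<close> divided by
  the power \<open>l + 1\<close> of \<open>1 - 2 * cos \<theta> * X + X\<^sup>2\<close>. Its modulus is all that the resonance argument needs, and for it no branch of the power has to be fixed.
\<close>

lemma zonal_series:
  assumes l: "l > 0" and z: "norm z < 1"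
  shows "summable (\<lambda>k. \<bar>zonal_coeff l \<theta> k\<bar> * norm z ^ k)"
    and "norm (\<Sum>k. of_real (zonal_coeff l \<theta> k) * z ^ k)
      = norm (1 - z\<^sup>2) * (norm (1 - cis \<theta> * z) * norm (1 - cis (- \<theta>) * z)) powr (- l - 1)"
proof -
  define F where "F = gegenbauer_fps l \<theta>"
  define q where "q = 1 - fps_const (of_real (2 * cos \<theta>)) * fps_X + (fps_X :: complex fps) ^ 2"
  define D where "D = fps_X * fps_deriv F"
  define Z where "Z = F + fps_const (of_real (1 / l)) * D"
  have nth: "fps_nth Z k = of_real (zonal_coeff l \<theta> k)" for k
    using l by (cases k) (simp_all add: Z_def D_def F_def gegenbauer_fps_nth zonal_coeff_def zonal_poly_def field_simps)
  have rF: "fps_conv_radius F \<ge> 1" unfolding F_def by (rule conv_radius_gegenbauer_fps)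
  have rD: "fps_conv_radius (fps_deriv F) \<ge> 1"
    using fps_conv_radius_deriv[of F] rF by (rule order.trans[rotated])
  have rDD: "fps_conv_radius D \<ge> 1"
    unfolding D_def using fps_conv_radius_mult[of fps_X "fps_deriv F"] rD by (simp add: order.trans[rotated])
  have rcD: "fps_conv_radius (fps_const (of_real (1 / l)) * D) \<ge> 1"
    using fps_conv_radius_mult[of "fps_const (of_real (1 / l))" D] rDD by (simp add: order.trans[rotated])
  have rZ: "fps_conv_radius Z \<ge> 1"
    unfolding Z_def using fps_conv_radius_add[of F "fps_const (of_real (1 / l)) * D"] rF rcD
    by (auto intro: order.trans[rotated])
  have z1: "ereal (norm z) < 1" using z by simp
  have zZ: "ereal (norm z) < fps_conv_radius Z" and zF: "ereal (norm z) < fps_conv_radius F"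
    and zL: "\<And>\<theta>. ereal (norm z) < fps_conv_radius (linear_binomial l (cis \<theta>))"
    using less_le_trans[OF z1] rZ rF conv_radius_linear_binomial by simp_all
  show "summable (\<lambda>k. \<bar>zonal_coeff l \<theta> k\<bar> * norm z ^ k)"
    using norm_summable_fps[OF zZ] by (simp add: nth norm_mult norm_power)
  have "q * D = fps_X * (q * fps_deriv F)" by (simp add: D_def algebra_simps)
  also have "q * fps_deriv F = fps_const (of_real l) * (fps_const (of_real (2 * cos \<theta>)) - 2 * fps_X) * F"
    unfolding q_def F_def by (rule gegenbauer_fps_deriv)
  finally have "fps_const (of_real (1 / l)) * (q * D)
     = (fps_const (of_real (1/l)) * fps_const (of_real l)) * (fps_X * ((fps_const (of_real (2 * cos \<theta>)) - 2 * fps_X) * F))"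
    by (simp only: mult_ac)
  also have "fps_const (of_real (1/l)) * fps_const (of_real l :: complex) = 1"
    using l by (simp flip: of_real_mult)
  finally have "q * Z = q * F + fps_X * ((fps_const (of_real (2 * cos \<theta>)) - 2 * fps_X) * F)"
    by (simp only: Z_def distrib_left mult_1_left mult.left_commute[of q])
  also have "\<dots> = (1 - fps_X ^ 2) * F"
    unfolding q_def by algebra
  finally have qZ: "q * Z = (1 - fps_X ^ 2) * F" .
  define w where "w = (1 - cis \<theta> * z) * (1 - cis (- \<theta>) * z)"
  have q_split: "q = (1 - fps_const (cis \<theta>) * fps_X) * (1 - fps_const (cis (- \<theta>)) * fps_X)"
    unfolding q_def by (rule quadratic_factor[symmetric])
  have lin: "\<infinity> \<le> fps_conv_radius (1 - fps_const c * fps_X)" "eval_fps (1 - fps_const c * fps_X) z = 1 - c * z" for c :: complex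
  proof -
    have "fps_conv_radius (fps_const c * fps_X) \<ge> min \<infinity> \<infinity>"
      using fps_conv_radius_mult[of "fps_const c" fps_X] by simp
    then have r: "fps_conv_radius (fps_const c * fps_X) = \<infinity>" by simp
    then show "\<infinity> \<le> fps_conv_radius (1 - fps_const c * fps_X)"
      using fps_conv_radius_diff[of 1 "fps_const c * fps_X"] by simp
    show "eval_fps (1 - fps_const c * fps_X) z = 1 - c * z"
      using r by (subst eval_fps_diff) (simp_all add: eval_fps_mult)
  qed
  have rq: "\<infinity> \<le> fps_conv_radius q"
    unfolding q_split using fps_conv_radius_mult[of "1 - fps_const (cis \<theta>) * fps_X" "1 - fps_const (cis (- \<theta>)) * fps_X"] lin(1)
    by (metis ereal_infty_less_eq(1) min.idem)
  have eq: "eval_fps q z = w"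
    unfolding q_split w_def using lin by (subst eval_fps_mult) (simp_all)
  have rs: "\<infinity> \<le> fps_conv_radius (1 - (fps_X :: complex fps) ^ 2)"
    using fps_conv_radius_diff[of 1 "(fps_X :: complex fps)^2"] by simp
  have "w * eval_fps Z z = eval_fps (q * Z) z"
    using rq zZ by (simp add: eval_fps_mult eq)
  also have "\<dots> = (1 - z\<^sup>2) * eval_fps F z"
    unfolding qZ using rs zF by (subst eval_fps_mult) (simp_all add: eval_fps_diff)
  finally have main: "w * eval_fps Z z = (1 - z\<^sup>2) * eval_fps F z" .
  have nz: "1 - cis a * z \<noteq> 0" for a
  proof
    assume "1 - cis a * z = 0"
    then have "norm (cis a * z) = 1" by (metis eq_iff_diff_eq_0 norm_one)
    with z show False by (simp add: norm_mult)
  qed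
  have w0: "w \<noteq> 0" using nz by (simp add: w_def)
  have "norm (eval_fps F z) = norm w powr (- l)"
    unfolding F_def gegenbauer_fps_def w_def using zL z
    by (simp add: eval_fps_mult eval_linear_binomial norm_mult norm_powr_real_powr' powr_mult)
  then have "norm w * norm (eval_fps Z z) = norm (1 - z\<^sup>2) * norm w powr (- l)"
    using arg_cong[OF main, of norm] by (simp add: norm_mult)
  then have "norm (eval_fps Z z) = norm (1 - z\<^sup>2) * norm w powr (- l - 1)"
    using w0 by (simp add: powr_diff field_simps)
  then show "norm (\<Sum>k. of_real (zonal_coeff l \<theta> k) * z ^ k)
      = norm (1 - z\<^sup>2) * (norm (1 - cis \<theta> * z) * norm (1 - cis (- \<theta>) * z)) powr (- l - 1)"
    by (simp add: eval_fps_def nth w_def norm_mult)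
qed


section \<open>Laplace transforms of Riesz means\<close>

lemma gamma_integral_scaled:
  fixes l \<sigma> :: real
  assumes "l > - 1" "\<sigma> > 0"
  shows "has_bochner_integral lborel (\<lambda>u. indicator {0<..} u * (u powr l * exp (- \<sigma> * u)))
           (Gamma (l + 1) * \<sigma> powr (- l - 1))"
proof -
  define f where "f = (\<lambda>t::real. indicator {0..} t * t powr l / exp t)"
  have "(\<integral>\<^sup>+ t. ennreal (f t) \<partial>lborel) = ennreal (Gamma (l + 1))"
    using Gamma_conv_nn_integral_real[of "l + 1"] assms by (simp add: f_def)
  then have f: "integrable lborel f \<and> integral\<^sup>L lborel f = Gamma (l + 1)"
    using assms Gamma_real_pos[of "l + 1"]
    by (subst nn_integral_eq_integrable[symmetric]) (auto simp: f_def)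
  have eq: "f (0 + \<sigma> * u) = \<sigma> powr l * (indicator {0<..} u * (u powr l * exp (- \<sigma> * u)))" for u
    using assms by (auto simp: f_def indicator_def powr_mult exp_minus field_simps zero_le_mult_iff)
  have "integrable lborel (\<lambda>u. f (0 + \<sigma> * u))"
    using f assms by (intro lborel_integrable_real_affine) auto
  then have i: "integrable lborel (\<lambda>u. indicator {0<..} u * (u powr l * exp (- \<sigma> * u)))"
    unfolding eq using assms by simp
  have "Gamma (l + 1) = \<sigma> * (\<sigma> powr l * (\<integral>u. indicator {0<..} u * (u powr l * exp (- \<sigma> * u)) \<partial>lborel))"
    using f lborel_integral_real_affine[of \<sigma> f 0] assms unfolding eq by simp
  then show ?thesis
    using i assms by (simp add: has_bochner_integral_iff powr_diff powr_minus field_simps)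
qed

definition laplace_powr :: "real \<Rightarrow> complex \<Rightarrow> complex" where
  "laplace_powr l s = (\<integral>u. of_real (indicator {0<..} u * u powr l) * exp (- s * of_real u) \<partial>lborel)"

lemma integrable_laplace_powr:
  assumes "l > - 1" "Re s > 0"
  shows "integrable lborel (\<lambda>u. of_real (indicator {0<..} u * u powr l) * exp (- s * of_real u))"
proof (rule Bochner_Integration.integrable_bound)
  show "integrable lborel (\<lambda>u. indicator {0<..} u * (u powr l * exp (- Re s * u)))"
    using gamma_integral_scaled[OF assms] by (simp add: has_bochner_integral_iff)
qed (auto simp: norm_mult indicator_def)

lemma pochhammer_Gamma_real: "(x::real) > 0 \<Longrightarrow> Gamma (x + real j) = Gamma x * pochhammer x j"
proof -
  assume x: "x > 0"
  then have "x \<notin> \<int>\<^sub>\<le>\<^sub>0" by (auto dest: nonpos_Ints_nonpos)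
  from pochhammer_Gamma[OF this, of j] show ?thesis
    using Gamma_real_pos[OF x] by (simp add: field_simps)
qed

lemma gbinomial_minus_power:
  fixes a q :: "'a::field_char_0"
  shows "((- a) gchoose j) * (- q) ^ j = pochhammer a j * q ^ j / fact j"
proof -
  have "(- 1) ^ j * (- q) ^ j = q ^ j" by (simp add: power_mult_distrib[symmetric])
  then have "(- 1) ^ j * pochhammer a j * (- q) ^ j = pochhammer a j * q ^ j"
    by (simp add: mult.assoc mult.left_commute)
  then show ?thesis by (simp add: gbinomial_pochhammer)
qed

text \<open>
  The transform of a power is known on the positive real axis. It extends to complex \<open>s\<close> by
  expanding \<open>exp (- s * u)\<close> around a real point \<open>s0\<close> and integrating termwise, which produces the
  binomial series of \<open>s / s0\<close> to the power \<open>- l - 1\<close>.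
\<close>

lemma norm_laplace_powr:
  assumes l: "l > - 1" and s: "Re s > 0"
  shows "norm (laplace_powr l s) = Gamma (l + 1) * norm s powr (- l - 1)"
proof -
  \<comment> \<open>A positive value with \<open>norm (s0 - s) < s0\<close>, which puts \<open>s\<close> inside the disc of convergence.\<close>
  define s0 where "s0 = (norm s)\<^sup>2 / Re s"
  have "s \<noteq> 0" using s by auto
  then have s0: "s0 > 0" using s by (simp add: s0_def)
  define q where "q = (of_real s0 - s) / of_real s0"
  have "(norm (of_real s0 - s))\<^sup>2 = s0\<^sup>2 - 2 * s0 * Re s + (norm s)\<^sup>2"
    unfolding cmod_power2 by (simp add: power2_eq_square algebra_simps)
  also have "(norm s)\<^sup>2 = s0 * Re s" using s by (simp add: s0_def)
  also have "s0\<^sup>2 - 2 * s0 * Re s + s0 * Re s < s0\<^sup>2" using s s0 by simp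
  finally have "norm (of_real s0 - s) < s0"
    using s0 by (simp add: power2_less_imp_less)
  then have q1: "norm q < 1" using s0 by (simp add: q_def norm_divide)
  define c where "c = Gamma (l + 1) * s0 powr (- l - 1)"
  define f where "f = (\<lambda>j u. of_real (indicator {0<..} u * (u powr (l + real j) * exp (- s0 * u))) * ((of_real s0 - s) ^ j / fact j))"
  have base: "has_bochner_integral lborel (\<lambda>u. indicator {0<..} u * (u powr (l + real j) * exp (- s0 * u)))
           (c * pochhammer (l + 1) j / s0 ^ j)" for j
  proof -
    have "Gamma (l + real j + 1) * s0 powr (- (l + real j) - 1) = c * pochhammer (l + 1) j / s0 ^ j"
      using s0 pochhammer_Gamma_real[of "l + 1" j] l
      by (simp add: c_def powr_diff powr_minus powr_add powr_realpow field_simps)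
    then show ?thesis using gamma_integral_scaled[of "l + real j" s0] l s0 by simp
  qed
  have fint: "has_bochner_integral lborel (f j) (of_real (c * pochhammer (l + 1) j / s0 ^ j) * ((of_real s0 - s) ^ j / fact j))" for j
    unfolding f_def using has_bochner_integral_of_real[OF base[of j]] by (rule has_bochner_integral_mult_left)
  have coeff: "of_real (c * pochhammer (l + 1) j / s0 ^ j) * ((of_real s0 - s) ^ j / fact j)
     = of_real c * (((- of_real (l + 1)) gchoose j) * (- q) ^ j)" for j
  proof -
    have "of_real (pochhammer (l + 1) j) = pochhammer (of_real (l + 1) :: complex) j"
      by (rule pochhammer_of_real[symmetric])
    then show ?thesis
      unfolding gbinomial_minus_power by (simp add: q_def power_divide)
  qed
  have nint: "(\<integral>u. norm (f j u) \<partial>lborel) = c * (((- (l + 1)) gchoose j) * (- norm q) ^ j)" for j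
  proof -
    have "norm (f j u) = indicator {0<..} u * (u powr (l + real j) * exp (- s0 * u)) * (norm (of_real s0 - s) ^ j / fact j)" for u
      by (simp add: f_def norm_mult norm_divide norm_power indicator_def)
    then have "(\<integral>u. norm (f j u) \<partial>lborel) = c * pochhammer (l + 1) j / s0 ^ j * (norm (of_real s0 - s) ^ j / fact j)"
      using base[of j] by (simp add: has_bochner_integral_iff)
    also have "\<dots> = c * (((- (l + 1)) gchoose j) * (- norm q) ^ j)"
      unfolding gbinomial_minus_power using s0 by (simp add: q_def norm_divide power_divide)
    finally show ?thesis .
  qed
  have fsum: "(\<lambda>j. f j u) sums (of_real (indicator {0<..} u * u powr l) * exp (- s * of_real u))" for u
  proof -
    have "(\<lambda>j. of_real (indicator {0<..} u * (u powr l * exp (- s0 * u))) * (((of_real s0 - s) * of_real u) ^ j /\<^sub>R fact j))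
      sums (of_real (indicator {0<..} u * (u powr l * exp (- s0 * u))) * exp ((of_real s0 - s) * of_real u))"
      by (intro sums_mult exp_converges)
    also have "(\<lambda>j. of_real (indicator {0<..} u * (u powr l * exp (- s0 * u))) * (((of_real s0 - s) * of_real u) ^ j /\<^sub>R fact j)) = (\<lambda>j. f j u)"
      by (auto simp: f_def fun_eq_iff indicator_def powr_add powr_realpow power_mult_distrib scaleR_conv_of_real divide_inverse mult_ac)
    also have "of_real (indicator {0<..} u * (u powr l * exp (- s0 * u))) * exp ((of_real s0 - s) * of_real u)
      = of_real (indicator {0<..} u * u powr l) * exp (- s * of_real u)"
      by (simp add: exp_of_real[symmetric] mult.assoc exp_add[symmetric] algebra_simps)
    finally show ?thesis .
  qed
  have "(\<lambda>j. integral\<^sup>L lborel (f j)) sums (\<integral>u. (\<Sum>j. f j u) \<partial>lborel)"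
  proof (rule sums_integral)
    show "integrable lborel (f j)" for j using fint[of j] by (simp add: has_bochner_integral_iff)
    show "AE u in lborel. summable (\<lambda>j. norm (f j u))"
    proof (rule AE_I2)
      fix u :: real
      have "summable (\<lambda>j. norm (indicator {0<..} u * (u powr l * exp (- s0 * u))) * (norm (((of_real s0 - s) * of_real u) ^ j /\<^sub>R fact j)))"
        by (intro summable_mult summable_norm_exp)
      also have "(\<lambda>j. norm (indicator {0<..} u * (u powr l * exp (- s0 * u))) * (norm (((of_real s0 - s) * of_real u) ^ j /\<^sub>R fact j))) = (\<lambda>j. norm (f j u))"
        by (auto simp: f_def fun_eq_iff indicator_def powr_add powr_realpow power_mult_distrib norm_mult norm_divide norm_power norm_inverse divide_inverse mult_ac)
      finally show "summable (\<lambda>j. norm (f j u))" .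
    qed
    show "summable (\<lambda>j. \<integral>u. norm (f j u) \<partial>lborel)"
      unfolding nint using gen_binomial_real[of "- norm q" "- (l + 1)"] q1
      by (intro summable_mult) (simp add: sums_iff)
  qed
  moreover have "integral\<^sup>L lborel (f j) = of_real c * (((- of_real (l + 1)) gchoose j) * (- q) ^ j)" for j
    using has_bochner_integral_integral_eq[OF fint[of j]] coeff[of j] by (rule trans)
  then have "(\<lambda>j. integral\<^sup>L lborel (f j)) sums (of_real c * (1 + - q) powr (- of_real (l + 1)))"
    using q1 gen_binomial_complex[of "- q" "- of_real (l + 1)"] by (simp only: sums_mult norm_minus_cancel)
  ultimately have "laplace_powr l s = of_real c * (1 - q) powr (of_real (- l - 1))"
    using fsum by (simp add: sums_iff laplace_powr_def)
  moreover have "1 - q = s / of_real s0" using s0 by (simp add: q_def field_simps)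
  ultimately have "norm (laplace_powr l s) = c * (norm s / s0) powr (- l - 1)"
    using l s0 Gamma_real_pos[of "l + 1"]
    by (simp add: norm_mult norm_powr_real_powr' norm_divide c_def)
  also have "\<dots> = Gamma (l + 1) * norm s powr (- l - 1)"
    using s0 by (simp add: c_def powr_divide)
  finally show ?thesis .
qed

definition riesz_sum :: "real \<Rightarrow> (nat \<Rightarrow> real) \<Rightarrow> real \<Rightarrow> real" where
  "riesz_sum l a R = (\<Sum>k | real k < R. (1 - real k / R) powr l * a k)"

lemma finite_nat_less_real: "finite {k::nat. real k < R}"
  by (rule finite_subset[of _ "{..nat \<lceil>R\<rceil>}"]) (auto, linarith)

text \<open>
  For \<open>R > k\<close> the product of the powers \<open>l\<close> of \<open>R\<close> and \<open>1 - k / R\<close> is the power \<open>l\<close> of \<open>R - k\<close>. So each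
  summand is a translate by \<open>k\<close> of one function, and the translation contributes the factor
  \<open>exp (- s)\<close> to the power \<open>k\<close>.
\<close>

lemma laplace_riesz_sum:
  assumes l: "l > - 1" and s: "Re s > 0"
    and a: "summable (\<lambda>k. \<bar>a k\<bar> * exp (- Re s) ^ k)"
  shows "has_bochner_integral lborel
     (\<lambda>R. of_real (indicator {0<..} R * (R powr l * riesz_sum l a R)) * exp (- s * of_real R))
     (laplace_powr l s * (\<Sum>k. of_real (a k) * exp (- s) ^ k))"
proof -
  define h where "h = (\<lambda>u. of_real (indicator {0<..} u * u powr l) * exp (- s * of_real u))"
  define f where "f = (\<lambda>k R. of_real (a k) * exp (- s) ^ k * h (- real k + 1 * R))"
  have hi: "integrable lborel h" unfolding h_def by (rule integrable_laplace_powr[OF l s])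
  have hV: "integral\<^sup>L lborel h = laplace_powr l s" by (simp add: h_def laplace_powr_def)
  have fi: "integrable lborel (f k)" for k
    unfolding f_def by (intro integrable_mult_right lborel_integrable_real_affine hi) simp
  have shift: "(\<integral>R. g (- real k + 1 * R) \<partial>lborel) = integral\<^sup>L lborel g" for g :: "real \<Rightarrow> 'b::{banach, second_countable_topology}" and k
    using lborel_integral_real_affine[of 1 g "- real k"] by simp
  have fV: "integral\<^sup>L lborel (f k) = laplace_powr l s * (of_real (a k) * exp (- s) ^ k)" for k
    unfolding f_def integral_mult_right_zero shift hV by (rule mult.commute)
  have nV: "(\<integral>R. norm (f k R) \<partial>lborel) = (\<bar>a k\<bar> * exp (- Re s) ^ k) * (\<integral>u. norm (h u) \<partial>lborel)" for k
    unfolding f_def norm_mult integral_mult_right_zero shift[of "\<lambda>u. norm (h u)"]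
    by (simp add: norm_power)
  have f0: "f k R = 0" if "R \<le> real k" for k R
    using that by (simp add: f_def h_def indicator_def)
  have fsum: "(\<Sum>k. f k R) = of_real (indicator {0<..} R * (R powr l * riesz_sum l a R)) * exp (- s * of_real R)" for R
  proof -
    have "(\<Sum>k. f k R) = (\<Sum>k | real k < R. f k R)"
      by (rule suminf_finite[OF finite_nat_less_real]) (auto intro: f0)
    also have "\<dots> = (\<Sum>k | real k < R. of_real (indicator {0<..} R * R powr l * ((1 - real k / R) powr l * a k)) * exp (- s * of_real R))"
    proof (rule sum.cong[OF refl])
      fix k assume "k \<in> {k. real k < R}"
      then have k: "real k < R" and R: "R > 0" by auto
      have "R * (1 - real k / R) = R - real k" using R by (simp add: field_simps)
      then have h: "R powr l * (1 - real k / R) powr l = (R - real k) powr l"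
        by (simp only: powr_mult[symmetric])
      have e: "R powr l * ((1 - real k / R) powr l * a k) = a k * (R - real k) powr l"
        by (simp only: mult.assoc[symmetric] h mult.commute[of "a k"])
      have exp: "exp (- s) ^ k * exp (- s * of_real (R - real k)) = exp (- s * of_real R)"
        by (simp add: exp_of_nat_mult[symmetric] exp_add[symmetric] algebra_simps)
      have "f k R = of_real (a k * (R - real k) powr l) * (exp (- s) ^ k * exp (- s * of_real (R - real k)))"
        using k R by (simp add: f_def h_def indicator_def)
      moreover have "indicator {0<..} R * R powr l * ((1 - real k / R) powr l * a k) = a k * (R - real k) powr l"
        using R e by simp
      ultimately show "f k R = of_real (indicator {0<..} R * R powr l * ((1 - real k / R) powr l * a k)) * exp (- s * of_real R)"
        by (simp only: exp)
    qed
    also have "\<dots> = of_real (indicator {0<..} R * (R powr l * riesz_sum l a R)) * exp (- s * of_real R)"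
      by (simp add: riesz_sum_def sum_distrib_left sum_distrib_right mult_ac)
    finally show ?thesis .
  qed
  have ae: "AE R in lborel. summable (\<lambda>k. norm (f k R))"
  proof (rule AE_I2)
    fix R :: real
    show "summable (\<lambda>k. norm (f k R))"
      by (rule summable_finite[OF finite_nat_less_real[of R]]) (auto intro: f0)
  qed
  have sm: "summable (\<lambda>k. \<integral>R. norm (f k R) \<partial>lborel)"
    unfolding nV by (intro summable_mult2 a)
  have "summable (\<lambda>k. of_real (a k) * exp (- s) ^ k)"
    by (rule summable_norm_cancel) (use a in \<open>simp add: norm_mult norm_power\<close>)
  then have "integral\<^sup>L lborel (\<lambda>R. \<Sum>k. f k R) = laplace_powr l s * (\<Sum>k. of_real (a k) * exp (- s) ^ k)"
    using integral_suminf[OF fi ae sm] by (simp add: fV suminf_mult)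
  moreover have "integrable lborel (\<lambda>R. \<Sum>k. f k R)"
    by (rule integrable_suminf[OF fi ae sm])
  ultimately show ?thesis by (simp add: has_bochner_integral_iff fsum)
qed


section \<open>Riesz products\<close>

text \<open>
  Expanding a product over \<open>i \<in> I\<close> of factors \<open>1 + Re (u i * cis (- \<theta> i * R))\<close> gives one exponential for
  each choice \<open>\<epsilon>\<close> of a sign or zero at every \<open>i\<close>; its frequency is the corresponding signed sum of
  the \<open>\<theta> i\<close>.
\<close>

definition frequency :: "'i set \<Rightarrow> ('i \<Rightarrow> real) \<Rightarrow> ('i \<Rightarrow> int) \<Rightarrow> real" where
  "frequency I \<theta> \<epsilon> = (\<Sum>i\<in>I. of_int (\<epsilon> i) * \<theta> i)"

definition sign_patterns :: "'i set \<Rightarrow> ('i \<Rightarrow> int) set" where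
  "sign_patterns I = (\<Pi>\<^sub>E i\<in>I. {-1, 0, 1})"

definition single_pattern :: "'i set \<Rightarrow> 'i \<Rightarrow> int \<Rightarrow> 'i \<Rightarrow> int" where
  "single_pattern I j c = (\<lambda>i\<in>I. if i = j then c else 0)"

definition fourier :: "real measure \<Rightarrow> (real \<Rightarrow> real) \<Rightarrow> real \<Rightarrow> complex" where
  "fourier \<nu> h \<alpha> = (\<integral>R. of_real (h R) * cis (- \<alpha> * R) \<partial>\<nu>)"

lemma frequency_single: "finite I \<Longrightarrow> j \<in> I \<Longrightarrow> frequency I \<theta> (single_pattern I j c) = of_int c * \<theta> j"
  by (simp add: frequency_def single_pattern_def if_distrib if_distribR cong: if_cong)

lemma single_pattern_in: "j \<in> I \<Longrightarrow> c \<in> {-1,0,1} \<Longrightarrow> single_pattern I j c \<in> sign_patterns I"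
  by (auto simp: single_pattern_def sign_patterns_def)

lemma finite_sign_patterns: "finite I \<Longrightarrow> finite (sign_patterns I)"
  by (auto simp: sign_patterns_def intro: finite_PiE)

lemma cis_measurable [measurable]: "cis \<in> borel_measurable borel"
  by (intro borel_measurable_continuous_onI continuous_intros)

text \<open>
  Integrate \<open>\<Sum>j\<in>I. m j * K j R\<close> against the product of the factors \<open>1 + Re (u j * cis (- \<theta> j * R))\<close>.
  This product is nonnegative as soon as \<open>norm (u j) \<le> 1\<close>, so the integral is at most \<open>B\<close> times
  that of the product. Its expansion has coefficients of modulus at most one; the two patterns
  \<open>\<theta> j\<close> and \<open>- \<theta> j\<close> have coefficients \<open>u j / 2\<close> and \<open>cnj (u j) / 2\<close>, so for the phase \<open>u j\<close> that makes
  \<open>u j * fourier \<nu> (K j) (\<theta> j)\<close> real and nonnegative they together recover the modulus of that Fourier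
  coefficient. All other patterns are treated as errors.
\<close>

lemma riesz_product_inequality:
  fixes \<nu> :: "real measure" and K :: "'i \<Rightarrow> real \<Rightarrow> real"
  assumes fin: "finite_measure \<nu>" and sets: "sets \<nu> = sets borel"
    and I: "finite I"
    and K: "\<And>j. j \<in> I \<Longrightarrow> integrable \<nu> (K j)"
    and m: "\<And>j. j \<in> I \<Longrightarrow> m j \<ge> 0"
    and B: "AE R in \<nu>. \<bar>\<Sum>j\<in>I. m j * K j R\<bar> \<le> B" "B \<ge> 0"
  shows "(\<Sum>j\<in>I. m j * (norm (fourier \<nu> (K j) (\<theta> j))
           - (\<Sum>\<epsilon>\<in>sign_patterns I - {single_pattern I j 1, single_pattern I j (-1)}.
                norm (fourier \<nu> (K j) (frequency I \<theta> \<epsilon>)))))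
         \<le> B * (\<Sum>\<epsilon>\<in>sign_patterns I. norm (fourier \<nu> (\<lambda>_. 1) (frequency I \<theta> \<epsilon>)))"
proof -
  interpret finite_measure \<nu> by (rule fin)
  note [measurable_cong] = sets
  define F where "F = (\<lambda>j. fourier \<nu> (K j))"
  \<comment> \<open>The phase that turns the coefficient at \<open>\<theta> j\<close> into its modulus; it is zero if the coefficient is.\<close>
  define u where "u = (\<lambda>j. cnj (sgn (F j (\<theta> j))))"
  have uF: "u j * F j (\<theta> j) = of_real (norm (F j (\<theta> j)))" for j
  proof (cases "F j (\<theta> j) = 0")
    case False
    then show ?thesis
      using complex_norm_square[of "F j (\<theta> j)"]
      by (simp add: u_def sgn_eq power2_eq_square field_simps)
  qed (simp add: u_def)
  have u1: "norm (u j) \<le> 1" for j by (simp add: u_def norm_sgn)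
  define w where "w = (\<lambda>j (k::int). if k = 0 then 1 else if k = 1 then u j / 2 else cnj (u j) / 2)"
  have w1: "norm (w j k) \<le> 1" for j k
    using u1[of j] by (simp add: w_def norm_divide)
  define W where "W = (\<lambda>\<epsilon>. \<Prod>j\<in>I. w j (\<epsilon> j))"
  have W1: "norm (W \<epsilon>) \<le> 1" for \<epsilon>
    unfolding W_def prod_norm[symmetric] using w1 by (intro prod_le_1) auto
  define \<rho> where "\<rho> = (\<lambda>R. \<Prod>j\<in>I. 1 + Re (u j * cis (- \<theta> j * R)))"
  have rho0: "\<rho> R \<ge> 0" for R
    unfolding \<rho>_def
  proof (rule prod_nonneg)
    fix j
    have "\<bar>Re (u j * cis (- \<theta> j * R))\<bar> \<le> 1"
      using abs_Re_le_cmod[of "u j * cis (- \<theta> j * R)"] u1[of j] by (simp add: norm_mult)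
    then show "0 \<le> 1 + Re (u j * cis (- \<theta> j * R))" by linarith
  qed
  have rho_expand: "complex_of_real (\<rho> R) = (\<Sum>\<epsilon>\<in>sign_patterns I. W \<epsilon> * cis (- frequency I \<theta> \<epsilon> * R))" for R
  proof -
    have factor: "complex_of_real (1 + Re (u j * cis (- \<theta> j * R))) = (\<Sum>k\<in>{-1,0,1}. w j k * cis (- (of_int k * \<theta> j * R)))" for j
      by (simp add: w_def complex_eq_iff diff_divide_distrib)
    have "complex_of_real (\<rho> R) = (\<Prod>j\<in>I. \<Sum>k\<in>{-1,0,1}. w j k * cis (- (of_int k * \<theta> j * R)))"
      unfolding \<rho>_def of_real_prod factor ..
    also have "\<dots> = (\<Sum>\<epsilon>\<in>sign_patterns I. \<Prod>j\<in>I. w j (\<epsilon> j) * cis (- (of_int (\<epsilon> j) * \<theta> j * R)))"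
      unfolding sign_patterns_def by (rule prod_sum_PiE) (use I in auto)
    also have "\<dots> = (\<Sum>\<epsilon>\<in>sign_patterns I. W \<epsilon> * cis (- frequency I \<theta> \<epsilon> * R))"
    proof (rule sum.cong[OF refl])
      fix \<epsilon>
      have "(\<Prod>j\<in>I. cis (g j)) = cis (\<Sum>j\<in>I. g j)" for g
        using I by (induction I rule: finite_induct) (auto simp: cis_mult)
      then show "(\<Prod>j\<in>I. w j (\<epsilon> j) * cis (- (of_int (\<epsilon> j) * \<theta> j * R))) = W \<epsilon> * cis (- frequency I \<theta> \<epsilon> * R)"
        by (simp add: prod.distrib W_def frequency_def sum_distrib_right sum_negf)
    qed
    finally show ?thesis .
  qed
  have Ki: "integrable \<nu> (\<lambda>R. complex_of_real (h R) * cis (- \<alpha> * R))" if "integrable \<nu> h" for h \<alpha>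
  proof (rule Bochner_Integration.integrable_bound[OF that])
    have [measurable]: "h \<in> borel_measurable \<nu>" using that by simp
    show "(\<lambda>R. complex_of_real (h R) * cis (- \<alpha> * R)) \<in> borel_measurable \<nu>" by measurable
  qed (simp add: norm_mult)
  have one: "integrable \<nu> (\<lambda>_. 1 :: real)" by simp
  have expand: "(\<integral>R. complex_of_real (h R) * complex_of_real (\<rho> R) \<partial>\<nu>) = (\<Sum>\<epsilon>\<in>sign_patterns I. W \<epsilon> * fourier \<nu> h (frequency I \<theta> \<epsilon>))"
    and expand_int: "integrable \<nu> (\<lambda>R. complex_of_real (h R) * complex_of_real (\<rho> R))"
    if h: "integrable \<nu> h" for h
  proof -
    have eq: "complex_of_real (h R) * complex_of_real (\<rho> R)
      = (\<Sum>\<epsilon>\<in>sign_patterns I. W \<epsilon> * (complex_of_real (h R) * cis (- frequency I \<theta> \<epsilon> * R)))" for R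
      unfolding rho_expand sum_distrib_left by (rule sum.cong) (simp_all add: mult_ac)
    show "(\<integral>R. complex_of_real (h R) * complex_of_real (\<rho> R) \<partial>\<nu>) = (\<Sum>\<epsilon>\<in>sign_patterns I. W \<epsilon> * fourier \<nu> h (frequency I \<theta> \<epsilon>))"
      unfolding eq using Ki[OF h] by (simp add: fourier_def)
    show "integrable \<nu> (\<lambda>R. complex_of_real (h R) * complex_of_real (\<rho> R))"
      unfolding eq using Ki[OF h] by (intro Bochner_Integration.integrable_sum integrable_mult_right)
  qed
  have rho_int: "integrable \<nu> \<rho>"
    using expand_int[OF one] by (simp add: complex_of_real_integrable_eq)
  have hrho: "integrable \<nu> (\<lambda>R. h R * \<rho> R)" if "integrable \<nu> h" for h
    using expand_int[OF that] by (simp add: complex_of_real_integrable_eq flip: of_real_mult)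
  have total: "(\<integral>R. \<rho> R \<partial>\<nu>) \<le> (\<Sum>\<epsilon>\<in>sign_patterns I. norm (fourier \<nu> (\<lambda>_. 1) (frequency I \<theta> \<epsilon>)))"
  proof -
    have "complex_of_real (\<integral>R. \<rho> R \<partial>\<nu>) = (\<Sum>\<epsilon>\<in>sign_patterns I. W \<epsilon> * fourier \<nu> (\<lambda>_. 1) (frequency I \<theta> \<epsilon>))"
      using expand[OF one] by simp
    then have "\<bar>\<integral>R. \<rho> R \<partial>\<nu>\<bar> = norm (\<Sum>\<epsilon>\<in>sign_patterns I. W \<epsilon> * fourier \<nu> (\<lambda>_. 1) (frequency I \<theta> \<epsilon>))"
      by (metis norm_of_real)
    also have "\<dots> \<le> (\<Sum>\<epsilon>\<in>sign_patterns I. norm (W \<epsilon> * fourier \<nu> (\<lambda>_. 1) (frequency I \<theta> \<epsilon>)))"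
      by (rule norm_sum)
    also have "\<dots> \<le> (\<Sum>\<epsilon>\<in>sign_patterns I. norm (fourier \<nu> (\<lambda>_. 1) (frequency I \<theta> \<epsilon>)))"
      using W1 by (intro sum_mono) (simp add: norm_mult mult_left_le_one_le)
    finally show ?thesis by simp
  qed
  define b where "b = (\<lambda>R. \<Sum>j\<in>I. m j * K j R)"
  have b: "integrable \<nu> b" unfolding b_def using K by (intro Bochner_Integration.integrable_sum integrable_mult_right)
  have lower: "norm (F j (\<theta> j)) - (\<Sum>\<epsilon>\<in>sign_patterns I - {single_pattern I j 1, single_pattern I j (-1)}. norm (F j (frequency I \<theta> \<epsilon>)))
     \<le> (\<integral>R. K j R * \<rho> R \<partial>\<nu>)" if j: "j \<in> I" for j
  proof -
    let ?p = "single_pattern I j 1" and ?n = "single_pattern I j (-1)"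
    have ne: "?p \<noteq> ?n" using j by (auto simp: single_pattern_def fun_eq_iff)
    have Wp: "W (single_pattern I j c) = w j c" for c
    proof -
      have "W (single_pattern I j c) = (\<Prod>i\<in>I. if i = j then w j c else 1)"
        unfolding W_def by (intro prod.cong) (auto simp: single_pattern_def w_def)
      then show ?thesis using I j by (simp add: prod.delta)
    qed
    have conj: "F j (- \<theta> j) = cnj (F j (\<theta> j))"
      unfolding F_def fourier_def by (subst Bochner_Integration.integral_cnj[symmetric]) (simp add: cis_cnj)
    have "complex_of_real (\<integral>R. K j R * \<rho> R \<partial>\<nu>) = (\<Sum>\<epsilon>\<in>sign_patterns I. W \<epsilon> * F j (frequency I \<theta> \<epsilon>))"
      using expand[OF K[OF j]] by (simp add: F_def flip: of_real_mult)
    also have "\<dots> = W ?p * F j (frequency I \<theta> ?p) + (W ?n * F j (frequency I \<theta> ?n)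
        + (\<Sum>\<epsilon>\<in>sign_patterns I - {?p, ?n}. W \<epsilon> * F j (frequency I \<theta> \<epsilon>)))"
    proof -
      have "?p \<in> sign_patterns I" "?n \<in> sign_patterns I - {?p}"
        using single_pattern_in[OF j] ne by auto
      then show ?thesis
        using finite_sign_patterns[OF I]
        by (simp add: sum.remove[of "sign_patterns I" ?p] sum.remove[of "sign_patterns I - {?p}" ?n] Diff_insert2[symmetric])
    qed
    also have "W ?p * F j (frequency I \<theta> ?p) = of_real (norm (F j (\<theta> j)) / 2)"
      using uF[of j] by (simp add: Wp w_def frequency_single[OF I j])
    also have "W ?n * F j (frequency I \<theta> ?n) = of_real (norm (F j (\<theta> j)) / 2)"
      using arg_cong[OF uF[of j], of cnj] by (simp add: Wp w_def frequency_single[OF I j] conj)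
    finally have "complex_of_real ((\<integral>R. K j R * \<rho> R \<partial>\<nu>) - norm (F j (\<theta> j))) = (\<Sum>\<epsilon>\<in>sign_patterns I - {?p, ?n}. W \<epsilon> * F j (frequency I \<theta> \<epsilon>))"
      by simp
    then have "\<bar>(\<integral>R. K j R * \<rho> R \<partial>\<nu>) - norm (F j (\<theta> j))\<bar> = norm (\<Sum>\<epsilon>\<in>sign_patterns I - {?p, ?n}. W \<epsilon> * F j (frequency I \<theta> \<epsilon>))"
      by (metis norm_of_real)
    also have "\<dots> \<le> (\<Sum>\<epsilon>\<in>sign_patterns I - {?p, ?n}. norm (W \<epsilon> * F j (frequency I \<theta> \<epsilon>)))"
      by (rule norm_sum)
    also have "\<dots> \<le> (\<Sum>\<epsilon>\<in>sign_patterns I - {?p, ?n}. norm (F j (frequency I \<theta> \<epsilon>)))"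
      using W1 by (intro sum_mono) (simp add: norm_mult mult_left_le_one_le)
    finally show ?thesis by linarith
  qed
  have "(\<Sum>j\<in>I. m j * (norm (F j (\<theta> j))
           - (\<Sum>\<epsilon>\<in>sign_patterns I - {single_pattern I j 1, single_pattern I j (-1)}. norm (F j (frequency I \<theta> \<epsilon>)))))
      \<le> (\<Sum>j\<in>I. m j * (\<integral>R. K j R * \<rho> R \<partial>\<nu>))"
    using lower m by (intro sum_mono mult_left_mono)
  also have "\<dots> = (\<integral>R. b R * \<rho> R \<partial>\<nu>)"
    unfolding b_def sum_distrib_right using hrho[OF K] by (subst Bochner_Integration.integral_sum) (simp_all add: mult.assoc)
  also have "\<dots> \<le> (\<integral>R. B * \<rho> R \<partial>\<nu>)"
  proof (rule integral_mono_AE[OF hrho[OF b]])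
    show "integrable \<nu> (\<lambda>R. B * \<rho> R)" using rho_int by simp
    show "AE R in \<nu>. b R * \<rho> R \<le> B * \<rho> R"
      using B(1) by eventually_elim (auto simp: b_def intro!: mult_right_mono rho0)
  qed
  also have "\<dots> \<le> B * (\<Sum>\<epsilon>\<in>sign_patterns I. norm (fourier \<nu> (\<lambda>_. 1) (frequency I \<theta> \<epsilon>)))"
    using total B(2) by (simp add: mult_left_mono)
  finally show ?thesis by (simp add: F_def)
qed


section \<open>Resonance at the singularities of the Poisson kernel\<close>

text \<open>
  The Laplace transform of \<open>h\<close> times a power, at \<open>\<sigma> + \<i> * \<alpha>\<close>, is the Fourier transform of \<open>h\<close> at \<open>\<alpha>\<close>
  with respect to this measure. After normalization it spreads over ever larger \<open>R\<close> as \<open>\<sigma>\<close> tends to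
  zero.
\<close>

definition gamma_measure :: "real \<Rightarrow> real \<Rightarrow> real measure" where
  "gamma_measure l \<sigma> = density lborel (\<lambda>R. ennreal (indicator {0<..} R * (R powr l * exp (- \<sigma> * R))))"

lemma sets_gamma_measure [simp]: "sets (gamma_measure l \<sigma>) = sets borel"
  by (simp add: gamma_measure_def)

lemma finite_gamma_measure:
  assumes "l > - 1" "\<sigma> > 0"
  shows "finite_measure (gamma_measure l \<sigma>)"
proof
  have "emeasure (gamma_measure l \<sigma>) (space (gamma_measure l \<sigma>)) = (\<integral>\<^sup>+R. ennreal (indicator {0<..} R * (R powr l * exp (- \<sigma> * R))) \<partial>lborel)"
    by (simp add: gamma_measure_def emeasure_density)
  also have "\<dots> = ennreal (Gamma (l + 1) * \<sigma> powr (- l - 1))"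
    using gamma_integral_scaled[OF assms] by (subst nn_integral_eq_integral) (auto simp: has_bochner_integral_iff)
  finally show "emeasure (gamma_measure l \<sigma>) (space (gamma_measure l \<sigma>)) \<noteq> \<infinity>" by simp
qed

lemma fourier_gamma_measure:
  assumes [measurable]: "h \<in> borel_measurable borel"
  shows "fourier (gamma_measure l \<sigma>) h \<alpha>
    = (\<integral>R. of_real (indicator {0<..} R * (R powr l * h R)) * exp (- Complex \<sigma> \<alpha> * of_real R) \<partial>lborel)"
proof -
  have "exp (- Complex \<sigma> \<alpha> * of_real R) = of_real (exp (- \<sigma> * R)) * cis (- \<alpha> * R)" for R
    by (simp add: exp_eq_polar)
  moreover have "fourier (gamma_measure l \<sigma>) h \<alpha>
     = (\<integral>R. (indicator {0<..} R * (R powr l * exp (- \<sigma> * R))) *\<^sub>R (of_real (h R) * cis (- \<alpha> * R)) \<partial>lborel)"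
    unfolding fourier_def gamma_measure_def by (rule integral_density) auto
  ultimately show ?thesis
    by (simp add: scaleR_conv_of_real mult_ac)
qed

lemma riesz_sum_measurable [measurable]: "riesz_sum l a \<in> borel_measurable borel"
proof -
  have "riesz_sum l a = (\<lambda>R. \<Sum>k. indicator {real k<..} R * ((1 - real k / R) powr l * a k))"
  proof
    fix R
    have "(\<Sum>k. indicator {real k<..} R * ((1 - real k / R) powr l * a k))
       = (\<Sum>k | real k < R. indicator {real k<..} R * ((1 - real k / R) powr l * a k))"
      by (rule suminf_finite[OF finite_nat_less_real]) simp
    then show "riesz_sum l a R = (\<Sum>k. indicator {real k<..} R * ((1 - real k / R) powr l * a k))"
      by (simp add: riesz_sum_def)
  qed
  then show ?thesis by simp
qed

lemma norm_fourier_one: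
  assumes "l > - 1" "\<sigma> > 0"
  shows "norm (fourier (gamma_measure l \<sigma>) (\<lambda>_. 1) \<alpha>) = Gamma (l + 1) * norm (Complex \<sigma> \<alpha>) powr (- l - 1)"
  using norm_laplace_powr[of l "Complex \<sigma> \<alpha>"] assms
  by (simp add: fourier_gamma_measure laplace_powr_def)

lemma zonal_riesz_sum:
  assumes l: "l > 0" and \<sigma>: "\<sigma> > 0"
  shows "norm (fourier (gamma_measure l \<sigma>) (riesz_sum l (zonal_coeff l \<theta>)) \<alpha>)
     = Gamma (l + 1) * norm (Complex \<sigma> \<alpha>) powr (- l - 1) * (norm (1 - exp (- Complex \<sigma> \<alpha>) ^ 2) *
       (norm (1 - cis \<theta> * exp (- Complex \<sigma> \<alpha>)) * norm (1 - cis (- \<theta>) * exp (- Complex \<sigma> \<alpha>))) powr (- l - 1))" (is ?F)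
    and "integrable (gamma_measure l \<sigma>) (riesz_sum l (zonal_coeff l \<theta>))" (is ?I)
proof -
  have *: "norm (exp (- Complex \<sigma> \<beta>)) < 1" for \<beta> using \<sigma> by simp
  have L: "has_bochner_integral lborel
     (\<lambda>R. of_real (indicator {0<..} R * (R powr l * riesz_sum l (zonal_coeff l \<theta>) R)) * exp (- Complex \<sigma> \<beta> * of_real R))
     (laplace_powr l (Complex \<sigma> \<beta>) * (\<Sum>k. of_real (zonal_coeff l \<theta> k) * exp (- Complex \<sigma> \<beta>) ^ k))" for \<beta>
    using zonal_series(1)[OF l *[of \<beta>], of \<theta>] l \<sigma> by (intro laplace_riesz_sum) simp_all
  show ?F
    using L[of \<alpha>] zonal_series(2)[OF l *[of \<alpha>], of \<theta>] norm_laplace_powr[of l "Complex \<sigma> \<alpha>"] l \<sigma>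
    by (simp add: fourier_gamma_measure has_bochner_integral_iff norm_mult)
  have "integrable lborel (\<lambda>R. complex_of_real (indicator {0<..} R * (R powr l * riesz_sum l (zonal_coeff l \<theta>) R)) * exp (- Complex \<sigma> 0 * of_real R))"
    using L[of 0] by (simp add: has_bochner_integral_iff)
  then have "integrable lborel (\<lambda>R. norm (complex_of_real (indicator {0<..} R * (R powr l * riesz_sum l (zonal_coeff l \<theta>) R)) * exp (- Complex \<sigma> 0 * of_real R)))"
    by (rule integrable_norm)
  then have "integrable lborel (\<lambda>R. indicator {0<..} R * (R powr l * exp (- \<sigma> * R)) * riesz_sum l (zonal_coeff l \<theta>) R)"
    by (rule Bochner_Integration.integrable_bound) (auto simp: norm_mult abs_mult)
  then show ?I
    unfolding gamma_measure_def by (subst integrable_density) auto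
qed

text \<open>
  The modulus of the mean value of the kernel times \<open>cis (- \<alpha> * R)\<close> over the normalized measure.
\<close>

definition resonance_profile :: "real \<Rightarrow> real \<Rightarrow> real \<Rightarrow> real \<Rightarrow> real" where
  "resonance_profile l \<theta> \<alpha> \<sigma> = \<sigma> powr (l + 1) / Gamma (l + 1)
     * norm (fourier (gamma_measure l \<sigma>) (riesz_sum l (zonal_coeff l \<theta>)) \<alpha>)"

lemma Complex_tendsto: "((\<lambda>\<sigma>. Complex \<sigma> \<alpha>) \<longlongrightarrow> Complex 0 \<alpha>) (at_right 0)"
  unfolding Complex_eq by (intro tendsto_intros)

text \<open>
  In the limit a pure exponential has mean value zero, except for the constant one.
\<close>

lemma mean_mass_tendsto:
  assumes "l > 0"
  shows "((\<lambda>\<sigma>. \<sigma> powr (l + 1) / Gamma (l + 1) * norm (fourier (gamma_measure l \<sigma>) (\<lambda>_. 1) \<alpha>))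
     \<longlongrightarrow> (if \<alpha> = 0 then 1 else 0)) (at_right 0)"
proof -
  have G: "Gamma (l + 1) \<noteq> 0" using Gamma_real_pos[of "l + 1"] assms by linarith
  have eq: "\<forall>\<^sub>F \<sigma> in at_right 0. \<sigma> powr (l + 1) / Gamma (l + 1) * norm (fourier (gamma_measure l \<sigma>) (\<lambda>_. 1) \<alpha>)
     = \<sigma> powr (l + 1) * norm (Complex \<sigma> \<alpha>) powr (- l - 1)"
    using eventually_at_right_less[of 0] by eventually_elim (use assms in \<open>simp add: norm_fourier_one G\<close>)
  have "((\<lambda>\<sigma>. \<sigma> powr (l + 1) * norm (Complex \<sigma> \<alpha>) powr (- l - 1)) \<longlongrightarrow> (if \<alpha> = 0 then 1 else 0)) (at_right 0)"
  proof (cases "\<alpha> = 0")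
    case True
    have "\<forall>\<^sub>F \<sigma> in at_right 0. \<sigma> powr (l + 1) * norm (Complex \<sigma> \<alpha>) powr (- l - 1) = 1"
      using eventually_at_right_less[of 0] by eventually_elim (simp add: True cmod_def powr_add[symmetric])
    then show ?thesis using True by (simp add: tendsto_eventually)
  next
    case False
    have "((\<lambda>\<sigma>. \<sigma> powr (l + 1)) \<longlongrightarrow> 0) (at_right 0)"
      using assms by real_asymp
    then have "((\<lambda>\<sigma>. \<sigma> powr (l + 1) * norm (Complex \<sigma> \<alpha>) powr (- l - 1)) \<longlongrightarrow> 0 * norm (Complex 0 \<alpha>) powr (- l - 1)) (at_right 0)"
      by (intro tendsto_mult tendsto_powr tendsto_norm Complex_tendsto tendsto_const) (use False in \<open>simp_all add: complex_eq_iff\<close>)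
    then show ?thesis using False by simp
  qed
  then show ?thesis by (rule Lim_transform_eventually) (use eq in eventually_elim, simp)
qed

lemma resonance_profile_eq:
  assumes "l > 0" "\<sigma> > 0"
  shows "resonance_profile l \<theta> \<alpha> \<sigma> =
    (\<sigma> powr (l + 1) * norm (Complex \<sigma> \<alpha>) powr (- l - 1)) * (norm (1 - exp (- Complex \<sigma> \<alpha>) ^ 2) *
       (norm (1 - cis \<theta> * exp (- Complex \<sigma> \<alpha>)) * norm (1 - cis (- \<theta>) * exp (- Complex \<sigma> \<alpha>))) powr (- l - 1))"
proof -
  have "Gamma (l + 1) \<noteq> 0" using Gamma_real_pos[of "l + 1"] assms by linarith
  then show ?thesis using assms by (simp add: resonance_profile_def zonal_riesz_sum)
qed

lemma exp_imaginary: "exp (- Complex 0 \<alpha>) = cis (- \<alpha>)"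
  by (simp add: exp_eq_polar)

text \<open>
  Away from the singularities of the Poisson kernel the second factor stays bounded while the mean
  value of the exponential tends to zero. At \<open>\<alpha> = 0\<close> that mean value is one, but there the Poisson
  kernel tends to zero, because of its factor \<open>1 - X\<^sup>2\<close>.
\<close>

lemma off_resonance:
  assumes l: "l > 0" and p: "cis (\<theta> - \<alpha>) \<noteq> 1" "cis (- \<theta> - \<alpha>) \<noteq> 1"
  shows "(resonance_profile l \<theta> \<alpha> \<longlongrightarrow> 0) (at_right 0)"
proof -
  let ?P = "\<lambda>e. norm (1 - e ^ 2) * (norm (1 - cis \<theta> * e) * norm (1 - cis (- \<theta>) * e)) powr (- l - 1)"
  have E: "((\<lambda>\<sigma>. exp (- Complex \<sigma> \<alpha>)) \<longlongrightarrow> cis (- \<alpha>)) (at_right 0)"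
    unfolding exp_imaginary[symmetric] by (intro tendsto_intros Complex_tendsto)
  have nz: "norm (1 - cis \<theta> * cis (- \<alpha>)) * norm (1 - cis (- \<theta>) * cis (- \<alpha>)) \<noteq> 0"
    using p by (simp add: cis_mult)
  have lim: "((\<lambda>\<sigma>. ?P (exp (- Complex \<sigma> \<alpha>))) \<longlongrightarrow> ?P (cis (- \<alpha>))) (at_right 0)"
    by (intro tendsto_mult tendsto_powr tendsto_norm tendsto_diff tendsto_power tendsto_const E nz)
  have G: "Gamma (l + 1) \<noteq> 0" using Gamma_real_pos[of "l + 1"] l by linarith
  have mass: "((\<lambda>\<sigma>. \<sigma> powr (l + 1) * norm (Complex \<sigma> \<alpha>) powr (- l - 1)) \<longlongrightarrow> (if \<alpha> = 0 then 1 else 0)) (at_right 0)"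
  proof (rule Lim_transform_eventually[OF mean_mass_tendsto[OF l, of \<alpha>]])
    show "\<forall>\<^sub>F \<sigma> in at_right 0. \<sigma> powr (l + 1) / Gamma (l + 1) * norm (fourier (gamma_measure l \<sigma>) (\<lambda>_. 1) \<alpha>)
        = \<sigma> powr (l + 1) * norm (Complex \<sigma> \<alpha>) powr (- l - 1)"
      using eventually_at_right_less[of 0] by eventually_elim (use l in \<open>simp add: norm_fourier_one G\<close>)
  qed
  have "((\<lambda>\<sigma>. \<sigma> powr (l + 1) * norm (Complex \<sigma> \<alpha>) powr (- l - 1) * ?P (exp (- Complex \<sigma> \<alpha>))) \<longlongrightarrow> (if \<alpha> = 0 then 1 else 0) * ?P (cis (- \<alpha>))) (at_right 0)"
    by (rule tendsto_mult[OF mass lim])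
  moreover have "(if \<alpha> = 0 then 1 else 0) * ?P (cis (- \<alpha>)) = 0" by simp
  ultimately have "((\<lambda>\<sigma>. \<sigma> powr (l + 1) * norm (Complex \<sigma> \<alpha>) powr (- l - 1) * ?P (exp (- Complex \<sigma> \<alpha>))) \<longlongrightarrow> 0) (at_right 0)"
    by simp
  then show ?thesis
  proof (rule Lim_transform_eventually)
    show "\<forall>\<^sub>F \<sigma> in at_right 0. \<sigma> powr (l + 1) * norm (Complex \<sigma> \<alpha>) powr (- l - 1) * ?P (exp (- Complex \<sigma> \<alpha>))
        = resonance_profile l \<theta> \<alpha> \<sigma>"
      using eventually_at_right_less[of 0] by eventually_elim (use l in \<open>simp add: resonance_profile_eq\<close>)
  qed
qed

lemma norm_one_minus_cis: "0 \<le> sin \<theta> \<Longrightarrow> norm (1 - cis (- 2 * \<theta>)) = 2 * sin \<theta>"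
proof -
  assume "0 \<le> sin \<theta>"
  have "(norm (1 - cis (- 2 * \<theta>)))\<^sup>2 = (1 - cos (2 * \<theta>))\<^sup>2 + (sin (2 * \<theta>))\<^sup>2"
    by (simp add: cmod_power2)
  also have "\<dots> = 2 - 2 * cos (2 * \<theta>)"
    using sin_cos_squared_add[of "2 * \<theta>"] by (simp add: power2_eq_square algebra_simps)
  also have "\<dots> = (2 * sin \<theta>)\<^sup>2"
    by (simp add: cos_double_sin power2_eq_square)
  finally show ?thesis
    by (rule power2_eq_imp_eq) (use \<open>0 \<le> sin \<theta>\<close> in auto)
qed

text \<open>
  At \<open>\<alpha> = \<theta>\<close> one of the two linear factors equals \<open>1 - exp (- \<sigma>)\<close>, which is asymptotic to \<open>\<sigma>\<close> and
  cancels the normalization. The limit is the amplitude of the kernel at angle \<open>\<theta>\<close>.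
\<close>

lemma at_resonance:
  assumes l: "l > 0" and \<theta>: "0 < \<theta>" "\<theta> < pi"
  shows "(resonance_profile l \<theta> \<theta> \<longlongrightarrow> \<theta> powr (- l - 1) * (2 * sin \<theta>) powr (- l)) (at_right 0)"
proof -
  have sn: "sin \<theta> > 0" using \<theta> by (rule sin_gt_zero)
  let ?e = "\<lambda>\<sigma>. exp (- Complex \<sigma> \<theta>)"
  have E: "(?e \<longlongrightarrow> cis (- \<theta>)) (at_right 0)"
    unfolding exp_imaginary[symmetric] by (intro tendsto_intros Complex_tendsto)
  have c2: "norm (1 - cis (- \<theta>) ^ 2) = 2 * sin \<theta>" "norm (1 - cis (- \<theta>) * cis (- \<theta>)) = 2 * sin \<theta>"
    using norm_one_minus_cis[of \<theta>] sn by (simp_all add: power2_eq_square cis_mult)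
  have eq: "cis \<theta> * ?e \<sigma> = of_real (exp (- \<sigma>))" for \<sigma>
    by (simp add: exp_eq_polar cis_mult)
  have one: "((\<lambda>\<sigma>. \<sigma> / (1 - exp (- \<sigma>))) \<longlongrightarrow> 1) (at_right (0::real))"
    by real_asymp
  have pos: "((\<lambda>\<sigma>. (\<sigma> / (1 - exp (- \<sigma>))) powr (l + 1) * norm (Complex \<sigma> \<theta>) powr (- l - 1)
       * (norm (1 - ?e \<sigma> ^ 2) * norm (1 - cis (- \<theta>) * ?e \<sigma>) powr (- l - 1)))
      \<longlongrightarrow> 1 powr (l + 1) * norm (Complex 0 \<theta>) powr (- l - 1)
       * (norm (1 - cis (- \<theta>) ^ 2) * norm (1 - cis (- \<theta>) * cis (- \<theta>)) powr (- l - 1))) (at_right 0)"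
    by (intro tendsto_mult tendsto_powr one tendsto_const tendsto_norm Complex_tendsto tendsto_diff tendsto_power E)
      (use c2 sn \<theta> in \<open>auto simp: complex_eq_iff\<close>)
  moreover have "1 powr (l + 1) * norm (Complex 0 \<theta>) powr (- l - 1)
       * (norm (1 - cis (- \<theta>) ^ 2) * norm (1 - cis (- \<theta>) * cis (- \<theta>)) powr (- l - 1)) = \<theta> powr (- l - 1) * (2 * sin \<theta>) powr (- l)"
    unfolding c2 using \<theta> sn by (simp add: cmod_def powr_diff)
  ultimately have "((\<lambda>\<sigma>. (\<sigma> / (1 - exp (- \<sigma>))) powr (l + 1) * norm (Complex \<sigma> \<theta>) powr (- l - 1)
       * (norm (1 - ?e \<sigma> ^ 2) * norm (1 - cis (- \<theta>) * ?e \<sigma>) powr (- l - 1))) \<longlongrightarrow> \<theta> powr (- l - 1) * (2 * sin \<theta>) powr (- l)) (at_right 0)"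
    by simp
  then show ?thesis
  proof (rule Lim_transform_eventually)
    show "\<forall>\<^sub>F \<sigma> in at_right 0. (\<sigma> / (1 - exp (- \<sigma>))) powr (l + 1) * norm (Complex \<sigma> \<theta>) powr (- l - 1)
       * (norm (1 - ?e \<sigma> ^ 2) * norm (1 - cis (- \<theta>) * ?e \<sigma>) powr (- l - 1)) = resonance_profile l \<theta> \<theta> \<sigma>"
      using eventually_at_right_less[of 0]
    proof eventually_elim
      case (elim \<sigma>)
      define a where "a = 1 - exp (- \<sigma>)"
      have a: "a > 0" using elim by (simp add: a_def)
      have "1 - cis \<theta> * ?e \<sigma> = of_real a" by (simp add: eq a_def)
      then have n: "norm (1 - cis \<theta> * ?e \<sigma>) = a" using a by simp
      have e: "- l - 1 = - (l + 1)" by simp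
      have d: "(\<sigma> / a) powr (l + 1) = \<sigma> powr (l + 1) * a powr (- l - 1)"
        unfolding e powr_minus using a elim by (subst powr_divide) (auto simp: divide_inverse)
      show ?case
        unfolding resonance_profile_eq[OF l elim] n a_def[symmetric] d powr_mult by (simp only: mult_ac)
    qed
  qed
qed

text \<open>
  Let \<open>\<sigma>\<close> tend to zero in the inequality for Riesz products. By independence of the angles no
  pattern other than \<open>\<theta> j\<close> and \<open>- \<theta> j\<close> meets a singularity of the \<open>j\<close>-th kernel, and only the zero
  pattern contributes to the mean value of the Riesz product. The hypothesis on \<open>c\<close> says that no
  nontrivial integer combination of the angles is a multiple of \<open>2 * pi\<close>.
\<close>

theorem resonance:
  fixes I :: "'i set" and \<theta> m :: "'i \<Rightarrow> real"
  assumes l: "l > 0" and I: "finite I"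
    and \<theta>: "\<And>j. j \<in> I \<Longrightarrow> 0 < \<theta> j \<and> \<theta> j < pi"
    and m: "\<And>j. j \<in> I \<Longrightarrow> m j \<ge> 0"
    and gen: "\<And>c :: 'i \<Rightarrow> int. cis (\<Sum>i\<in>I. of_int (c i) * \<theta> i) = 1 \<Longrightarrow> \<forall>i\<in>I. c i = 0"
    and B: "\<And>R. R > 0 \<Longrightarrow> \<bar>riesz_sum l (\<lambda>k. \<Sum>j\<in>I. m j * zonal_coeff l (\<theta> j) k) R\<bar> \<le> B"
  shows "(\<Sum>j\<in>I. m j * (\<theta> j powr (- l - 1) * (2 * sin (\<theta> j)) powr (- l))) \<le> B"
proof -
  let ?S = "sign_patterns I" and ?O = "\<lambda>j. sign_patterns I - {single_pattern I j 1, single_pattern I j (-1)}"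
  let ?G = "\<lambda>\<sigma>. \<sigma> powr (l + 1) / Gamma (l + 1)"
  define mass where "mass = (\<lambda>\<alpha> \<sigma>. ?G \<sigma> * norm (fourier (gamma_measure l \<sigma>) (\<lambda>_. 1) \<alpha>))"
  have B0: "B \<ge> 0" using B[of 1] by simp
  have Gl: "Gamma (l + 1) > 0" using l by (intro Gamma_real_pos) simp
  have le: "(\<Sum>j\<in>I. m j * (resonance_profile l (\<theta> j) (\<theta> j) \<sigma> - (\<Sum>\<epsilon>\<in>?O j. resonance_profile l (\<theta> j) (frequency I \<theta> \<epsilon>) \<sigma>)))
     \<le> B * (\<Sum>\<epsilon>\<in>?S. mass (frequency I \<theta> \<epsilon>) \<sigma>)" if \<sigma>: "\<sigma> > 0" for \<sigma>
  proof -
    have pos: "AE R in gamma_measure l \<sigma>. R > 0"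
      unfolding gamma_measure_def by (subst AE_density) (auto simp: indicator_def)
    have sum: "riesz_sum l (\<lambda>k. \<Sum>j\<in>I. m j * zonal_coeff l (\<theta> j) k) R = (\<Sum>j\<in>I. m j * riesz_sum l (zonal_coeff l (\<theta> j)) R)" for R
      unfolding riesz_sum_def sum_distrib_left by (subst sum.swap) (simp add: mult_ac)
    have "AE R in gamma_measure l \<sigma>. \<bar>\<Sum>j\<in>I. m j * riesz_sum l (zonal_coeff l (\<theta> j)) R\<bar> \<le> B"
      using pos by eventually_elim (use B sum in auto)
    from riesz_product_inequality[OF finite_gamma_measure sets_gamma_measure I zonal_riesz_sum(2)[OF l \<sigma>] m this B0, of \<theta>]
    have "?G \<sigma> * (\<Sum>j\<in>I. m j * (norm (fourier (gamma_measure l \<sigma>) (riesz_sum l (zonal_coeff l (\<theta> j))) (\<theta> j))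
           - (\<Sum>\<epsilon>\<in>?O j. norm (fourier (gamma_measure l \<sigma>) (riesz_sum l (zonal_coeff l (\<theta> j))) (frequency I \<theta> \<epsilon>)))))
      \<le> ?G \<sigma> * (B * (\<Sum>\<epsilon>\<in>?S. norm (fourier (gamma_measure l \<sigma>) (\<lambda>_. 1) (frequency I \<theta> \<epsilon>))))"
      using l \<sigma> Gl by (intro mult_left_mono) auto
    then show ?thesis
      by (simp add: resonance_profile_def mass_def sum_distrib_left right_diff_distrib mult_ac)
  qed
  \<comment> \<open>Independence of the angles: a pattern is determined by its frequency modulo \<open>2 * pi\<close>, even
    against a pattern supported at a single index.\<close>
  have freq_diff: "cis (frequency I \<theta> \<epsilon> - of_int c * \<theta> j) = 1 \<Longrightarrow> \<epsilon> = single_pattern I j c"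
    if "\<epsilon> \<in> ?S" "j \<in> I" for \<epsilon> c j
  proof -
    assume *: "cis (frequency I \<theta> \<epsilon> - of_int c * \<theta> j) = 1"
    have "frequency I \<theta> \<epsilon> - of_int c * \<theta> j = (\<Sum>i\<in>I. of_int (\<epsilon> i - single_pattern I j c i) * \<theta> i)"
      using frequency_single[OF I \<open>j \<in> I\<close>, of \<theta> c]
      by (simp add: frequency_def sum_subtractf left_diff_distrib)
    with * gen[of "\<lambda>i. \<epsilon> i - single_pattern I j c i"] have "\<forall>i\<in>I. \<epsilon> i - single_pattern I j c i = 0" by simp
    then show "\<epsilon> = single_pattern I j c"
      using \<open>\<epsilon> \<in> ?S\<close> by (auto simp: sign_patterns_def single_pattern_def fun_eq_iff PiE_def extensional_def)
  qed
  have off: "(resonance_profile l (\<theta> j) (frequency I \<theta> \<epsilon>) \<longlongrightarrow> 0) (at_right 0)" if "j \<in> I" "\<epsilon> \<in> ?O j" for j \<epsilon>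
  proof (rule off_resonance[OF l])
    have inv: "cis (- x) = 1 \<longleftrightarrow> cis x = 1" for x
      by (simp add: complex_eq_iff)
    show "cis (\<theta> j - frequency I \<theta> \<epsilon>) \<noteq> 1"
      using freq_diff[of \<epsilon> j 1] that inv[of "frequency I \<theta> \<epsilon> - \<theta> j"] by auto
    show "cis (- \<theta> j - frequency I \<theta> \<epsilon>) \<noteq> 1"
      using freq_diff[of \<epsilon> j "-1"] that inv[of "frequency I \<theta> \<epsilon> + \<theta> j"] by (auto simp: algebra_simps)
  qed
  define z where "z = (\<lambda>i\<in>I. 0 :: int)"
  have z: "z \<in> ?S" by (auto simp: z_def sign_patterns_def)
  have fz: "frequency I \<theta> \<epsilon> = 0 \<longleftrightarrow> \<epsilon> = z" if "\<epsilon> \<in> ?S" for \<epsilon>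
  proof
    assume "frequency I \<theta> \<epsilon> = 0"
    then have "\<forall>i\<in>I. \<epsilon> i = 0" using gen[of \<epsilon>] by (simp add: frequency_def)
    then show "\<epsilon> = z"
      using that by (auto simp: sign_patterns_def z_def fun_eq_iff PiE_def extensional_def)
  qed (simp add: z_def frequency_def)
  have lhs: "((\<lambda>\<sigma>. \<Sum>j\<in>I. m j * (resonance_profile l (\<theta> j) (\<theta> j) \<sigma> - (\<Sum>\<epsilon>\<in>?O j. resonance_profile l (\<theta> j) (frequency I \<theta> \<epsilon>) \<sigma>)))
     \<longlongrightarrow> (\<Sum>j\<in>I. m j * (\<theta> j powr (- l - 1) * (2 * sin (\<theta> j)) powr (- l) - (\<Sum>\<epsilon>\<in>?O j. 0)))) (at_right 0)"
    by (intro tendsto_intros at_resonance l off) (use \<theta> in auto)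
  have "((\<lambda>\<sigma>. B * (\<Sum>\<epsilon>\<in>?S. mass (frequency I \<theta> \<epsilon>) \<sigma>)) \<longlongrightarrow> B * (\<Sum>\<epsilon>\<in>?S. if frequency I \<theta> \<epsilon> = 0 then 1 else 0)) (at_right 0)"
    unfolding mass_def by (intro tendsto_intros mean_mass_tendsto l)
  also have "(\<Sum>\<epsilon>\<in>?S. if frequency I \<theta> \<epsilon> = 0 then 1 else 0 :: real) = (\<Sum>\<epsilon>\<in>?S. if \<epsilon> = z then 1 else 0)"
    by (intro sum.cong) (simp_all add: fz)
  also have "\<dots> = 1"
    using z finite_sign_patterns[OF I] by simp
  finally have rhs: "((\<lambda>\<sigma>. B * (\<Sum>\<epsilon>\<in>?S. mass (frequency I \<theta> \<epsilon>) \<sigma>)) \<longlongrightarrow> B) (at_right 0)"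
    by simp
  have "\<forall>\<^sub>F \<sigma> in at_right 0. (\<Sum>j\<in>I. m j * (resonance_profile l (\<theta> j) (\<theta> j) \<sigma> - (\<Sum>\<epsilon>\<in>?O j. resonance_profile l (\<theta> j) (frequency I \<theta> \<epsilon>) \<sigma>)))
     \<le> B * (\<Sum>\<epsilon>\<in>?S. mass (frequency I \<theta> \<epsilon>) \<sigma>)"
    using eventually_at_right_less[of 0] by eventually_elim (rule le)
  from tendsto_le[OF trivial_limit_at_right_real rhs lhs this] show ?thesis by simp
qed


section \<open>Caps, level sets and fine partitions of the sphere\<close>

lemma finite_sphere_measure: "finite_measure (sphere_measure :: 'a::euclidean_space measure)"
  by standard (simp add: space_sphere_measure emeasure_sphere_measure_total)

interpretation sphere: finite_measure "sphere_measure :: 'a::euclidean_space measure"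
  by (rule finite_sphere_measure)

lemma sets_sphere_measureI: "A \<in> sets borel \<Longrightarrow> A \<subseteq> sphere 0 1 \<Longrightarrow> A \<in> sets sphere_measure"
  by (auto simp: sets_sphere_measure sets_restrict_space image_iff intro!: bexI[of _ A])

lemma measure_sphere_total: "measure sphere_measure (sphere (0::'a::euclidean_space) 1) = 1"
  by (simp add: measure_def emeasure_sphere_measure_total)

lemma measure_sphere_measure:
  fixes A :: "'a::euclidean_space set"
  assumes A: "A \<in> sets borel" "A \<subseteq> sphere 0 1"
  shows "measure sphere_measure A = measure lborel (ball 0 1 \<inter> sgn -` A) / measure lborel (ball (0::'a) 1)"
proof -
  have "emeasure lborel (ball 0 1 \<inter> sgn -` A) \<le> emeasure lborel (ball (0::'a) 1)"
    by (rule emeasure_mono) auto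
  then have "emeasure lborel (ball 0 1 \<inter> sgn -` A) = ennreal (measure lborel (ball 0 1 \<inter> sgn -` A))"
    using emeasure_unit_ball(2)[where 'a = 'a] by (intro emeasure_eq_ennreal_measure) (auto simp: top_unique)
  moreover have "emeasure lborel (ball (0::'a) 1) = ennreal (measure lborel (ball (0::'a) 1))"
    using emeasure_unit_ball(2)[where 'a = 'a] by (intro emeasure_eq_ennreal_measure) auto
  moreover have "measure lborel (ball (0::'a) 1) > 0" by (rule content_ball_pos) simp
  ultimately show ?thesis
    unfolding measure_def[of sphere_measure] emeasure_sphere_measure[OF A]
    by (simp add: divide_ennreal)
qed

text \<open>
  For \<open>0 \<le> v < 1\<close> the cone lies in the frontier of the convex set where \<open>v * norm z \<le> x \<bullet> z\<close>: a
  small step in the direction \<open>- x\<close> leaves this set. For \<open>v \<ge> 1\<close> it is contained in a line, by the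
  equality case of the Cauchy-Schwarz inequality.
\<close>

lemma negligible_cone:
  fixes x :: "'a::euclidean_space"
  assumes x: "norm x = 1" and D: "DIM('a) \<ge> 2"
  shows "negligible {z. x \<bullet> z = v * norm z}"
proof -
  have nonneg: "negligible {z. x \<bullet> z = v * norm z}" if x: "norm x = 1" and v: "v \<ge> 0" for x :: 'a and v
  proof (cases "v < 1")
    case True
    define C where "C = {z. v * norm z \<le> x \<bullet> z}"
    have "convex C"
    proof (rule convexI)
      fix y z and a b :: real
      assume yz: "y \<in> C" "z \<in> C" and ab: "0 \<le> a" "0 \<le> b" "a + b = 1"
      have "v * norm (a *\<^sub>R y + b *\<^sub>R z) \<le> v * (a * norm y + b * norm z)"
        using norm_triangle_ineq[of "a *\<^sub>R y" "b *\<^sub>R z"] ab v by (intro mult_left_mono) auto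
      also have "\<dots> = a * (v * norm y) + b * (v * norm z)" by (simp add: algebra_simps)
      also have "\<dots> \<le> a * (x \<bullet> y) + b * (x \<bullet> z)"
        using yz ab by (intro add_mono mult_left_mono) (auto simp: C_def)
      finally show "a *\<^sub>R y + b *\<^sub>R z \<in> C" by (simp add: C_def inner_add_right)
    qed
    then have "negligible (frontier C)" by (rule negligible_convex_frontier)
    moreover have "{z. x \<bullet> z = v * norm z} \<subseteq> frontier C"
    proof
      fix z assume "z \<in> {z. x \<bullet> z = v * norm z}"
      then have z: "x \<bullet> z = v * norm z" by simp
      have "z \<notin> interior C"
      proof
        assume "z \<in> interior C"
        then obtain e where e: "e > 0" "cball z e \<subseteq> C" by (auto simp: mem_interior_cball)
        have "z - e *\<^sub>R x \<in> C" using e x by (auto simp: subset_iff dist_norm)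
        then have "v * norm (z - e *\<^sub>R x) \<le> v * norm z - e"
          using z x by (simp add: C_def inner_diff_right dot_square_norm)
        moreover have "v * (norm z - e) \<le> v * norm (z - e *\<^sub>R x)"
          using norm_triangle_ineq2[of z "e *\<^sub>R x"] x e v by (intro mult_left_mono) auto
        ultimately have "e * 1 \<le> e * v" by (simp add: algebra_simps)
        with e True show False by simp
      qed
      moreover have "z \<in> closure C" using z closure_subset[of C] by (auto simp: C_def)
      ultimately show "z \<in> frontier C" by (simp add: frontier_def)
    qed
    ultimately show ?thesis by (rule negligible_subset)
  next
    case False
    have "{z. x \<bullet> z = v * norm z} \<subseteq> span {x}"
    proof
      fix z assume "z \<in> {z. x \<bullet> z = v * norm z}"
      then have "norm z \<le> x \<bullet> z" using False mult_right_mono[of 1 v "norm z"] by auto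
      then have "x \<bullet> z = norm x * norm z"
        using norm_cauchy_schwarz[of x z] x by auto
      then have "norm x *\<^sub>R z = norm z *\<^sub>R x" by (simp only: norm_cauchy_schwarz_eq)
      then show "z \<in> span {x}" using x by (auto simp: span_singleton)
    qed
    moreover have "negligible (span {x})"
      using D dim_le_card'[of "{x}"] by (intro negligible_lowdim) simp
    ultimately show ?thesis by (rule negligible_subset[rotated])
  qed
  show ?thesis
  proof (cases "v \<ge> 0")
    case False
    then show ?thesis using nonneg[of "- x" "- v"] x by simp
  qed (use nonneg x in blast)
qed

lemma level_set_null:
  fixes x :: "'a::euclidean_space"
  assumes x: "norm x = 1" and D: "DIM('a) \<ge> 2"
  shows "{y \<in> sphere 0 1. x \<bullet> y = v} \<in> null_sets sphere_measure"
proof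
  let ?A = "{y \<in> sphere 0 1. x \<bullet> y = v}"
  have "closed ({y. x \<bullet> y = v} \<inter> sphere 0 1)"
    by (intro closed_Int closed_Collect_eq continuous_intros) simp
  then have A: "?A \<in> sets borel" by (intro borel_closed) (simp add: Int_def conj_commute)
  then show "?A \<in> sets sphere_measure" by (intro sets_sphere_measureI) auto
  have "ball 0 1 \<inter> sgn -` ?A \<subseteq> {z. x \<bullet> z = v * norm z}"
    by (auto simp: sgn_div_norm field_simps)
  then have "negligible (ball 0 1 \<inter> sgn -` ?A)"
    using negligible_cone[OF x D] negligible_subset by blast
  moreover have "ball 0 1 \<inter> sgn -` ?A \<in> sets borel"
    using measurable_sets_borel[OF borel_measurable_sgn A] by simp
  ultimately have "emeasure lborel (ball 0 1 \<inter> sgn -` ?A) = 0"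
    by (simp add: negligible_iff_null_sets null_sets_completion_iff null_sets_def)
  then show "emeasure sphere_measure ?A = 0"
    using A by (subst emeasure_sphere_measure) auto
qed

definition cap :: "'a::euclidean_space \<Rightarrow> real \<Rightarrow> 'a set" where
  "cap x r = {y \<in> sphere 0 1. dist x y < r}"

lemma cap_borel: "cap x r \<in> sets borel"
proof -
  have "cap x r = sphere 0 1 \<inter> ball x r" by (auto simp: cap_def)
  then show ?thesis by simp
qed

lemma cap_sets: "cap x r \<in> sets sphere_measure"
  using cap_borel by (intro sets_sphere_measureI) (auto simp: cap_def)

text \<open>
  A cap of radius \<open>r\<close> on the sphere of dimension \<open>n\<close> has measure of order \<open>r ^ n\<close>. The cone over it
  contains about \<open>1 / (2 * r)\<close> disjoint balls of radius \<open>r / 4\<close> with centres on the ray through \<open>x\<close>,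
  and each of them has volume of order \<open>r ^ (n + 1)\<close>. Dyadic radii make the number of balls an
  exact power of two.
\<close>

lemma cap_measure_ge:
  fixes x :: "'a::euclidean_space"
  assumes x: "norm x = 1" and n: "DIM('a) = n + 1"
  shows "measure sphere_measure (cap x ((1/2) ^ (j + 1))) \<ge> ((1/2) ^ (j + 1)) ^ n / (2 * 4 ^ (n + 1))"
proof -
  define r :: real where "r = (1/2) ^ (j + 1)"
  have r: "0 < r" "r \<le> 1/2" by (auto simp: r_def power_le_one)
  have r2: "2 ^ j * r = 1 / 2" by (simp add: r_def power_one_over)
  \<comment> \<open>Centres \<open>s k *\<^sub>R x\<close> with norms between \<open>1/2\<close> and \<open>3/4\<close>, at mutual distance at least \<open>r / 2\<close>, twice the radius of the balls.\<close>
  define s where "s = (\<lambda>k::nat. 1/2 + real k * (r / 2))"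
  have s: "1/2 \<le> s k" "s k \<le> 3/4" if "k < 2 ^ j" for k
  proof -
    have "real k \<le> 2 ^ j" using that by (simp add: order_less_imp_le)
    then have "real k * r \<le> 2 ^ j * r" using r by (intro mult_right_mono) auto
    then have "real k * r \<le> 1 / 2" by (simp only: r2)
    moreover have "real k * (r / 2) = (real k * r) / 2" by simp
    ultimately have "real k * (r / 2) \<le> 1 / 4" by linarith
    moreover have "0 \<le> real k * (r / 2)" using r by simp
    ultimately show "1/2 \<le> s k" "s k \<le> 3/4" unfolding s_def by linarith+
  qed
  define b where "b = (\<lambda>k. ball (s k *\<^sub>R x) (r / 4))"
  have disj: "disjoint_family_on b {..<2 ^ j}"
    unfolding disjoint_family_on_def
  proof (intro ballI impI)
    fix k m :: nat assume "k \<noteq> m"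
    then have "1 \<le> \<bar>real k - real m\<bar>" by linarith
    then have "r / 2 \<le> \<bar>real k - real m\<bar> * (r / 2)" using r by simp
    also have "\<dots> = \<bar>(real k - real m) * (r / 2)\<bar>" using r by (simp add: abs_mult)
    also have "\<dots> = \<bar>s k - s m\<bar>" by (simp add: s_def left_diff_distrib diff_divide_distrib)
    also have "\<dots> = dist (s k *\<^sub>R x) (s m *\<^sub>R x)" using x by (simp add: dist_norm scaleR_left_diff_distrib[symmetric])
    finally show "b k \<inter> b m = {}" unfolding b_def by (intro disjoint_ballI) simp
  qed
  have sub: "b k \<subseteq> ball 0 1 \<inter> sgn -` cap x r" if k: "k < 2 ^ j" for k
  proof
    fix z assume "z \<in> b k"
    then have d: "norm (z - s k *\<^sub>R x) < r / 4" by (simp add: b_def dist_norm norm_minus_commute)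
    have sk: "1/2 \<le> s k" "s k \<le> 3/4" using s[OF k] by auto
    have nz: "\<bar>norm z - s k\<bar> < r / 4"
      using norm_triangle_ineq3[of z "s k *\<^sub>R x"] d x sk by simp
    then have z0: "norm z > 0" and z1: "norm z < 1" using sk r by linarith+
    have "s k *\<^sub>R (x - sgn z) = (s k *\<^sub>R x - z) + (norm z - s k) *\<^sub>R sgn z"
      using z0 by (simp add: sgn_div_norm algebra_simps)
    then have "s k * norm (x - sgn z) \<le> norm (s k *\<^sub>R x - z) + \<bar>norm z - s k\<bar>"
      using sk z0 norm_triangle_ineq[of "s k *\<^sub>R x - z" "(norm z - s k) *\<^sub>R sgn z"]
      by (metis abs_of_nonneg divide_nonneg_pos dual_order.trans mult.right_neutral norm_eq_zero norm_scaleR norm_sgn order_less_irrefl zero_le_one zero_less_numeral)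
    also have "\<dots> < r / 2" using d nz by (simp add: norm_minus_commute)
    finally have "s k * norm (x - sgn z) < r / 2" .
    moreover have "1/2 * norm (x - sgn z) \<le> s k * norm (x - sgn z)" using sk by (intro mult_right_mono) auto
    ultimately have "dist x (sgn z) < r" by (simp add: dist_norm)
    then show "z \<in> ball 0 1 \<inter> sgn -` cap x r" using z0 z1 by (auto simp: cap_def norm_sgn)
  qed
  have ms: "ball 0 1 \<inter> sgn -` cap x r \<in> sets borel"
    using measurable_sets_borel[OF borel_measurable_sgn cap_borel[of x r]] by simp
  have fm: "ball 0 1 \<inter> sgn -` cap x r \<in> fmeasurable lborel"
    by (rule fmeasurable_Int_fmeasurable[of "ball 0 1"]) (use measurable_sets_borel[OF borel_measurable_sgn cap_borel[of x r]] in \<open>auto intro!: fmeasurableI simp: emeasure_unit_ball(2)[unfolded infinity_ennreal_def] less_top[symmetric]\<close>)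
  define V where "V = measure lborel (ball (0::'a) 1)"
  have V: "V > 0" unfolding V_def by (rule content_ball_pos) simp
  have cb: "measure lborel (b k) = (r / 4) ^ (n + 1) * V" for k
    unfolding b_def V_def n[symmetric] using r by (intro content_ball_conv_unit_ball) simp
  have "2 ^ j * ((r / 4) ^ (n + 1) * V) = (\<Sum>k<2 ^ j. measure lborel (b k))"
    by (simp only: cb sum_constant card_lessThan of_nat_power of_nat_numeral)
  also have "\<dots> = measure lborel (\<Union>k<2 ^ j. b k)"
    using disj emeasure_lborel_ball_finite by (intro measure_finite_Union[symmetric]) (auto simp: b_def less_top)
  also have "\<dots> \<le> measure lborel (ball 0 1 \<inter> sgn -` cap x r)"
    using sub fm by (intro measure_mono_fmeasurable) (auto simp: b_def)
  also have "\<dots> = measure sphere_measure (cap x r) * V"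
    using V by (subst measure_sphere_measure) (auto simp: cap_borel V_def cap_def)
  finally have "2 ^ j * (r / 4) ^ (n + 1) \<le> measure sphere_measure (cap x r)"
    using V by (simp add: mult.assoc[symmetric])
  moreover have "2 ^ j * (r / 4) ^ (n + 1) = (2 ^ j * r) * (r ^ n / 4 ^ (n + 1))"
    by (simp add: power_divide)
  ultimately show ?thesis unfolding r2 by (simp add: r_def)
qed

lemma fine_partition:
  assumes "\<delta> > 0"
  obtains N :: nat and Q :: "nat \<Rightarrow> 'a::euclidean_space set"
  where "\<And>i. Q i \<in> sets sphere_measure" "disjoint_family_on Q {..<N}" "(\<Union>i<N. Q i) = sphere 0 1"
    "\<And>i x y. x \<in> Q i \<Longrightarrow> y \<in> Q i \<Longrightarrow> dist x y < \<delta>"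
proof -
  obtain k where k: "finite k" "sphere (0::'a) 1 \<subseteq> (\<Union>x\<in>k. ball x (\<delta> / 2))"
    using compact_sphere[of "0::'a" 1] assms unfolding compact_eq_totally_bounded
    by (meson half_gt_zero)
  obtain h where h: "bij_betw h {..<card k} k"
    using ex_bij_betw_nat_finite[OF k(1)] by (auto simp: atLeast0LessThan)
  define Q where "Q = (\<lambda>i. sphere 0 1 \<inter> disjointed (\<lambda>i. ball (h i) (\<delta> / 2)) i)"
  show thesis
  proof (rule that[of Q "card k"])
    show "Q i \<in> sets sphere_measure" for i
      unfolding Q_def by (intro sets_sphere_measureI sets.Int sets.range_disjointed_sets[THEN subsetD, OF _ rangeI]) auto
    show "disjoint_family_on Q {..<card k}"
      using disjoint_family_disjointed[of "\<lambda>i. ball (h i) (\<delta> / 2)"]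
      by (auto simp: Q_def disjoint_family_on_def)
    have "(\<Union>i<card k. ball (h i) (\<delta> / 2)) = (\<Union>x\<in>k. ball x (\<delta> / 2))"
      using h by (metis (no_types, lifting) SUP_image bij_betw_imp_surj_on comp_apply SUP_cong)
    moreover have "(\<Union>i<card k. disjointed (\<lambda>i. ball (h i) (\<delta> / 2)) i) = (\<Union>i<card k. ball (h i) (\<delta> / 2))"
      using finite_UN_disjointed_eq[of "\<lambda>i. ball (h i) (\<delta> / 2)" "card k"] by (simp add: atLeast0LessThan)
    ultimately show "(\<Union>i<card k. Q i) = sphere 0 1"
      using k(2) by (auto simp: Q_def)
    show "dist x y < \<delta>" if "x \<in> Q i" "y \<in> Q i" for i x y
    proof -
      have "x \<in> ball (h i) (\<delta> / 2)" "y \<in> ball (h i) (\<delta> / 2)"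
        using that disjointed_subset[of "\<lambda>i. ball (h i) (\<delta> / 2)" i] by (auto simp: Q_def)
      then show ?thesis using dist_triangle_half_r[of "h i" x \<delta> y] by (simp add: dist_commute)
    qed
  qed
qed


section \<open>Point masses in general position\<close>

definition angle :: "'a::euclidean_space \<Rightarrow> 'a \<Rightarrow> real" where
  "angle x y = arccos (x \<bullet> y)"

lemma inner_sphere_bounds: "norm x = 1 \<Longrightarrow> norm y = 1 \<Longrightarrow> x \<bullet> y \<in> {-1..1}"
  using Cauchy_Schwarz_ineq2[of x y] by auto

lemma cos_angle: "norm x = 1 \<Longrightarrow> norm y = 1 \<Longrightarrow> cos (angle x y) = x \<bullet> y"
  using inner_sphere_bounds[of x y] by (simp add: angle_def)

lemma angle_bounds: "norm x = 1 \<Longrightarrow> norm y = 1 \<Longrightarrow> 0 \<le> angle x y \<and> angle x y \<le> pi"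
  using inner_sphere_bounds[of x y] by (simp add: angle_def arccos_lbound arccos_ubound)

lemma id_sphere_measurable [measurable]: "(\<lambda>x. x) \<in> measurable sphere_measure borel"
  unfolding measurable_cong_sets[OF sets_sphere_measure refl] by (rule measurable_restrict_space1) simp

lemma angle_measurable:
  assumes [measurable]: "f \<in> measurable M borel" "g \<in> measurable M borel"
    and "\<And>z. z \<in> space M \<Longrightarrow> norm (f z) = 1 \<and> norm (g z) = 1"
  shows "(\<lambda>z. angle (f z) (g z)) \<in> borel_measurable M"
proof -
  have "continuous_on UNIV (\<lambda>t::real. arccos (max (-1) (min 1 t)))"
    by (intro continuous_on_arccos continuous_intros) auto
  then have [measurable]: "(\<lambda>t::real. arccos (max (-1) (min 1 t))) \<in> borel_measurable borel"
    by (rule borel_measurable_continuous_onI)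
  have "(\<lambda>z. arccos (max (-1) (min 1 (f z \<bullet> g z)))) \<in> borel_measurable M"
    by measurable
  also have "?this \<longleftrightarrow> ?thesis"
  proof (rule measurable_cong)
    fix z assume "z \<in> space M"
    then show "arccos (max (-1) (min 1 (f z \<bullet> g z))) = angle (f z) (g z)"
      using assms(3)[of z] inner_sphere_bounds[of "f z" "g z"] by (auto simp: angle_def max_def min_def)
  qed
  finally show ?thesis .
qed

lemma cis_eq_1_imp: "cis x = 1 \<Longrightarrow> \<exists>k::int. x = of_int k * (2 * pi)"
  using cos_one_2pi_int[of x] by (auto simp: complex_eq_iff)

definition independent_angles :: "'i set \<Rightarrow> ('i \<Rightarrow> 'a::euclidean_space) \<Rightarrow> 'a \<Rightarrow> bool" where
  "independent_angles I p x \<longleftrightarrow>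
     (\<forall>c :: 'i \<Rightarrow> int. cis (\<Sum>i\<in>I. of_int (c i) * angle x (p i)) = 1 \<longrightarrow> (\<forall>i\<in>I. c i = 0))"

text \<open>
  Add the points one at a time. Given the earlier points and \<open>x\<close>, a relation that involves the new
  point \<open>y\<close> forces \<open>x \<bullet> y\<close> into a countable set, so almost every \<open>y\<close> is good. By Fubini's theorem
  almost every \<open>y\<close> is then good for almost every \<open>x\<close>, and a set of positive measure contains such
  a \<open>y\<close>.
\<close>

lemma exists_independent_points:
  fixes Q :: "nat \<Rightarrow> 'a::euclidean_space set"
  assumes D: "DIM('a) \<ge> 2" and fin: "finite I"
    and Q: "\<And>i. i \<in> I \<Longrightarrow> Q i \<in> sets sphere_measure" "\<And>i. i \<in> I \<Longrightarrow> measure sphere_measure (Q i) > 0"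
  shows "\<exists>p. (\<forall>i\<in>I. p i \<in> Q i) \<and> (AE x in sphere_measure. independent_angles I p x)"
  using fin Q
proof (induction I rule: finite_induct)
  case empty
  show ?case by (simp add: independent_angles_def)
next
  case (insert m I)
  then obtain p where p: "\<forall>i\<in>I. p i \<in> Q i" "AE x in sphere_measure. independent_angles I p x"
    by (metis insertCI)
  have Qs: "Q i \<subseteq> sphere 0 1" if "i \<in> insert m I" for i
    using sets.sets_into_space[OF insert.prems(1)[OF that]] by (simp add: space_sphere_measure)
  have np: "norm (p i) = 1" if "i \<in> I" for i using p(1) Qs[of i] that by auto
  let ?S = "sphere_measure :: 'a measure"
  \<comment> \<open>Extensional coefficient families, so that there are only countably many.\<close>
  define C where "C = {c \<in> insert m I \<rightarrow>\<^sub>E (UNIV :: int set). c m \<noteq> 0}"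
  have "countable (insert m I \<rightarrow>\<^sub>E (UNIV :: int set))"
    using insert.hyps by (intro countable_PiE) auto
  then have C: "countable C" by (rule countable_subset[rotated]) (auto simp: C_def)
  define bad where "bad = (\<lambda>c x y. cis ((\<Sum>i\<in>I. of_int (c i) * angle x (p i)) + of_int (c m) * angle x y) = (1::complex))"
  have bad_null: "AE y in ?S. \<not> bad c x y" if c: "c \<in> C" and x: "x \<in> sphere 0 1" for c x
  proof -
    define v where "v = (\<lambda>k::int. cos ((of_int k * (2 * pi) - (\<Sum>i\<in>I. of_int (c i) * angle x (p i))) / of_int (c m)))"
    have cm: "c m \<noteq> 0" using c by (simp add: C_def)
    have "(\<Union>k. {y \<in> sphere 0 1. x \<bullet> y = v k}) \<in> null_sets ?S"
      using level_set_null[of x] x D by (intro null_sets_UN) auto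
    moreover have "y \<in> (\<Union>k. {y \<in> sphere 0 1. x \<bullet> y = v k})" if y: "y \<in> sphere 0 1" "bad c x y" for y
    proof -
      obtain k :: int where "(\<Sum>i\<in>I. of_int (c i) * angle x (p i)) + of_int (c m) * angle x y = of_int k * (2 * pi)"
        using y cis_eq_1_imp unfolding bad_def by blast
      then have "angle x y = (of_int k * (2 * pi) - (\<Sum>i\<in>I. of_int (c i) * angle x (p i))) / of_int (c m)"
        using cm by (simp add: field_simps)
      then have "x \<bullet> y = v k"
        using cos_angle[of x y] x y by (simp add: v_def)
      then show ?thesis using y by auto
    qed
    ultimately show ?thesis
      by (intro AE_I'[of "\<Union>k. {y \<in> sphere 0 1. x \<bullet> y = v k}"]) (auto simp: space_sphere_measure)
  qed
  interpret P: pair_sigma_finite ?S ?S by unfold_locales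
  have "AE y in ?S. AE x in ?S. \<forall>c\<in>C. \<not> bad c x y"
  proof (subst P.AE_commute[symmetric])
    have m: "{z \<in> space (?S \<Otimes>\<^sub>M ?S). bad c (fst z) (snd z)} \<in> sets (?S \<Otimes>\<^sub>M ?S)" for c
    proof -
      have [measurable]: "(\<lambda>z. angle (fst z) (p i)) \<in> borel_measurable (?S \<Otimes>\<^sub>M ?S)" if "i \<in> I" for i
        using np[OF that] by (intro angle_measurable) (auto simp: space_pair_measure space_sphere_measure)
      have [measurable]: "(\<lambda>z. angle (fst z) (snd z)) \<in> borel_measurable (?S \<Otimes>\<^sub>M ?S)"
        by (intro angle_measurable) (auto simp: space_pair_measure space_sphere_measure)
      show ?thesis unfolding bad_def by measurable
    qed
    have "{z \<in> space (?S \<Otimes>\<^sub>M ?S). \<forall>c\<in>C. \<not> bad c (fst z) (snd z)}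
       = space (?S \<Otimes>\<^sub>M ?S) - (\<Union>c\<in>C. {z \<in> space (?S \<Otimes>\<^sub>M ?S). bad c (fst z) (snd z)})"
      by auto
    also have "\<dots> \<in> sets (?S \<Otimes>\<^sub>M ?S)"
      by (intro sets.Diff sets.top sets.countable_UN'[OF C]) (use m in auto)
    finally show "{z \<in> space (?S \<Otimes>\<^sub>M ?S). \<forall>c\<in>C. \<not> bad c (fst z) (snd z)} \<in> sets (?S \<Otimes>\<^sub>M ?S)" .
    show "AE x in ?S. AE y in ?S. \<forall>c\<in>C. \<not> bad c x y"
    proof (rule AE_I2)
      fix x :: 'a assume "x \<in> space ?S"
      then show "AE y in ?S. \<forall>c\<in>C. \<not> bad c x y"
        using bad_null C by (subst AE_ball_countable) (auto simp: space_sphere_measure)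
    qed
  qed
  moreover have "\<not> (AE y in ?S. y \<notin> Q m)"
  proof
    assume "AE y in ?S. y \<notin> Q m"
    then have "Q m \<in> null_sets ?S" using insert.prems(1)[of m] by (simp add: AE_iff_null_sets)
    then show False using insert.prems(2)[of m] by (simp add: measure_def null_sets_def)
  qed
  ultimately obtain y where y: "y \<in> Q m" "AE x in ?S. \<forall>c\<in>C. \<not> bad c x y"
    by (metis (no_types, lifting) eventually_mono)
  define q where "q = p(m := y)"
  have qI: "q i = p i" if "i \<in> I" for i using that insert.hyps by (auto simp: q_def)
  have qm: "q m = y" by (simp add: q_def)
  have "AE x in ?S. independent_angles (insert m I) q x"
    using p(2) y(2)
  proof eventually_elim
    case (elim x)
    show ?case unfolding independent_angles_def
    proof (intro allI impI)
      fix c :: "nat \<Rightarrow> int"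
      assume "cis (\<Sum>i\<in>insert m I. of_int (c i) * angle x (q i)) = 1"
      then have c: "cis ((\<Sum>i\<in>I. of_int (c i) * angle x (p i)) + of_int (c m) * angle x y) = 1"
        using insert.hyps by (simp add: qI qm add.commute cong: sum.cong)
      have "c m = 0"
      proof (rule ccontr)
        assume "c m \<noteq> 0"
        then have "restrict c (insert m I) \<in> C" by (auto simp: C_def)
        moreover have "bad (restrict c (insert m I)) x y"
          using c by (simp add: bad_def cong: sum.cong)
        ultimately show False using elim(2) by blast
      qed
      moreover have "\<forall>i\<in>I. c i = 0"
        using elim(1) c \<open>c m = 0\<close> by (simp add: independent_angles_def)
      ultimately show "\<forall>i\<in>insert m I. c i = 0" by simp
    qed
  qed
  moreover have "\<forall>i\<in>insert m I. q i \<in> Q i" using p(1) y(1) qI qm by auto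
  ultimately show ?case by blast
qed

lemma sin_ge_half:
  assumes "0 \<le> u" "u \<le> pi / 2"
  shows "u / 2 \<le> sin u"
proof -
  define v where "v = u / 2"
  have v: "0 \<le> v" "v \<le> pi / 4" using assms by (auto simp: v_def)
  have "(\<lambda>v. sin v - v * cos v) 0 \<le> (\<lambda>v. sin v - v * cos v) v"
  proof (rule DERIV_nonneg_imp_nondecreasing[OF v(1)])
    fix t assume "0 \<le> t" "t \<le> v"
    then have "0 \<le> t * sin t" using v by (intro mult_nonneg_nonneg sin_ge_zero) auto
    moreover have "((\<lambda>v. sin v - v * cos v) has_real_derivative t * sin t) (at t)"
      by (auto intro!: derivative_eq_intros)
    ultimately show "\<exists>y. ((\<lambda>v. sin v - v * cos v) has_real_derivative y) (at t) \<and> 0 \<le> y" by blast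
  qed
  then have le: "v * cos v \<le> sin v" by simp
  have c: "cos v \<ge> 0" using v by (intro cos_ge_zero) auto
  have "cos u \<ge> 0" using assms by (intro cos_ge_zero) auto
  then have "1 \<le> 2 * (cos v)\<^sup>2" using cos_double_cos[of v] by (simp add: v_def)
  then have "v * 1 \<le> v * (2 * (cos v)\<^sup>2)" using v by (intro mult_left_mono) auto
  also have "\<dots> = 2 * ((v * cos v) * cos v)" by (simp add: power2_eq_square)
  also have "\<dots> \<le> 2 * (sin v * cos v)" using le c by (intro mult_left_mono mult_right_mono) auto
  also have "\<dots> = sin u" using sin_double[of v] by (simp add: v_def)
  finally show ?thesis by (simp add: v_def)
qed

lemma angle_le_chord:
  assumes x: "norm x = 1" and y: "norm y = 1"
  shows "angle x y \<le> 2 * dist x y"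
proof -
  define u where "u = angle x y / 2"
  have u: "0 \<le> u" "u \<le> pi / 2" using angle_bounds[OF x y] by (auto simp: u_def)
  have "(dist x y)\<^sup>2 = 2 - 2 * (x \<bullet> y)"
    using x y unfolding dist_norm power2_norm_eq_inner norm_eq_1
    by (simp add: inner_diff_left inner_diff_right inner_commute)
  also have "x \<bullet> y = cos (2 * u)" using cos_angle[OF x y] by (simp add: u_def)
  also have "2 - 2 * cos (2 * u) = (2 * sin u)\<^sup>2"
    by (simp add: cos_double_sin power2_eq_square)
  finally have "dist x y = 2 * sin u"
    by (rule power2_eq_imp_eq) (use u in \<open>auto intro!: sin_ge_zero\<close>)
  then show ?thesis using sin_ge_half[OF u] by (simp add: u_def)
qed

text \<open>
  The exponents \<open>l + 1\<close> and \<open>l\<close> add up to \<open>2 * l + 1 = n\<close>: at the critical order the singularity of the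
  amplitude is exactly that of the inverse \<open>n\<close>-th power of the distance.
\<close>

lemma amplitude_ge:
  assumes l: "l > 0" and n: "real n = 2 * l + 1" and \<theta>: "0 < \<theta>" "\<theta> < pi" "\<theta> \<le> 2 * d"
  shows "2 powr (- 3 * l - 1) / d ^ n \<le> \<theta> powr (- l - 1) * (2 * sin \<theta>) powr (- l)"
proof -
  have d: "d > 0" using \<theta> by simp
  have "2 powr (- 3 * l - 1) / d ^ n = (2 * d) powr (- l - 1) * (2 * (2 * d)) powr (- l)"
  proof -
    have "(2 * d) powr (- l - 1) * (2 * (2 * d)) powr (- l) = (2 powr (- l - 1) * 2 powr (- l) * 2 powr (- l)) * (d powr (- l - 1) * d powr (- l))"
      unfolding powr_mult by (simp only: mult_ac)
    also have "2 powr (- l - 1) * 2 powr (- l) * 2 powr (- l) = 2 powr (- l - 1 + - l + - l)"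
      by (simp only: powr_add)
    also have "- l - 1 + - l + - l = - 3 * l - 1" by simp
    also have "d powr (- l - 1) * d powr (- l) = d powr (- l - 1 + - l)"
      by (simp only: powr_add)
    also have "- l - 1 + - l = - real n" by (simp add: n)
    also have "d powr (- real n) = 1 / d ^ n" using d by (simp add: powr_minus powr_realpow divide_inverse)
    finally show ?thesis by simp
  qed
  also have "\<dots> \<le> \<theta> powr (- l - 1) * (2 * sin \<theta>) powr (- l)"
  proof (rule mult_mono[OF powr_mono2' powr_mono2'])
    have "sin \<theta> \<le> \<theta>" using \<theta> by (intro sin_x_le_x) simp
    then show "2 * sin \<theta> \<le> 2 * (2 * d)" using \<theta> by simp
    show "0 < 2 * sin \<theta>" using sin_gt_zero[of \<theta>] \<theta> by simp
  qed (use l \<theta> in auto)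
  finally show ?thesis .
qed

text \<open>
  Summing dyadic indicators bounds the singularity \<open>2 / d ^ n\<close> from below by a function for which
  sums over point masses reduce to measures of caps.
\<close>

lemma dyadic_shells_le:
  fixes d :: real
  assumes d: "d > 0" and n: "n \<ge> 1"
  shows "(\<Sum>j<J. (2 ^ j) ^ n * indicator {..<(1/2) ^ j} d) \<le> 2 / d ^ n"
proof (induction J)
  case 0
  show ?case using d by simp
next
  case (Suc J)
  show ?case
  proof (cases "d < (1/2) ^ J")
    case True
    have geo: "(\<Sum>j<Suc J. (q::real) ^ j) \<le> 2 * q ^ J" if "q \<ge> 2" for q J
    proof (induction J)
      case (Suc J)
      have "2 * q ^ J \<le> q * q ^ J" using that by (intro mult_right_mono) auto
      then show ?case using Suc by simp
    qed simp
    have q: "(2::real) ^ n \<ge> 2" using n self_le_power[of "2::real" n] by simp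
    have "(\<Sum>j<Suc J. (2 ^ j) ^ n * indicator {..<(1/2) ^ j} d) \<le> (\<Sum>j<Suc J. (2 ^ n) ^ j :: real)"
      by (intro sum_mono) (auto simp: indicator_def power_mult[symmetric] mult.commute)
    also have "\<dots> \<le> 2 * (2 ^ n) ^ J" using geo[OF q] .
    also have "(2 ^ n) ^ J = 1 / ((1/2) ^ J :: real) ^ n"
      by (simp add: power_one_over power_mult[symmetric] mult.commute)
    also have "2 * (1 / ((1/2) ^ J) ^ n) \<le> 2 / d ^ n"
      using True d by (simp add: frac_le power_mono)
    finally show ?thesis .
  next
    case False
    then show ?thesis using Suc by simp
  qed
qed

text \<open>
  Give each piece of a fine partition of the sphere a point carrying the measure of the piece.
  For each of the first \<open>J\<close> dyadic radii the mass near \<open>x\<close> is at least the measure of a cap, so the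
  \<open>J\<close> shells each contribute a fixed amount to the sum of the amplitudes, which exceeds any bound
  for large \<open>J\<close>. This is the divergence of the integral of the inverse \<open>n\<close>-th power of the distance.
\<close>

lemma exists_resonating_points:
  fixes M l :: real
  assumes n: "DIM('a::euclidean_space) = n + 1" "n \<ge> 2" and l: "l = (real n - 1) / 2"
  obtains I :: "nat set" and m :: "nat \<Rightarrow> real" and p :: "nat \<Rightarrow> 'a::euclidean_space"
  where "finite I" "\<And>i. i \<in> I \<Longrightarrow> m i \<ge> 0" "(\<Sum>i\<in>I. m i) = 1" "\<And>i. i \<in> I \<Longrightarrow> norm (p i) = 1"
    "AE x in sphere_measure. independent_angles I p x"
    "\<And>x. norm x = 1 \<Longrightarrow> independent_angles I p x \<Longrightarrow>
        (\<forall>i\<in>I. 0 < angle x (p i) \<and> angle x (p i) < pi) \<and>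
        M \<le> (\<Sum>i\<in>I. m i * (angle x (p i) powr (- l - 1) * (2 * sin (angle x (p i))) powr (- l)))"
proof -
  have l0: "l > 0" and nl: "real n = 2 * l + 1" using n(2) by (simp_all add: l field_simps)
  define c where "c = 2 powr (- 3 * l - 1) / 2 * ((1/2) ^ n / (2 * 4 ^ (n + 1)))"
  have c: "c > 0" by (simp add: c_def)
  obtain J :: nat where "M < real J * c"
    using reals_Archimedean3[OF c, rule_format, of M] by blast
  then have J: "M \<le> real J * c" by simp
  \<comment> \<open>The diameter of the pieces is at most half of each radius \<open>(1/2) ^ j\<close> with \<open>j < J\<close>.\<close>
  define \<delta> :: real where "\<delta> = (1/2) ^ (J + 1)"
  have "\<delta> > 0" by (simp add: \<delta>_def)
  then obtain N :: nat and Q :: "nat \<Rightarrow> 'a set" where Q: "\<And>i. Q i \<in> sets sphere_measure"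
    "disjoint_family_on Q {..<N}" "(\<Union>i<N. Q i) = sphere 0 1"
    "\<And>i x y. x \<in> Q i \<Longrightarrow> y \<in> Q i \<Longrightarrow> dist x y < \<delta>"
    by (rule fine_partition) blast
  define m where "m = (\<lambda>i. measure sphere_measure (Q i))"
  define I where "I = {i. i < N \<and> m i > 0}"
  have fI: "finite I" by (simp add: I_def)
  have m0: "m i \<ge> 0" for i by (simp add: m_def)
  have drop: "(\<Sum>i | i < N \<and> P i. m i) = (\<Sum>i\<in>I \<inter> {i. P i}. m i)" for P
  proof (rule sum.mono_neutral_right)
    show "\<forall>i\<in>{i. i < N \<and> P i} - I \<inter> {i. P i}. m i = 0"
      using m0 by (auto simp: I_def order.order_iff_strict)
  qed (auto simp: I_def)
  have part: "(\<Sum>i | i < N \<and> P i. m i) = measure sphere_measure (\<Union>i\<in>{i. i < N \<and> P i}. Q i)" for P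
    unfolding m_def
  proof (rule sphere.finite_measure_finite_Union[symmetric])
    show "disjoint_family_on Q {i. i < N \<and> P i}"
      using Q(2) by (rule disjoint_family_on_mono[rotated]) auto
  qed (use Q(1) in auto)
  have total: "(\<Sum>i\<in>I. m i) = 1"
    using drop[of "\<lambda>_. True"] part[of "\<lambda>_. True"] Q(3) measure_sphere_total[where 'a='a]
    by (simp add: lessThan_def)
  have "DIM('a) \<ge> 2" using n by simp
  then have "\<exists>p. (\<forall>i\<in>I. p i \<in> Q i) \<and> (AE x in sphere_measure. independent_angles I p x)"
    by (rule exists_independent_points[OF _ fI Q(1)]) (simp add: I_def m_def)
  then obtain p where p: "\<forall>i\<in>I. p i \<in> Q i" "AE x in sphere_measure. independent_angles I p x"
    by blast
  have np: "norm (p i) = 1" if "i \<in> I" for i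
  proof -
    have "p i \<in> (\<Union>i<N. Q i)" using p(1) that by (auto simp: I_def)
    then show ?thesis unfolding Q(3) by simp
  qed
  have near: "((1/2) ^ (j + 1)) ^ n / (2 * 4 ^ (n + 1)) \<le> (\<Sum>i\<in>I. m i * indicator {..<(1/2) ^ j} (dist x (p i)))"
    if x: "norm x = 1" and j: "j < J" for x j
  proof -
    define r :: real where "r = (1/2) ^ (j + 1)"
    have r: "\<delta> \<le> r" "(1/2) ^ j = 2 * r" using j by (auto simp: \<delta>_def r_def intro!: power_decreasing)
    let ?P = "\<lambda>i. Q i \<inter> cap x r \<noteq> {}"
    have "r ^ n / (2 * 4 ^ (n + 1)) \<le> measure sphere_measure (cap x r)"
      unfolding r_def by (rule cap_measure_ge[OF x n(1)])
    also have "\<dots> \<le> measure sphere_measure (\<Union>i\<in>{i. i < N \<and> ?P i}. Q i)"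
    proof (intro sphere.finite_measure_mono sets.finite_UN Q(1) subsetI)
      fix y assume y: "y \<in> cap x r"
      then have "y \<in> (\<Union>i<N. Q i)" unfolding Q(3) by (simp add: cap_def)
      then show "y \<in> (\<Union>i\<in>{i. i < N \<and> ?P i}. Q i)" using y by auto
    qed simp
    also have "\<dots> = (\<Sum>i\<in>I \<inter> {i. ?P i}. m i)" using part[of ?P] drop[of ?P] by simp
    also have "\<dots> \<le> (\<Sum>i\<in>I \<inter> {i. ?P i}. m i * indicator {..<(1/2) ^ j} (dist x (p i)))"
    proof (rule sum_mono)
      fix i assume i: "i \<in> I \<inter> {i. ?P i}"
      then obtain y where y: "y \<in> Q i" "dist x y < r" by (auto simp: cap_def)
      have "dist y (p i) < \<delta>" using Q(4)[OF y(1)] p(1) i by auto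
      then have "dist x (p i) < 2 * r" using y r dist_triangle[of x "p i" y] by linarith
      then show "m i \<le> m i * indicator {..<(1/2) ^ j} (dist x (p i))" unfolding r(2) by simp
    qed
    also have "\<dots> \<le> (\<Sum>i\<in>I. m i * indicator {..<(1/2) ^ j} (dist x (p i)))"
      using fI m0 by (intro sum_mono2) auto
    finally show ?thesis by (simp add: r_def)
  qed
  show thesis
  proof (rule that[OF fI m0 total np p(2)])
    fix x :: 'a assume x: "norm x = 1" and ind: "independent_angles I p x"
    have ang: "0 < angle x (p i) \<and> angle x (p i) < pi" if i: "i \<in> I" for i
    proof -
      have "cis (of_int k * angle x (p i)) \<noteq> 1" if "k \<noteq> 0" for k
      proof
        assume *: "cis (of_int k * angle x (p i)) = 1"
        have "(\<Sum>i'\<in>I. of_int (if i' = i then k else 0) * angle x (p i')) = of_int k * angle x (p i)"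
          using fI i by (simp add: if_distrib if_distribR cong: if_cong)
        then have "cis (\<Sum>i'\<in>I. of_int (if i' = i then k else 0) * angle x (p i')) = 1"
          using * by simp
        then have "\<forall>i'\<in>I. (if i' = i then k else 0) = 0"
          using ind[unfolded independent_angles_def, THEN spec[of _ "\<lambda>i'. if i' = i then k else 0"]] by blast
        then show False using that i by auto
      qed
      from this[of 1] this[of 2] have "angle x (p i) \<noteq> 0" "angle x (p i) \<noteq> pi"
        by (auto simp: complex_eq_iff)
      then show ?thesis using angle_bounds[OF x np[OF i]] by linarith
    qed
    have "M \<le> real J * c" by (rule J)
    also have "\<dots> = (\<Sum>j<J. 2 powr (- 3 * l - 1) / 2 * ((2 ^ j) ^ n * (((1/2) ^ (j + 1)) ^ n / (2 * 4 ^ (n + 1)))))"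
    proof -
      have "2 powr (- 3 * l - 1) / 2 * ((2 ^ j) ^ n * (((1/2) ^ (j + 1)) ^ n / (2 * 4 ^ (n + 1)))) = c" for j
      proof -
        have "2 ^ j * (1/2) ^ (j + 1) = (1/2 :: real)" by (simp add: power_one_over)
        then have "(2 ^ j) ^ n * ((1/2) ^ (j + 1)) ^ n = (1/2 :: real) ^ n"
          by (metis power_mult_distrib)
        then have "(2 ^ j) ^ n * (((1/2) ^ (j + 1)) ^ n / (2 * 4 ^ (n + 1))) = (1/2 :: real) ^ n / (2 * 4 ^ (n + 1))"
          by (simp only: times_divide_eq_right)
        then show ?thesis by (simp only: c_def)
      qed
      then show ?thesis by simp
    qed
    also have "\<dots> \<le> (\<Sum>j<J. 2 powr (- 3 * l - 1) / 2 * ((2 ^ j) ^ n * (\<Sum>i\<in>I. m i * indicator {..<(1/2) ^ j} (dist x (p i)))))"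
      using near[OF x] by (intro sum_mono mult_left_mono) auto
    also have "\<dots> = (\<Sum>i\<in>I. m i * (2 powr (- 3 * l - 1) / 2 * (\<Sum>j<J. (2 ^ j) ^ n * indicator {..<(1/2) ^ j} (dist x (p i)))))"
      unfolding sum_distrib_left by (subst sum.swap) (simp add: mult_ac)
    also have "\<dots> \<le> (\<Sum>i\<in>I. m i * (angle x (p i) powr (- l - 1) * (2 * sin (angle x (p i))) powr (- l)))"
    proof (intro sum_mono mult_left_mono m0)
      fix i assume i: "i \<in> I"
      have le: "angle x (p i) \<le> 2 * dist x (p i)" by (rule angle_le_chord[OF x np[OF i]])
      then have d: "dist x (p i) > 0" using ang[OF i] by linarith
      have "2 powr (- 3 * l - 1) / 2 * (\<Sum>j<J. (2 ^ j) ^ n * indicator {..<(1/2) ^ j} (dist x (p i)))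
         \<le> 2 powr (- 3 * l - 1) / 2 * (2 / dist x (p i) ^ n)"
        using dyadic_shells_le[OF d, of n J] n by (intro mult_left_mono) auto
      also have "\<dots> = 2 powr (- 3 * l - 1) / dist x (p i) ^ n" by simp
      also have "\<dots> \<le> angle x (p i) powr (- l - 1) * (2 * sin (angle x (p i))) powr (- l)"
        using ang[OF i] le by (intro amplitude_ge l0 nl) auto
      finally show "2 powr (- 3 * l - 1) / 2 * (\<Sum>j<J. (2 ^ j) ^ n * indicator {..<(1/2) ^ j} (dist x (p i)))
        \<le> angle x (p i) powr (- l - 1) * (2 * sin (angle x (p i))) powr (- l)" .
    qed
    finally show "(\<forall>i\<in>I. 0 < angle x (p i) \<and> angle x (p i) < pi) \<and>
        M \<le> (\<Sum>i\<in>I. m i * (angle x (p i) powr (- l - 1) * (2 * sin (angle x (p i))) powr (- l)))"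
      using ang by blast
  qed
qed


section \<open>Condensation of singularities\<close>

text \<open>
  The sum of the moduli has a finite integral, hence is finite almost everywhere and dominates all
  partial sums and tails.
\<close>

lemma L1_series:
  fixes h :: "nat \<Rightarrow> 'a \<Rightarrow> real"
  assumes h: "\<And>j. integrable M (h j)" and s: "summable (\<lambda>j. \<integral>x. \<bar>h j x\<bar> \<partial>M)"
  shows "integrable M (\<lambda>x. \<Sum>j. h j x)"
    and "(\<integral>x. \<bar>(\<Sum>j. h j x) - (\<Sum>j<n. h j x)\<bar> \<partial>M) \<le> (\<Sum>j. \<integral>x. \<bar>h (j + n) x\<bar> \<partial>M)"
proof -
  have [measurable]: "h j \<in> borel_measurable M" for j using h by simp
  have "(\<integral>\<^sup>+x. (\<Sum>j. ennreal \<bar>h j x\<bar>) \<partial>M) = (\<Sum>j. \<integral>\<^sup>+x. ennreal \<bar>h j x\<bar> \<partial>M)"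
    by (rule nn_integral_suminf) simp
  also have "\<dots> = (\<Sum>j. ennreal (\<integral>x. \<bar>h j x\<bar> \<partial>M))"
    using h by (subst nn_integral_eq_integral) auto
  also have "\<dots> \<noteq> \<infinity>"
    using s by (simp add: ennreal_suminf_neq_top)
  finally have "AE x in M. (\<Sum>j. ennreal \<bar>h j x\<bar>) \<noteq> \<infinity>"
    by (intro nn_integral_PInf_AE) auto
  then have ae: "AE x in M. summable (\<lambda>j. \<bar>h j x\<bar>)"
    by eventually_elim (auto intro!: summable_suminf_not_top)
  show i: "integrable M (\<lambda>x. \<Sum>j. h j x)"
    using integrable_suminf[of M h] h ae s by simp
  have sn: "summable (\<lambda>j. \<integral>x. \<bar>h (j + n) x\<bar> \<partial>M)"
    using s by (subst summable_iff_shift)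
  have aen: "AE x in M. summable (\<lambda>j. norm \<bar>h (j + n) x\<bar>)"
    using ae by eventually_elim (simp add: summable_iff_shift[of "\<lambda>j. \<bar>h j _\<bar>" n])
  have "(\<integral>x. \<bar>(\<Sum>j. h j x) - (\<Sum>j<n. h j x)\<bar> \<partial>M) \<le> (\<integral>x. (\<Sum>j. \<bar>h (j + n) x\<bar>) \<partial>M)"
  proof (rule integral_mono_AE)
    show "integrable M (\<lambda>x. \<bar>(\<Sum>j. h j x) - (\<Sum>j<n. h j x)\<bar>)"
      using i h by (intro integrable_abs Bochner_Integration.integrable_diff Bochner_Integration.integrable_sum)
    show "integrable M (\<lambda>x. \<Sum>j. \<bar>h (j + n) x\<bar>)"
      using integrable_suminf[of M "\<lambda>j x. \<bar>h (j + n) x\<bar>"] h aen sn by simp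
    show "AE x in M. \<bar>(\<Sum>j. h j x) - (\<Sum>j<n. h j x)\<bar> \<le> (\<Sum>j. \<bar>h (j + n) x\<bar>)"
      using ae
    proof eventually_elim
      case (elim x)
      have "(\<Sum>j. h j x) - (\<Sum>j<n. h j x) = (\<Sum>j. h (j + n) x)"
        using suminf_split_initial_segment[of "\<lambda>j. h j x" n] summable_rabs_cancel[OF elim] by simp
      moreover have "\<bar>\<Sum>j. h (j + n) x\<bar> \<le> (\<Sum>j. \<bar>h (j + n) x\<bar>)"
        using elim by (intro summable_rabs) (simp add: summable_iff_shift[of "\<lambda>j. \<bar>h j x\<bar>" n])
      ultimately show ?case by simp
    qed
  qed
  also have "\<dots> = (\<Sum>j. \<integral>x. \<bar>h (j + n) x\<bar> \<partial>M)"
    using integral_suminf[of M "\<lambda>j x. \<bar>h (j + n) x\<bar>"] h aen sn by simp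
  finally show "(\<integral>x. \<bar>(\<Sum>j. h j x) - (\<Sum>j<n. h j x)\<bar> \<partial>M) \<le> (\<Sum>j. \<integral>x. \<bar>h (j + n) x\<bar> \<partial>M)" .
qed

text \<open>
  The properties of the Riesz means that the gliding hump uses; \<open>C r\<close> bounds the norms of the
  functionals \<open>f \<mapsto> T R f x\<close> for all \<open>R < r\<close> and all points \<open>x\<close>.
\<close>

locale L1_means = finite_measure M for M :: "'a measure" +
  fixes T :: "real \<Rightarrow> ('a \<Rightarrow> real) \<Rightarrow> 'a \<Rightarrow> real" and C :: "real \<Rightarrow> real"
  assumes linear: "integrable M f \<Longrightarrow> integrable M g \<Longrightarrow> x \<in> space M \<Longrightarrow>
      T R (\<lambda>x. f x + c * g x) x = T R f x + c * T R g x"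
    and bound: "integrable M f \<Longrightarrow> x \<in> space M \<Longrightarrow> 0 < R \<Longrightarrow> R < r \<Longrightarrow> \<bar>T R f x\<bar> \<le> C r * (\<integral>x. \<bar>f x\<bar> \<partial>M)"
    and C_mono: "mono C" and C_nonneg: "C r \<ge> 0"
    and quiet_sets: "integrable M f \<Longrightarrow> {x \<in> space M. \<forall>R. 0 < R \<and> R < r \<longrightarrow> \<bar>T R f x\<bar> \<le> a} \<in> sets M"
begin

definition quiet :: "('a \<Rightarrow> real) \<Rightarrow> real \<Rightarrow> real \<Rightarrow> 'a set" where
  "quiet f r a = {x \<in> space M. \<forall>R. 0 < R \<and> R < r \<longrightarrow> \<bar>T R f x\<bar> \<le> a}"

lemma quiet_measurable: "integrable M f \<Longrightarrow> quiet f r a \<in> sets M"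
  unfolding quiet_def by (rule quiet_sets)

lemma quiet_antimono: "r \<le> r' \<Longrightarrow> quiet f r' a \<subseteq> quiet f r a"
  by (auto simp: quiet_def)

text \<open>
  Try the perturbations \<open>t * f\<close> for \<open>K\<close> equally spaced coefficients \<open>t\<close>, where \<open>f\<close> has a high peak.
  If at a point \<open>x\<close> the means of \<open>g + t * f\<close> stay small for two of them, then by linearity so do the
  means of \<open>f\<close> at \<open>x\<close>. So outside the small set where \<open>f\<close> has no peak the \<open>K\<close> bad sets are disjoint,
  and one of them has measure at most a \<open>K\<close>-th part of the total. This works for every \<open>g\<close>, however
  its own means behave.
\<close>

lemma small_perturbation:
  assumes peaks: "\<And>a \<epsilon>. \<epsilon> > 0 \<Longrightarrow> \<exists>f r. integrable M f \<and> (\<integral>x. \<bar>f x\<bar> \<partial>M) \<le> 1 \<and> measure M (quiet f r a) \<le> \<epsilon>"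
    and g: "integrable M g" and \<eta>: "\<eta> > 0" and \<epsilon>: "\<epsilon> > 0"
  shows "\<exists>h r. integrable M h \<and> (\<integral>x. \<bar>h x\<bar> \<partial>M) \<le> \<eta> \<and> measure M (quiet (\<lambda>x. g x + h x) r a) \<le> \<epsilon>"
proof -
  \<comment> \<open>With \<open>K\<close> coefficients, disjoint bad sets cannot all have measure above \<open>\<epsilon> / 2\<close>.\<close>
  obtain K :: nat where "measure M (space M) / (\<epsilon> / 2) < real K"
    using reals_Archimedean2 by blast
  then have K: "measure M (space M) < real K * (\<epsilon> / 2)" using \<epsilon> by (simp add: divide_less_eq)
  then have K0: "K > 0" by (cases K) (auto simp: not_less[symmetric])
  obtain f r where f: "integrable M f" "(\<integral>x. \<bar>f x\<bar> \<partial>M) \<le> 1" "measure M (quiet f r (2 * a * real K / \<eta>)) \<le> \<epsilon> / 2"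
    using peaks[of "\<epsilon> / 2" "2 * a * real K / \<eta>"] \<epsilon> by auto
  define B where "B = quiet f r (2 * a * real K / \<eta>)"
  define t where "t = (\<lambda>i::nat. \<eta> * real i / real K)"
  define E where "E = (\<lambda>i. quiet (\<lambda>x. g x + t i * f x) r a - B)"
  have gf: "integrable M (\<lambda>x. g x + t i * f x)" for i using g f(1) by simp
  have E: "E i \<in> sets M" for i
    unfolding E_def B_def using quiet_measurable f(1) gf by auto
  have disj: "disjoint_family_on E {..<K}"
    unfolding disjoint_family_on_def
  proof (intro ballI impI equals0I)
    fix i j :: nat and x
    assume ij: "i \<noteq> j" and x: "x \<in> E i \<inter> E j"
    have xM: "x \<in> space M" using x by (auto simp: E_def quiet_def)
    have "\<bar>T R f x\<bar> \<le> 2 * a * real K / \<eta>" if R: "0 < R" "R < r" for R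
    proof -
      have "\<bar>T R g x + t i * T R f x\<bar> \<le> a" "\<bar>T R g x + t j * T R f x\<bar> \<le> a"
        using x R linear[OF g f(1) xM] by (auto simp: E_def quiet_def)
      then have "\<bar>t i * T R f x - t j * T R f x\<bar> \<le> 2 * a" by linarith
      then have le: "\<bar>t i - t j\<bar> * \<bar>T R f x\<bar> \<le> 2 * a"
        by (simp add: left_diff_distrib[symmetric] abs_mult)
      have "1 \<le> \<bar>real i - real j\<bar>" using ij by linarith
      then have "\<eta> / real K * 1 \<le> \<eta> / real K * \<bar>real i - real j\<bar>"
        using \<eta> K0 by (intro mult_left_mono) auto
      also have "\<dots> = \<bar>t i - t j\<bar>"
        using \<eta> K0 by (simp add: t_def abs_mult right_diff_distrib[symmetric] diff_divide_distrib[symmetric])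
      finally have "\<eta> / real K * \<bar>T R f x\<bar> \<le> \<bar>t i - t j\<bar> * \<bar>T R f x\<bar>"
        by (intro mult_right_mono) auto
      with le have "\<eta> / real K * \<bar>T R f x\<bar> \<le> 2 * a" by linarith
      then show ?thesis using \<eta> K0 by (simp add: field_simps)
    qed
    then have "x \<in> B" using xM by (simp add: B_def quiet_def)
    then show False using x by (simp add: E_def)
  qed
  have "\<exists>i<K. measure M (E i) \<le> \<epsilon> / 2"
  proof (rule ccontr)
    assume "\<not> ?thesis"
    then have "real K * (\<epsilon> / 2) \<le> (\<Sum>i<K. measure M (E i))"
      using sum_bounded_below[of "{..<K}" "\<epsilon> / 2" "\<lambda>i. measure M (E i)"] by force
    also have "\<dots> = measure M (\<Union>i<K. E i)"
      using disj E by (intro finite_measure_finite_Union[symmetric]) auto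
    also have "\<dots> \<le> measure M (space M)" by (rule bounded_measure)
    finally show False using K by simp
  qed
  then obtain i where i: "i < K" "measure M (E i) \<le> \<epsilon> / 2" by blast
  have ti: "0 \<le> t i" "t i \<le> \<eta>" using i(1) \<eta> by (auto simp: t_def field_simps)
  have "quiet (\<lambda>x. g x + t i * f x) r a \<subseteq> E i \<union> B" by (auto simp: E_def)
  then have "measure M (quiet (\<lambda>x. g x + t i * f x) r a) \<le> measure M (E i \<union> B)"
    using E quiet_measurable[OF f(1)] by (intro finite_measure_mono) (auto simp: B_def)
  also have "\<dots> \<le> measure M (E i) + measure M B"
    using E quiet_measurable[OF f(1)] by (intro measure_Un_le) (auto simp: B_def)
  also have "\<dots> \<le> \<epsilon>" using i(2) f(3) by (simp add: B_def)
  finally have q: "measure M (quiet (\<lambda>x. g x + t i * f x) r a) \<le> \<epsilon>" .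
  have "(\<integral>x. \<bar>t i * f x\<bar> \<partial>M) = t i * (\<integral>x. \<bar>f x\<bar> \<partial>M)" using ti by (simp add: abs_mult)
  also have "\<dots> \<le> \<eta>" using ti f(2) mult_left_le[of "\<integral>x. \<bar>f x\<bar> \<partial>M" "t i"] by linarith
  finally show ?thesis using q f(1) by (intro exI[of _ "\<lambda>x. t i * f x"] exI[of _ r]) auto
qed

text \<open>
  The functions \<open>g n\<close> are built with a range \<open>r n\<close> of \<open>R\<close> such that the means of \<open>g (n + 1)\<close> exceed \<open>n\<close>
  somewhere in the range \<open>r (n + 1)\<close>, outside a set of measure \<open>(1/2) ^ n\<close>. All later changes
  are so small that together they alter the means in this range by at most \<open>2\<close>. The claim then follows
  from the Borel-Cantelli lemma.
\<close>

theorem divergence_almost_everywhere: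
  assumes peaks: "\<And>a \<epsilon>. \<epsilon> > 0 \<Longrightarrow> \<exists>f r. integrable M f \<and> (\<integral>x. \<bar>f x\<bar> \<partial>M) \<le> 1 \<and> measure M (quiet f r a) \<le> \<epsilon>"
  shows "\<exists>f. integrable M f \<and> (AE x in M. \<forall>a. \<exists>R>0. a < \<bar>T R f x\<bar>)"
proof -
  \<comment> \<open>The divisor \<open>C (snd s) + 1\<close> makes the change of the means in the range reached so far at most \<open>(1/2) ^ n\<close>.\<close>
  define step where "step = (\<lambda>(n::nat) (s :: ('a \<Rightarrow> real) \<times> real) s'. snd s \<le> snd s'
     \<and> (\<integral>x. \<bar>fst s' x - fst s x\<bar> \<partial>M) \<le> (1/2) ^ n / (C (snd s) + 1)
     \<and> measure M (quiet (fst s') (snd s') (real n)) \<le> (1/2) ^ n)"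
  define ok where "ok = (\<lambda>(n::nat) (s :: ('a \<Rightarrow> real) \<times> real). integrable M (fst s) \<and> (n = 0 \<longrightarrow> fst s = (\<lambda>_. 0)))"
  have "\<exists>s. \<forall>n. ok n (s n) \<and> step n (s n) (s (Suc n))"
  proof (rule dependent_nat_choice)
    show "\<exists>s. ok 0 s" by (rule exI[of _ "(\<lambda>_. 0, 0)"]) (simp add: ok_def)
    fix s n assume "ok n s"
    then have g: "integrable M (fst s)" by (simp add: ok_def)
    have C1: "C (snd s) + 1 > 0" using C_nonneg[of "snd s"] by linarith
    obtain h r where h: "integrable M h" "(\<integral>x. \<bar>h x\<bar> \<partial>M) \<le> (1/2) ^ n / (C (snd s) + 1)"
      "measure M (quiet (\<lambda>x. fst s x + h x) r (real n)) \<le> (1/2) ^ n"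
      using small_perturbation[OF peaks g, of "(1/2) ^ n / (C (snd s) + 1)" "(1/2) ^ n" "real n"] C1 by auto
    have gh: "integrable M (\<lambda>x. fst s x + h x)" using g h(1) by simp
    have "measure M (quiet (\<lambda>x. fst s x + h x) (max r (snd s)) (real n)) \<le> measure M (quiet (\<lambda>x. fst s x + h x) r (real n))"
      by (intro finite_measure_mono quiet_antimono quiet_measurable gh) simp
    then show "\<exists>s'. ok (Suc n) s' \<and> step n s s'"
      using h gh by (intro exI[of _ "(\<lambda>x. fst s x + h x, max r (snd s))"]) (auto simp: ok_def step_def)
  qed
  then obtain s where s: "\<And>n. ok n (s n)" "\<And>n. step n (s n) (s (Suc n))" by blast
  define g where "g = (\<lambda>n. fst (s n))"
  define r where "r = (\<lambda>n. snd (s n))"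
  define h where "h = (\<lambda>n x. g (Suc n) x - g n x)"
  have gi: "integrable M (g n)" for n using s(1)[of n] by (simp add: ok_def g_def)
  have g0: "g 0 = (\<lambda>_. 0)" using s(1)[of 0] by (simp add: ok_def g_def)
  have "r n \<le> r (Suc n)" for n using s(2)[of n] by (simp add: step_def r_def)
  then have rmono: "r m \<le> r n" if "m \<le> n" for m n
    using that by (rule lift_Suc_mono_le)
  have hn: "(\<integral>x. \<bar>h n x\<bar> \<partial>M) \<le> (1/2) ^ n / (C (r n) + 1)" for n
    using s(2)[of n] by (simp add: step_def h_def g_def r_def)
  have small: "measure M (quiet (g (Suc n)) (r (Suc n)) (real n)) \<le> (1/2) ^ n" for n
    using s(2)[of n] by (simp add: step_def g_def r_def)
  have hi: "integrable M (h n)" for n unfolding h_def using gi by (intro Bochner_Integration.integrable_diff)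
  have gsum: "g n x = (\<Sum>j<n. h j x)" for n x
    using g0 by (simp add: h_def sum_lessThan_telescope[of "\<lambda>n. g n x"])
  have geo: "summable (\<lambda>n. (1/2 :: real) ^ n)" by (rule summable_geometric) simp
  have hgeo: "(\<integral>x. \<bar>h n x\<bar> \<partial>M) \<le> (1/2) ^ n" for n
  proof -
    have "(1/2 :: real) ^ n / (C (r n) + 1) \<le> (1/2) ^ n / 1"
      using C_nonneg[of "r n"] by (intro divide_left_mono) auto
    then show ?thesis using hn[of n] by simp
  qed
  have sm: "summable (\<lambda>n. \<integral>x. \<bar>h n x\<bar> \<partial>M)"
    by (rule summable_comparison_test'[OF geo]) (use hgeo in auto)
  define f where "f = (\<lambda>x. \<Sum>j. h j x)"
  have fi: "integrable M f" unfolding f_def by (rule L1_series(1)[OF hi sm])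
  have tail: "C (r n) * (\<integral>x. \<bar>f x - g n x\<bar> \<partial>M) \<le> 2" for n
  proof -
    have smn: "summable (\<lambda>j. \<integral>x. \<bar>h (j + n) x\<bar> \<partial>M)" using sm by (subst summable_iff_shift)
    have geon: "summable (\<lambda>j. (1/2 :: real) ^ j)" by (rule geo)
    have "(\<integral>x. \<bar>f x - g n x\<bar> \<partial>M) \<le> (\<Sum>j. \<integral>x. \<bar>h (j + n) x\<bar> \<partial>M)"
      unfolding f_def gsum by (rule L1_series(2)[OF hi sm])
    then have "C (r n) * (\<integral>x. \<bar>f x - g n x\<bar> \<partial>M) \<le> C (r n) * (\<Sum>j. \<integral>x. \<bar>h (j + n) x\<bar> \<partial>M)"
      using C_nonneg by (rule mult_left_mono)
    also have "\<dots> = (\<Sum>j. C (r n) * (\<integral>x. \<bar>h (j + n) x\<bar> \<partial>M))"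
      by (rule suminf_mult[OF smn, symmetric])
    also have "\<dots> \<le> (\<Sum>j. (1/2) ^ j)"
    proof (rule suminf_le[OF _ summable_mult[OF smn] geon])
      fix j
      have C: "0 \<le> C (r n)" "C (r n) \<le> C (r (j + n))"
        using C_nonneg monoD[OF C_mono rmono[of n "j + n"]] by auto
      have "C (r n) * (\<integral>x. \<bar>h (j + n) x\<bar> \<partial>M) \<le> C (r (j + n)) * ((1/2) ^ (j + n) / (C (r (j + n)) + 1))"
        using C hn[of "j + n"] by (intro mult_mono) auto
      also have "\<dots> = (C (r (j + n)) / (C (r (j + n)) + 1)) * (1/2) ^ (j + n)" by simp
      also have "\<dots> \<le> 1 * (1/2) ^ (j + n)" using C by (intro mult_right_mono) auto
      also have "\<dots> \<le> (1/2) ^ j" by (simp add: power_add mult_left_le power_le_one)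
      finally show "C (r n) * (\<integral>x. \<bar>h (j + n) x\<bar> \<partial>M) \<le> (1/2) ^ j" .
    qed
    also have "\<dots> = 2" using suminf_geometric[of "1/2 :: real"] by simp
    finally show ?thesis .
  qed
  have "AE x in M. eventually (\<lambda>n. x \<in> space M - quiet (g (Suc n)) (r (Suc n)) (real n)) sequentially"
  proof (rule borel_cantelli_AE1)
    show "summable (\<lambda>n. measure M (quiet (g (Suc n)) (r (Suc n)) (real n)))"
      by (rule summable_comparison_test'[OF geo]) (use small in auto)
  qed (auto intro: quiet_measurable gi simp: emeasure_eq_measure)
  then have "AE x in M. \<forall>a. \<exists>R>0. a < \<bar>T R f x\<bar>"
  proof (eventually_elim, intro allI)
    fix x a
    assume "\<forall>\<^sub>F n in sequentially. x \<in> space M - quiet (g (Suc n)) (r (Suc n)) (real n)"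
    moreover have "\<forall>\<^sub>F n in sequentially. a + 2 \<le> real n"
      by (rule eventually_sequentiallyI[of "nat \<lceil>a + 2\<rceil>"]) linarith
    ultimately have "\<forall>\<^sub>F n in sequentially. x \<in> space M - quiet (g (Suc n)) (r (Suc n)) (real n) \<and> a + 2 \<le> real n"
      by (rule eventually_conj)
    then obtain n where n: "x \<in> space M" "x \<notin> quiet (g (Suc n)) (r (Suc n)) (real n)" "a + 2 \<le> real n"
      using eventually_happens by fastforce
    then obtain R where R: "0 < R" "R < r (Suc n)" "real n < \<bar>T R (g (Suc n)) x\<bar>"
      by (auto simp: quiet_def not_le)
    have "T R f x = T R (\<lambda>x. g (Suc n) x + 1 * (f x - g (Suc n) x)) x" by simp
    also have "\<dots> = T R (g (Suc n)) x + 1 * T R (\<lambda>x. f x - g (Suc n) x) x"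
      using gi fi n(1) by (intro linear) auto
    finally have split: "T R f x = T R (g (Suc n)) x + T R (\<lambda>x. f x - g (Suc n) x) x" by simp
    have "\<bar>T R (\<lambda>x. f x - g (Suc n) x) x\<bar> \<le> C (r (Suc n)) * (\<integral>x. \<bar>f x - g (Suc n) x\<bar> \<partial>M)"
      using gi fi n(1) R by (intro bound) auto
    also have "\<dots> \<le> 2" by (rule tail)
    finally have "a < \<bar>T R f x\<bar>" using split R(3) n(3) by linarith
    then show "\<exists>R>0. a < \<bar>T R f x\<bar>" using R(1) by blast
  qed
  then show ?thesis using fi by blast
qed

end


section \<open>Divergence of the critical Riesz means\<close>

lemma continuous_gegenbauer: "continuous_on S (gegenbauer k l)"
proof (induction k rule: induct_nat_012)
  case 0
  show ?case by (simp add: gegenbauer_0[abs_def])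
next
  case 1
  have "gegenbauer 1 l = (\<lambda>t. 2 * l * t)" by (rule ext) (rule gegenbauer_1)
  then show ?case by (auto intro!: continuous_intros)
next
  case (ge2 k)
  have "gegenbauer (k + 2) l = (\<lambda>t. (2 * (real k + 1 + l) * t * gegenbauer (k + 1) l t - (real k + 2 * l) * gegenbauer k l t) / real (k + 2))"
    by (rule ext) (simp only: gegenbauer_rec[symmetric], simp)
  then show ?case using ge2 by (auto intro!: continuous_intros)
qed

lemma continuous_zonal_poly: "continuous_on S (zonal_poly l k)"
  unfolding zonal_poly_def[abs_def] by (intro continuous_intros continuous_gegenbauer)

lemma zonal_kernel_eq: "zonal_kernel k (x::'a::euclidean_space) y = zonal_poly ((real DIM('a) - 2) / 2) k (x \<bullet> y)"
  by (simp add: zonal_kernel_def zonal_poly_def Let_def)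

lemma zonal_coeff_angle:
  "norm (x::'a::euclidean_space) = 1 \<Longrightarrow> norm y = 1 \<Longrightarrow> zonal_coeff ((real DIM('a) - 2) / 2) (angle x y) k = zonal_kernel k x y"
  by (simp add: zonal_coeff_def zonal_kernel_eq cos_angle)

definition zonal_bound :: "real \<Rightarrow> nat \<Rightarrow> real" where
  "zonal_bound l k = (SUP t\<in>{-1..1}. \<bar>zonal_poly l k t\<bar>)"

lemma zonal_bound: "t \<in> {-1..1} \<Longrightarrow> \<bar>zonal_poly l k t\<bar> \<le> zonal_bound l k"
  unfolding zonal_bound_def
proof (rule cSUP_upper)
  have "compact ((\<lambda>t. \<bar>zonal_poly l k t\<bar>) ` {-1..1})"
    by (intro compact_continuous_image continuous_intros continuous_zonal_poly) simp
  then show "bdd_above ((\<lambda>t. \<bar>zonal_poly l k t\<bar>) ` {-1..1})"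
    by (intro bounded_imp_bdd_above compact_imp_bounded)
qed

lemma zonal_bound_nonneg: "zonal_bound l k \<ge> 0"
  using zonal_bound[of 0 l k] abs_ge_zero[of "zonal_poly l k 0"] by simp

lemma zonal_kernel_measurable [measurable]: "zonal_kernel k (x::'a::euclidean_space) \<in> borel_measurable sphere_measure"
proof -
  have "continuous_on UNIV (zonal_kernel k x)"
    unfolding zonal_kernel_eq[abs_def]
    by (intro continuous_on_compose2[OF continuous_zonal_poly] continuous_intros) auto
  then have [measurable]: "zonal_kernel k x \<in> borel_measurable borel" by (rule borel_measurable_continuous_onI)
  have "(\<lambda>y. zonal_kernel k x y) \<in> borel_measurable sphere_measure" by measurable
  then show ?thesis by simp
qed

lemma zonal_kernel_bounded:
  assumes "norm x = 1" "norm y = 1"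
  shows "\<bar>zonal_kernel k (x::'a::euclidean_space) y\<bar> \<le> zonal_bound ((real DIM('a) - 2) / 2) k"
  unfolding zonal_kernel_eq by (rule zonal_bound) (rule inner_sphere_bounds[OF assms])

lemma integrable_zonal_kernel:
  fixes x :: "'a::euclidean_space"
  assumes f: "integrable sphere_measure f" and x: "norm x = 1"
  shows "integrable sphere_measure (\<lambda>y. zonal_kernel k x y * f y)"
proof (rule Bochner_Integration.integrable_bound)
  show "integrable sphere_measure (\<lambda>y. zonal_bound ((real DIM('a) - 2) / 2) k * f y)" using f by simp
  have [measurable]: "f \<in> borel_measurable sphere_measure" using f by simp
  show "(\<lambda>y. zonal_kernel k x y * f y) \<in> borel_measurable sphere_measure" by measurable
  show "AE y in sphere_measure. norm (zonal_kernel k x y * f y) \<le> norm (zonal_bound ((real DIM('a) - 2) / 2) k * f y)"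
    using zonal_kernel_bounded[OF x] zonal_bound_nonneg
    by (intro AE_I2) (auto simp: abs_mult space_sphere_measure intro!: mult_right_mono)
qed

lemma sphere_proj_bound:
  fixes x :: "'a::euclidean_space"
  assumes f: "integrable sphere_measure f" and x: "norm x = 1"
  shows "\<bar>sphere_proj k f x\<bar> \<le> zonal_bound ((real DIM('a) - 2) / 2) k * (\<integral>y. \<bar>f y\<bar> \<partial>sphere_measure)"
proof -
  have "\<bar>sphere_proj k f x\<bar> \<le> (\<integral>y. \<bar>zonal_kernel k x y * f y\<bar> \<partial>sphere_measure)"
    unfolding sphere_proj_def by (rule integral_abs_bound)
  also have "\<dots> \<le> (\<integral>y. zonal_bound ((real DIM('a) - 2) / 2) k * \<bar>f y\<bar> \<partial>sphere_measure)"
  proof (rule integral_mono)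
    show "integrable sphere_measure (\<lambda>y. \<bar>zonal_kernel k x y * f y\<bar>)"
      by (intro integrable_abs integrable_zonal_kernel f x)
  qed (use f zonal_kernel_bounded[OF x] in \<open>auto simp: abs_mult space_sphere_measure intro!: mult_right_mono\<close>)
  finally show ?thesis by simp
qed

lemma sphere_proj_linear:
  fixes x :: "'a::euclidean_space"
  assumes "integrable sphere_measure f" "integrable sphere_measure g" and x: "norm x = 1"
  shows "sphere_proj k (\<lambda>y. f y + c * g y) x = sphere_proj k f x + c * sphere_proj k g x"
proof -
  have "sphere_proj k (\<lambda>y. f y + c * g y) x = (\<integral>y. zonal_kernel k x y * f y + c * (zonal_kernel k x y * g y) \<partial>sphere_measure)"
    by (simp add: sphere_proj_def algebra_simps)
  also have "\<dots> = sphere_proj k f x + c * sphere_proj k g x"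
    unfolding sphere_proj_def using integrable_zonal_kernel[OF _ x] assms by simp
  finally show ?thesis .
qed

lemma continuous_sphere_proj:
  assumes f: "integrable sphere_measure (f :: 'a::euclidean_space \<Rightarrow> real)"
  shows "continuous_on (sphere 0 1) (sphere_proj k f)"
proof (rule continuous_on_sequentiallyI)
  fix u :: "nat \<Rightarrow> 'a" and a
  assume u: "\<forall>n. u n \<in> sphere 0 1" and a: "a \<in> sphere 0 1" and lim: "u \<longlonglongrightarrow> a"
  have [measurable]: "f \<in> borel_measurable sphere_measure" using f by simp
  show "(\<lambda>n. sphere_proj k f (u n)) \<longlonglongrightarrow> sphere_proj k f a"
    unfolding sphere_proj_def
  proof (rule integral_dominated_convergence)
    show "integrable sphere_measure (\<lambda>y. zonal_bound ((real DIM('a) - 2) / 2) k * \<bar>f y\<bar>)" using f by simp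
    show "AE y in sphere_measure. norm (zonal_kernel k (u n) y * f y) \<le> zonal_bound ((real DIM('a) - 2) / 2) k * \<bar>f y\<bar>" for n
      using zonal_kernel_bounded[of "u n"] u
      by (intro AE_I2) (auto simp: abs_mult space_sphere_measure intro!: mult_right_mono)
    show "AE y in sphere_measure. (\<lambda>n. zonal_kernel k (u n) y * f y) \<longlonglongrightarrow> zonal_kernel k a y * f y"
    proof (rule AE_I2)
      fix y
      have "(\<lambda>n. zonal_poly ((real DIM('a) - 2) / 2) k (u n \<bullet> y)) \<longlonglongrightarrow> zonal_poly ((real DIM('a) - 2) / 2) k (a \<bullet> y)"
        by (rule continuous_on_tendsto_compose[OF continuous_zonal_poly[of UNIV]])
          (auto intro!: tendsto_intros lim)
      then show "(\<lambda>n. zonal_kernel k (u n) y * f y) \<longlonglongrightarrow> zonal_kernel k a y * f y"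
        unfolding zonal_kernel_eq by (intro tendsto_intros)
    qed
  qed measurable
qed

lemma closed_condition_sets:
  fixes F :: "real \<Rightarrow> 'a::euclidean_space \<Rightarrow> real"
  assumes "\<And>R. continuous_on (sphere 0 1) (F R)"
  shows "{x \<in> space sphere_measure. \<forall>R. 0 < R \<and> R < r \<longrightarrow> \<bar>F R x\<bar> \<le> a} \<in> sets sphere_measure"
proof (rule sets_sphere_measureI)
  have "closed (sphere 0 1 \<inter> (\<Inter>R\<in>{0<..<r}. {x \<in> sphere 0 1. \<bar>F R x\<bar> \<le> a}))"
    using assms by (intro closed_Int closed_INT ballI closed_sphere continuous_on_closed_Collect_le continuous_intros) auto
  also have "sphere 0 1 \<inter> (\<Inter>R\<in>{0<..<r}. {x \<in> sphere 0 1. \<bar>F R x\<bar> \<le> a}) = {x \<in> space sphere_measure. \<forall>R. 0 < R \<and> R < r \<longrightarrow> \<bar>F R x\<bar> \<le> a}"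
    by (auto simp: space_sphere_measure)
  finally show "{x \<in> space sphere_measure. \<forall>R. 0 < R \<and> R < r \<longrightarrow> \<bar>F R x\<bar> \<le> a} \<in> sets borel"
    by (rule borel_closed)
qed (auto simp: space_sphere_measure)

lemma riesz_weight_bounds:
  assumes "0 \<le> \<delta>" "real k < R"
  shows "0 \<le> (1 - real k / R) powr \<delta>" "(1 - real k / R) powr \<delta> \<le> 1"
proof -
  have "0 \<le> 1 - real k / R" "1 - real k / R \<le> 1" using assms by (auto simp: field_simps)
  then show "(1 - real k / R) powr \<delta> \<le> 1" using assms(1) powr_mono2[of \<delta> "1 - real k / R" 1] by simp
qed simp

lemma riesz_mean_eq_riesz_sum: "riesz_mean \<delta> R f x = riesz_sum \<delta> (\<lambda>k. sphere_proj k f x) R"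
  by (simp add: riesz_mean_def riesz_sum_def)

lemma riesz_sum_abs_le:
  assumes "0 \<le> \<delta>" "\<And>k. real k < R \<Longrightarrow> \<bar>a k\<bar> \<le> b k"
  shows "\<bar>riesz_sum \<delta> a R\<bar> \<le> (\<Sum>k | real k < R. b k)"
proof -
  have "\<bar>riesz_sum \<delta> a R\<bar> \<le> (\<Sum>k | real k < R. \<bar>(1 - real k / R) powr \<delta> * a k\<bar>)"
    unfolding riesz_sum_def by (rule sum_abs)
  also have "\<dots> \<le> (\<Sum>k | real k < R. b k)"
  proof (rule sum_mono)
    fix k assume "k \<in> {k. real k < R}"
    then have k: "real k < R" by simp
    have "\<bar>(1 - real k / R) powr \<delta> * a k\<bar> \<le> 1 * \<bar>a k\<bar>"
      unfolding abs_mult using riesz_weight_bounds[OF assms(1) k] by (intro mult_right_mono) auto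
    also have "\<dots> \<le> b k" using assms(2)[OF k] by simp
    finally show "\<bar>(1 - real k / R) powr \<delta> * a k\<bar> \<le> b k" .
  qed
  finally show ?thesis .
qed

lemma riesz_sum_diff: "riesz_sum \<delta> a R - riesz_sum \<delta> b R = riesz_sum \<delta> (\<lambda>k. a k - b k) R"
  by (simp add: riesz_sum_def sum_subtractf right_diff_distrib)

text \<open>
  Each Riesz mean is a finite sum of integrals against continuous kernels. It is therefore bounded
  for bounded \<open>R\<close>, and it is continuous in \<open>x\<close>, so the set where the means stay small is closed.
\<close>

lemma L1_means_riesz:
  assumes "\<delta> \<ge> 0"
  shows "L1_means (sphere_measure :: 'a::euclidean_space measure) (riesz_mean \<delta>)
    (\<lambda>r. \<Sum>k | real k < r. zonal_bound ((real DIM('a) - 2) / 2) k)"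
proof (intro L1_means.intro finite_sphere_measure L1_means_axioms.intro)
  let ?b = "zonal_bound ((real DIM('a) - 2) / 2)"
  fix f g :: "'a \<Rightarrow> real" and x :: 'a and R c r a :: real
  assume f: "integrable sphere_measure f"
  {
    assume g: "integrable sphere_measure g" and x: "x \<in> space sphere_measure"
    show "riesz_mean \<delta> R (\<lambda>x. f x + c * g x) x = riesz_mean \<delta> R f x + c * riesz_mean \<delta> R g x"
      using sphere_proj_linear[OF f g] x
      by (simp add: riesz_mean_def space_sphere_measure sum.distrib sum_distrib_left algebra_simps)
  }
  {
    assume x: "x \<in> space sphere_measure" and R: "0 < R" "R < r"
    have "\<bar>riesz_mean \<delta> R f x\<bar> \<le> (\<Sum>k | real k < R. ?b k * (\<integral>x. \<bar>f x\<bar> \<partial>sphere_measure))"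
      unfolding riesz_mean_eq_riesz_sum using sphere_proj_bound[OF f] x
      by (intro riesz_sum_abs_le assms) (simp add: space_sphere_measure)
    also have "\<dots> \<le> (\<Sum>k | real k < r. ?b k * (\<integral>x. \<bar>f x\<bar> \<partial>sphere_measure))"
      using R by (intro sum_mono2 finite_nat_less_real mult_nonneg_nonneg zonal_bound_nonneg integral_nonneg_AE) auto
    finally show "\<bar>riesz_mean \<delta> R f x\<bar> \<le> (\<Sum>k | real k < r. ?b k) * (\<integral>x. \<bar>f x\<bar> \<partial>sphere_measure)"
      by (simp add: sum_distrib_right)
  }
  show "{x \<in> space sphere_measure. \<forall>R. 0 < R \<and> R < r \<longrightarrow> \<bar>riesz_mean \<delta> R f x\<bar> \<le> a} \<in> sets sphere_measure"
    unfolding riesz_mean_def by (intro closed_condition_sets continuous_intros continuous_sphere_proj f)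
next
  show "mono (\<lambda>r. \<Sum>k | real k < r. zonal_bound ((real DIM('a) - 2) / 2) k)"
    by (intro monoI sum_mono2 finite_nat_less_real zonal_bound_nonneg) auto
  show "0 \<le> (\<Sum>k | real k < r. zonal_bound ((real DIM('a) - 2) / 2) k)" for r
    by (intro sum_nonneg zonal_bound_nonneg)
qed

text \<open>
  Only finitely many zonal kernels enter the means with \<open>R < N\<close>, and they are uniformly continuous.
  Spreading each point mass uniformly over a sufficiently small cap thus changes each projection by
  at most \<open>1 / (N + 1)\<close>.
\<close>

lemma smoothing_of_point_masses:
  fixes p :: "nat \<Rightarrow> 'a::euclidean_space"
  assumes D: "DIM('a) = n + 1" and \<delta>: "\<delta> \<ge> 0"
    and I: "finite I" and m: "\<And>i. i \<in> I \<Longrightarrow> m i \<ge> 0" "(\<Sum>i\<in>I. m i) = 1"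
    and p: "\<And>i. i \<in> I \<Longrightarrow> norm (p i) = 1"
  shows "\<exists>f. integrable sphere_measure f \<and> (\<integral>x. \<bar>f x\<bar> \<partial>sphere_measure) \<le> 1 \<and>
     (\<forall>x R. norm x = 1 \<and> R < real N \<longrightarrow>
        \<bar>riesz_mean \<delta> R f x - riesz_sum \<delta> (\<lambda>k. \<Sum>i\<in>I. m i * zonal_kernel k x (p i)) R\<bar> \<le> 1)"
proof -
  let ?l = "(real DIM('a) - 2) / 2"
  let ?S = "sphere_measure :: 'a measure"
  have "\<exists>d>0. \<forall>s\<in>{-1..1}. \<forall>t\<in>{-1..1}. \<bar>s - t\<bar> < d \<longrightarrow> \<bar>zonal_poly ?l k s - zonal_poly ?l k t\<bar> \<le> 1 / (real N + 1)" for k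
    using compact_uniformly_continuous[OF continuous_zonal_poly[of "{-1..1}" ?l k]]
    unfolding uniformly_continuous_on_def dist_real_def
    by (metis compact_Icc less_imp_le of_nat_0_le_iff add_nonneg_pos zero_less_divide_1_iff zero_less_one)
  then obtain d where d: "\<And>k. d k > 0" "\<And>k s t. s \<in> {-1..1} \<Longrightarrow> t \<in> {-1..1} \<Longrightarrow> \<bar>s - t\<bar> < d k \<Longrightarrow>
      \<bar>zonal_poly ?l k s - zonal_poly ?l k t\<bar> \<le> 1 / (real N + 1)"
    by metis
  have "Min (insert 1 (d ` {..<N})) > 0" using d(1) by (subst Min_gr_iff) auto
  from real_arch_pow_inv[OF this, of "1/2"]
  obtain j where j': "(1/2) ^ j < Min (insert 1 (d ` {..<N}))" by auto
  have j: "(1/2) ^ j < d k" if "k < N" for k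
    using less_le_trans[OF j' Min_le] that by simp
  define r :: real where "r = (1/2) ^ (j + 1)"
  have rd: "r < d k" if "k < N" for k using j[OF that] d(1)[of k] by (simp add: r_def)
  define w where "w = (\<lambda>i. measure ?S (cap (p i) r))"
  have w: "w i > 0" if "i \<in> I" for i
  proof -
    have "0 < ((1/2) ^ (j + 1)) ^ n / (2 * 4 ^ (n + 1) :: real)" by simp
    also have "\<dots> \<le> w i" unfolding w_def r_def by (rule cap_measure_ge[OF p[OF that] D])
    finally show ?thesis .
  qed
  define f where "f = (\<lambda>y. \<Sum>i\<in>I. m i / w i * indicator (cap (p i) r) y)"
  have ci: "integrable ?S (indicator (cap (p i) r) :: _ \<Rightarrow> real)" for i
    by (simp add: integrable_indicator_iff cap_sets sets.Int_space_eq2 sphere.emeasure_eq_measure)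
  have cint: "(\<integral>y. indicator (cap (p i) r) y \<partial>?S) = w i" for i
    by (simp add: cap_sets sets.Int_space_eq2 w_def)
  have fi: "integrable ?S f" unfolding f_def using ci by (intro Bochner_Integration.integrable_sum integrable_mult_right)
  have abs_f: "\<bar>f y\<bar> = f y" for y
    unfolding f_def using m(1) w by (intro abs_of_nonneg sum_nonneg mult_nonneg_nonneg divide_nonneg_pos) auto
  have "(\<integral>y. \<bar>f y\<bar> \<partial>?S) = (\<Sum>i\<in>I. m i / w i * w i)"
    unfolding abs_f unfolding f_def
    by (subst Bochner_Integration.integral_sum) (use ci in \<open>auto simp only: integral_mult_right_zero cint integrable_mult_right\<close>)
  also have "\<dots> = (\<Sum>i\<in>I. m i)" using w[THEN less_imp_neq] by (intro sum.cong) auto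
  finally have fnorm: "(\<integral>y. \<bar>f y\<bar> \<partial>?S) \<le> 1" using m(2) by simp
  have close: "\<bar>sphere_proj k f x - (\<Sum>i\<in>I. m i * zonal_kernel k x (p i))\<bar> \<le> 1 / (real N + 1)"
    if x: "norm x = 1" and k: "k < N" for k x
  proof -
    have each: "\<bar>(\<integral>y. zonal_kernel k x y * indicator (cap (p i) r) y \<partial>?S) - w i * zonal_kernel k x (p i)\<bar> \<le> w i * (1 / (real N + 1))"
      if i: "i \<in> I" for i
    proof -
      have zi: "integrable ?S (\<lambda>y. zonal_kernel k x y * indicator (cap (p i) r) y)"
        by (rule integrable_zonal_kernel[OF ci x])
      have "(\<integral>y. zonal_kernel k x y * indicator (cap (p i) r) y \<partial>?S) - w i * zonal_kernel k x (p i)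
        = (\<integral>y. zonal_kernel k x y * indicator (cap (p i) r) y - zonal_kernel k x (p i) * indicator (cap (p i) r) y \<partial>?S)"
        using zi ci by (simp only: Bochner_Integration.integral_diff integrable_mult_right integral_mult_right_zero cint mult.commute)
      also have "\<bar>\<dots>\<bar> \<le> (\<integral>y. \<bar>zonal_kernel k x y * indicator (cap (p i) r) y - zonal_kernel k x (p i) * indicator (cap (p i) r) y\<bar> \<partial>?S)"
        by (rule integral_abs_bound)
      also have "\<dots> \<le> (\<integral>y. 1 / (real N + 1) * indicator (cap (p i) r) y \<partial>?S)"
      proof (rule integral_mono)
        show "integrable ?S (\<lambda>y. \<bar>zonal_kernel k x y * indicator (cap (p i) r) y - zonal_kernel k x (p i) * indicator (cap (p i) r) y\<bar>)"
          using zi ci by (intro integrable_abs Bochner_Integration.integrable_diff integrable_mult_right)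
        show "integrable ?S (\<lambda>y. 1 / (real N + 1) * indicator (cap (p i) r) y)"
          using ci by (intro integrable_mult_right)
        fix y assume "y \<in> space ?S"
        show "\<bar>zonal_kernel k x y * indicator (cap (p i) r) y - zonal_kernel k x (p i) * indicator (cap (p i) r) y\<bar> \<le> 1 / (real N + 1) * indicator (cap (p i) r) y"
        proof (cases "y \<in> cap (p i) r")
          case True
          then have y: "norm y = 1" "dist (p i) y < r" by (auto simp: cap_def)
          have "\<bar>x \<bullet> y - x \<bullet> p i\<bar> \<le> norm x * norm (y - p i)"
            unfolding inner_diff_right[symmetric] by (rule Cauchy_Schwarz_ineq2)
          also have "\<dots> < d k" using x y rd[OF k] by (simp add: dist_norm norm_minus_commute)
          finally have "\<bar>zonal_kernel k x y - zonal_kernel k x (p i)\<bar> \<le> 1 / (real N + 1)"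
            unfolding zonal_kernel_eq by (intro d(2) inner_sphere_bounds x y p i)
          then show ?thesis using True by simp
        qed simp
      qed
      also have "\<dots> = w i * (1 / (real N + 1))"
        unfolding integral_mult_right_zero cint by (rule mult.commute)
      finally show ?thesis .
    qed
    have "sphere_proj k f x = (\<integral>y. (\<Sum>i\<in>I. m i / w i * (zonal_kernel k x y * indicator (cap (p i) r) y)) \<partial>?S)"
      unfolding sphere_proj_def f_def sum_distrib_left by (simp add: mult_ac)
    also have "\<dots> = (\<Sum>i\<in>I. m i / w i * (\<integral>y. zonal_kernel k x y * indicator (cap (p i) r) y \<partial>?S))"
      using integrable_zonal_kernel[OF ci x] by (subst Bochner_Integration.integral_sum) auto
    finally have sp: "sphere_proj k f x = (\<Sum>i\<in>I. m i / w i * (\<integral>y. zonal_kernel k x y * indicator (cap (p i) r) y \<partial>?S))" .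
    have "\<bar>sphere_proj k f x - (\<Sum>i\<in>I. m i * zonal_kernel k x (p i))\<bar>
      = \<bar>\<Sum>i\<in>I. m i / w i * ((\<integral>y. zonal_kernel k x y * indicator (cap (p i) r) y \<partial>?S) - w i * zonal_kernel k x (p i))\<bar>"
    proof -
      have "m i * zonal_kernel k x (p i) = m i / w i * (w i * zonal_kernel k x (p i))" if "i \<in> I" for i
        using w[OF that] by simp
      then have pm: "(\<Sum>i\<in>I. m i * zonal_kernel k x (p i)) = (\<Sum>i\<in>I. m i / w i * (w i * zonal_kernel k x (p i)))"
        by (intro sum.cong) auto
      show ?thesis
        unfolding sp pm by (simp only: sum_subtractf[symmetric] right_diff_distrib[symmetric])
    qed
    also have "\<dots> \<le> (\<Sum>i\<in>I. \<bar>m i / w i * ((\<integral>y. zonal_kernel k x y * indicator (cap (p i) r) y \<partial>?S) - w i * zonal_kernel k x (p i))\<bar>)"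
      by (rule sum_abs)
    also have "\<dots> \<le> (\<Sum>i\<in>I. m i * (1 / (real N + 1)))"
    proof (rule sum_mono)
      fix i assume i: "i \<in> I"
      have "\<bar>m i / w i * ((\<integral>y. zonal_kernel k x y * indicator (cap (p i) r) y \<partial>?S) - w i * zonal_kernel k x (p i))\<bar>
        \<le> m i / w i * (w i * (1 / (real N + 1)))"
        unfolding abs_mult using each[OF i] m(1)[OF i] w[OF i] by (intro mult_mono) auto
      then show "\<bar>m i / w i * ((\<integral>y. zonal_kernel k x y * indicator (cap (p i) r) y \<partial>?S) - w i * zonal_kernel k x (p i))\<bar> \<le> m i * (1 / (real N + 1))"
        using w[OF i] by simp
    qed
    also have "\<dots> = 1 / (real N + 1)" unfolding sum_distrib_right[symmetric] m(2) by simp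
    finally show ?thesis .
  qed
  have "\<bar>riesz_mean \<delta> R f x - riesz_sum \<delta> (\<lambda>k. \<Sum>i\<in>I. m i * zonal_kernel k x (p i)) R\<bar> \<le> 1"
    if x: "norm x = 1" and R: "R < real N" for x R
  proof -
    have "\<bar>riesz_mean \<delta> R f x - riesz_sum \<delta> (\<lambda>k. \<Sum>i\<in>I. m i * zonal_kernel k x (p i)) R\<bar> \<le> (\<Sum>k | real k < R. 1 / (real N + 1))"
      unfolding riesz_mean_eq_riesz_sum riesz_sum_diff
      using R by (intro riesz_sum_abs_le \<delta> close x) auto
    also have "\<dots> \<le> (\<Sum>k<N. 1 / (real N + 1))"
      using R by (intro sum_mono2) auto
    also have "\<dots> \<le> 1" by simp
    finally show ?thesis .
  qed
  then show ?thesis using fi fnorm by blast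
qed

text \<open>
  By \<open>resonance\<close> the means of suitable point masses exceed \<open>a + 1\<close> for some \<open>R > 0\<close>, at almost every
  point. By continuity of the measure a bounded range of \<open>R\<close> suffices outside a set of measure less
  than \<open>\<epsilon>\<close>, and on a bounded range smoothing costs at most \<open>1\<close>.
\<close>

lemma riesz_mean_peaks:
  fixes a \<epsilon> :: real
  assumes D: "DIM('a::euclidean_space) = n + 1" "n \<ge> 2" and l: "l = (real n - 1) / 2" and \<epsilon>: "\<epsilon> > 0"
  shows "\<exists>(f :: 'a \<Rightarrow> real) r. integrable sphere_measure f \<and> (\<integral>x. \<bar>f x\<bar> \<partial>sphere_measure) \<le> 1 \<and>
     measure sphere_measure {x \<in> space sphere_measure. \<forall>R. 0 < R \<and> R < r \<longrightarrow> \<bar>riesz_mean l R f x\<bar> \<le> a} \<le> \<epsilon>"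
proof -
  have l0: "l > 0" using D l by simp
  have lD: "l = (real DIM('a) - 2) / 2" using D l by simp
  from exists_resonating_points[OF D l, where M = "a + 2"]
  obtain I :: "nat set" and m :: "nat \<Rightarrow> real" and p :: "nat \<Rightarrow> 'a"
    where I: "finite I" and m: "\<And>i. i \<in> I \<Longrightarrow> m i \<ge> 0" "(\<Sum>i\<in>I. m i) = 1" and p: "\<And>i. i \<in> I \<Longrightarrow> norm (p i) = 1"
    and ind: "AE x in sphere_measure. independent_angles I p x"
    and big: "\<And>x. norm x = 1 \<Longrightarrow> independent_angles I p x \<Longrightarrow>
        (\<forall>i\<in>I. 0 < angle x (p i) \<and> angle x (p i) < pi) \<and>
        a + 2 \<le> (\<Sum>i\<in>I. m i * (angle x (p i) powr (- l - 1) * (2 * sin (angle x (p i))) powr (- l)))"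
    by blast
  define P where "P = (\<lambda>R x. riesz_sum l (\<lambda>k. \<Sum>i\<in>I. m i * zonal_kernel k x (p i)) R)"
  \<comment> \<open>The points whose means stay below \<open>a + 1\<close> in the range \<open>R < j\<close>; they decrease to a null set.\<close>
  define B where "B = (\<lambda>j::nat. {x \<in> space (sphere_measure :: 'a measure). \<forall>R. 0 < R \<and> R < real j \<longrightarrow> \<bar>P R x\<bar> \<le> a + 1})"
  have "continuous_on (sphere 0 1) (P R)" for R
    unfolding P_def riesz_sum_def zonal_kernel_eq
    by (intro continuous_intros continuous_on_compose2[OF continuous_zonal_poly[of UNIV]]) auto
  then have Bs: "B j \<in> sets sphere_measure" for j
    unfolding B_def by (rule closed_condition_sets)
  have ae: "AE x in sphere_measure. x \<notin> (\<Inter>j. B j)"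
    using ind AE_space
  proof eventually_elim
    case (elim x)
    then have x: "norm x = 1" by (simp add: space_sphere_measure)
    show ?case
    proof
      assume xB: "x \<in> (\<Inter>j. B j)"
      have "\<bar>P R x\<bar> \<le> a + 1" if R: "R > 0" for R
      proof -
        obtain j :: nat where "R < real j" using reals_Archimedean2 by blast
        then show ?thesis using xB R by (auto simp: B_def)
      qed
      moreover have "P R x = riesz_sum l (\<lambda>k. \<Sum>i\<in>I. m i * zonal_coeff l (angle x (p i)) k) R" for R
        unfolding P_def lD using zonal_coeff_angle[OF x p] by (simp cong: sum.cong)
      ultimately have "(\<Sum>i\<in>I. m i * (angle x (p i) powr (- l - 1) * (2 * sin (angle x (p i))) powr (- l))) \<le> a + 1"
        using big[OF x elim(1)] elim(1)
        by (intro resonance[OF l0 I _ m(1)]) (auto simp: independent_angles_def)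
      then show False using big[OF x elim(1)] by linarith
    qed
  qed
  have "(\<Inter>j. B j) \<in> sets sphere_measure" using Bs by (intro sets.countable_INT) auto
  from AE_iff_null_sets[OF this] ae have "(\<Inter>j. B j) \<in> null_sets sphere_measure"
    by blast
  then have "measure sphere_measure (\<Inter>j. B j) = 0"
    by (rule measure_eq_0_null_sets)
  moreover have "decseq B"
    unfolding decseq_def B_def by (auto intro: less_le_trans)
  ultimately have "(\<lambda>j. measure sphere_measure (B j)) \<longlonglongrightarrow> 0"
    using sphere.finite_Lim_measure_decseq[of B] Bs by auto
  from order_tendstoD(2)[OF this \<epsilon>] obtain N where N: "measure sphere_measure (B N) < \<epsilon>"
    by (auto simp: eventually_sequentially)
  have "\<exists>f. integrable sphere_measure f \<and> (\<integral>x. \<bar>f x\<bar> \<partial>sphere_measure) \<le> 1 \<and>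
     (\<forall>x R. norm x = 1 \<and> R < real N \<longrightarrow> \<bar>riesz_mean l R f x - P R x\<bar> \<le> 1)"
    unfolding P_def
  proof (rule smoothing_of_point_masses[OF D(1) _ I])
    show "0 \<le> l" using l0 by simp
  qed (fact m p)+
  then obtain f where f: "integrable sphere_measure f" "(\<integral>x. \<bar>f x\<bar> \<partial>sphere_measure) \<le> 1"
    and close: "\<forall>x R. norm x = 1 \<and> R < real N \<longrightarrow> \<bar>riesz_mean l R f x - P R x\<bar> \<le> 1"
    by blast
  have "{x \<in> space sphere_measure. \<forall>R. 0 < R \<and> R < real N \<longrightarrow> \<bar>riesz_mean l R f x\<bar> \<le> a} \<subseteq> B N"
  proof
    fix x assume "x \<in> {x \<in> space sphere_measure. \<forall>R. 0 < R \<and> R < real N \<longrightarrow> \<bar>riesz_mean l R f x\<bar> \<le> a}"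
    then have x: "x \<in> space sphere_measure" "norm x = 1" and q: "\<And>R. 0 < R \<Longrightarrow> R < real N \<Longrightarrow> \<bar>riesz_mean l R f x\<bar> \<le> a"
      by (auto simp: space_sphere_measure)
    have "\<bar>P R x\<bar> \<le> a + 1" if "0 < R" "R < real N" for R
    proof -
      have "\<bar>riesz_mean l R f x - P R x\<bar> \<le> 1" using close x that by blast
      with q[OF that] show ?thesis by linarith
    qed
    then show "x \<in> B N" using x by (simp add: B_def)
  qed
  then have "measure sphere_measure {x \<in> space sphere_measure. \<forall>R. 0 < R \<and> R < real N \<longrightarrow> \<bar>riesz_mean l R f x\<bar> \<le> a} \<le> measure sphere_measure (B N)"
    using Bs by (intro sphere.finite_measure_mono)
  then show ?thesis using f N by (intro exI[of _ f] exI[of _ "real N"]) auto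
qed

lemma unbounded_imp_Limsup:
  fixes F :: "real \<Rightarrow> real"
  assumes loc: "\<And>r. \<exists>c. \<forall>R. 0 < R \<and> R < r \<longrightarrow> \<bar>F R\<bar> \<le> c" and unb: "\<And>a. \<exists>R>0. a < \<bar>F R\<bar>"
  shows "Limsup at_top (\<lambda>R. ereal \<bar>F R\<bar>) = \<infinity>"
proof (rule ccontr)
  assume "\<not> ?thesis"
  then obtain a :: nat where "Limsup at_top (\<lambda>R. ereal \<bar>F R\<bar>) < ereal (real a)"
    by (auto simp: less_PInf_Ex_of_nat)
  then have "eventually (\<lambda>R. ereal \<bar>F R\<bar> < ereal (real a)) at_top"
    by (rule Limsup_lessD)
  then obtain r where r: "\<And>R. R \<ge> r \<Longrightarrow> \<bar>F R\<bar> < real a"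
    by (auto simp: eventually_at_top_linorder)
  obtain c where c: "\<forall>R. 0 < R \<and> R < r \<longrightarrow> \<bar>F R\<bar> \<le> c" using loc by blast
  obtain R where R: "R > 0" "max (real a) c < \<bar>F R\<bar>" using unb by blast
  then show False using r[of R] c by (cases "R < r") force+
qed

theorem corollary1:
  fixes n :: nat
  assumes "n \<ge> 2" and "CARD('d::finite) = n + 1"
  shows "\<exists>f :: real ^ 'd \<Rightarrow> real.
           integrable sphere_measure f \<and>
           (AE x in sphere_measure.
              Limsup at_top (\<lambda>R::real. ereal \<bar>riesz_mean ((real n - 1) / 2) R f x\<bar>) = \<infinity>)"
proof -
  define l where "l = (real n - 1) / 2"
  have D: "DIM(real ^ 'd) = n + 1" using assms by simp
  have l0: "l \<ge> 0" using assms by (simp add: l_def)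
  interpret L1_means "sphere_measure :: (real ^ 'd) measure" "riesz_mean l"
    "\<lambda>r. \<Sum>k | real k < r. zonal_bound ((real DIM(real ^ 'd) - 2) / 2) k"
    by (rule L1_means_riesz[OF l0])
  obtain f :: "real ^ 'd \<Rightarrow> real" where f: "integrable sphere_measure f"
    "AE x in sphere_measure. \<forall>a. \<exists>R>0. a < \<bar>riesz_mean l R f x\<bar>"
    using divergence_almost_everywhere riesz_mean_peaks[OF D assms(1) l_def] unfolding quiet_def by blast
  have "AE x in sphere_measure. Limsup at_top (\<lambda>R::real. ereal \<bar>riesz_mean l R f x\<bar>) = \<infinity>"
    using f(2) AE_space
  proof eventually_elim
    case (elim x)
    then show ?case using bound[OF f(1) elim(2)] by (intro unbounded_imp_Limsup) blast+
  qed
  then show ?thesis using f(1) unfolding l_def by blast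
qed

end
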